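(* Let $\mathcal H_N(q,s)$ be the $K$-algebra of $K$-linear operators on $K[x_1^{\pm1},\dots,x_N^{\pm1}]$ generated by the operators $T_1^x,\dots,T_{N-1}^x$, $(w^x)^{\pm1}$ and multiplication by $x_1^{\pm1},\dots,x_N^{\pm1}$. Then the assignment $T_i^x\mapsto\mathbf T_i$, $w^x\mapsto\mathbf w$, $x_i\mapsto x_i$ extends to an algebra isomorphism from $\mathcal H_N(q,s)$ onto the $K$-algebra of operators on $K[x_1^{\pm1},\dots,x_N^{\pm1}]\otimes_K V_\lambda$ generated by $\mathbf T_1,\dots,\mathbf T_{N-1}$, $\mathbf w^{\pm1}$, $x_1^{\pm1},\dots,x_N^{\pm1}$.
   Context: $N\ge2$, $q,s$ indeterminates, $K=\mathbb C(q,s)$. All operators act on the right and products are composed left to right ($fAB=(fA)B$). For a (Laurent) polynomial $p$, $p^{s_i}$ denotes $p$ with $x_i$ and $x_{i+1}$ exchanged. On $K[x^{\pm1}]$: $pT_i^x=(1-s)\frac{x_{i+1}(p-p^{s_i})}{x_i-x_{i+1}}+s\,p^{s_i}$ and $pw^x=p(qx_N,x_1,\dots,x_{N-1})$. $\mathcal H_N(s)$ is the $K$-algebra generated by $T_1,\dots,T_{N-1}$ with $(T_i+1)(T_i-s)=0$, $T_iT_{i+1}T_i=T_{i+1}T_iT_{i+1}$, $T_iT_j=T_jT_i$ ($|i-j|>1$). $\lambda$ is a partition of $N$ (French convention, rows numbered bottom to top); $\mathrm{Tab}_\lambda$ is the set of reverse standard tableaux (bijective fillings by $1,\dots,N$ strictly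 decreasing left to right along rows and bottom to top along columns); $\mathrm{CT}_{\mathbb T}[i]$ = column minus row of the cell of $i$; $\mathbb T^{(i,j)}$ exchanges $i,j$. $V_\lambda$ is the $K$-space with basis $\mathrm{Tab}_\lambda$ and right $\mathcal H_N(s)$-action: $\mathbb TT_i=s\mathbb T$ if $i,i+1$ in the same row; $-\mathbb T$ if in the same column; if $i$ is in a higher row than $i+1$, with $m=\mathrm{CT}_{\mathbb T}[i+1]-\mathrm{CT}_{\mathbb T}[i]>0$, $\mathbb TT_i=\frac{s-1}{1-s^m}\mathbb T+\frac{s(1-s^{m+1})(1-s^{m-1})}{(1-s^m)^2}\mathbb T^{(i,i+1)}$; otherwise determined by this formula for $\mathbb T^{(i,i+1)}$ and the quadratic relation. On $K[x^{\pm1}]\otimes V_\lambda$: $(p\otimes u)\mathbf T_i=(1-s)\frac{x_{i+1}(p-p^{s_i})}{x_i-x_{i+1}}\otimes u+p^{s_i}\otimes uT_i$; $(p\otimes u)\mathbf w=p(qx_N,x_1,\dots,x_{N-1})\otimes uT_1T_2\cdots T_{N-1}$; $(p\otimes u)x_i=x_ip\otimes u$. *)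

theory Defs
  imports Main "HOL-Library.Poly_Mapping" "HOL-Computational_Algebra.Polynomial"
    "HOL-Computational_Algebra.Fraction_Field"
begin

text \<open>K = C(q,s) realised as the fraction field of C[q][s]; q is the inner
  polynomial variable, s the outer one (two algebraically independent indeterminates).\<close>
type_synonym K = "complex poly poly fract"

definition qK :: K where "qK = Fract [:[:0, 1:]:] 1"
definition sK :: K where "sK = Fract [:0, 1:] 1"

text \<open>Laurent monomials are finitely supported exponent vectors nat =>0 int
  (variable x_k has index k, k = 1..N); Laurent polynomials are finitely supported
  coefficient functions on monomials.  The space K[x_1^{+-1},...,x_N^{+-1}] is the
  carrier LP N.\<close>
type_synonym mono = "nat \<Rightarrow>\<^sub>0 int"
type_synonym lpoly = "mono \<Rightarrow>\<^sub>0 K"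

definition LP :: "nat \<Rightarrow> lpoly set" where
  "LP N = {p. \<forall>m\<in>Poly_Mapping.keys p. Poly_Mapping.keys m \<subseteq> {1..N}}"

definition lconst :: "K \<Rightarrow> lpoly" where
  "lconst c = Poly_Mapping.single 0 c"

definition Xv :: "nat \<Rightarrow> lpoly" where
  "Xv i = Poly_Mapping.single (Poly_Mapping.single i 1) 1"

definition Xinv :: "nat \<Rightarrow> lpoly" where
  "Xinv i = Poly_Mapping.single (Poly_Mapping.single i (-1)) 1"

definition mono_perm :: "(nat \<Rightarrow> nat) \<Rightarrow> mono \<Rightarrow> mono" where
  "mono_perm \<sigma> m = Abs_poly_mapping (\<lambda>k. Poly_Mapping.lookup m (\<sigma> k))"

definition lp_map :: "(mono \<Rightarrow> K) \<Rightarrow> (mono \<Rightarrow> mono) \<Rightarrow> lpoly \<Rightarrow> lpoly" where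
  "lp_map c \<tau> p = (\<Sum>m\<in>Poly_Mapping.keys p. Poly_Mapping.single (\<tau> m) (c m * Poly_Mapping.lookup p m))"

definition swp :: "nat \<Rightarrow> nat \<Rightarrow> nat" where
  "swp i k = (if k = i then i + 1 else if k = i + 1 then i else k)"

definition lp_swap :: "nat \<Rightarrow> lpoly \<Rightarrow> lpoly" where
  "lp_swap i p = lp_map (\<lambda>_. 1) (mono_perm (swp i)) p"

text \<open>p(q x_N, x_1, ..., x_{N-1}): x_1^a ~> q^a x_N^a and x_k^a ~> x_{k-1}^a (2 <= k <= N).\<close>
definition cyc :: "nat \<Rightarrow> nat \<Rightarrow> nat" where
  "cyc N j = (if j = N then 1 else if 1 \<le> j \<and> j < N then j + 1 else j)"

definition lp_w :: "nat \<Rightarrow> lpoly \<Rightarrow> lpoly" where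
  "lp_w N p = lp_map (\<lambda>m. qK powi Poly_Mapping.lookup m 1) (mono_perm (cyc N)) p"

definition ddiff :: "nat \<Rightarrow> lpoly \<Rightarrow> lpoly" where
  "ddiff i p = (THE r. (Xv i - Xv (i + 1)) * r = p - lp_swap i p)"

definition ropL :: "nat \<Rightarrow> (lpoly \<Rightarrow> lpoly) \<Rightarrow> lpoly \<Rightarrow> lpoly" where
  "ropL N f = (\<lambda>p. if p \<in> LP N then f p else 0)"

definition TxL :: "nat \<Rightarrow> nat \<Rightarrow> lpoly \<Rightarrow> lpoly" where
  "TxL N i = ropL N (\<lambda>p. lconst (1 - sK) * Xv (i + 1) * ddiff i p + lconst sK * lp_swap i p)"

definition wxL :: "nat \<Rightarrow> lpoly \<Rightarrow> lpoly" where
  "wxL N = ropL N (lp_w N)"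

definition wxL_inv :: "nat \<Rightarrow> lpoly \<Rightarrow> lpoly" where
  "wxL_inv N = ropL N (the_inv_into (LP N) (wxL N))"

definition xL :: "nat \<Rightarrow> nat \<Rightarrow> lpoly \<Rightarrow> lpoly" where
  "xL N i = ropL N (\<lambda>p. Xv i * p)"

definition xL_inv :: "nat \<Rightarrow> nat \<Rightarrow> lpoly \<Rightarrow> lpoly" where
  "xL_inv N i = ropL N (\<lambda>p. Xinv i * p)"

definition is_partition :: "nat \<Rightarrow> nat list \<Rightarrow> bool" where
  "is_partition N lam \<longleftrightarrow> sorted (rev lam) \<and> 0 \<notin> set lam \<and> sum_list lam = N"

text \<open>Cells (row, column), 0-based, row 0 at the bottom, row r has length lam ! r.\<close>
definition cells :: "nat list \<Rightarrow> (nat \<times> nat) set" where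
  "cells lam = {(r, c). r < length lam \<and> c < lam ! r}"

type_synonym tab = "nat \<times> nat \<Rightarrow> nat"

definition Tab :: "nat \<Rightarrow> nat list \<Rightarrow> tab set" where
  "Tab N lam = {T. bij_betw T (cells lam) {1..N} \<and> (\<forall>x. x \<notin> cells lam \<longrightarrow> T x = 0)
     \<and> (\<forall>r c c'. (r, c) \<in> cells lam \<and> (r, c') \<in> cells lam \<and> c < c' \<longrightarrow> T (r, c') < T (r, c))
     \<and> (\<forall>r r' c. (r, c) \<in> cells lam \<and> (r', c) \<in> cells lam \<and> r < r' \<longrightarrow> T (r', c) < T (r, c))}"

definition cellof :: "nat list \<Rightarrow> tab \<Rightarrow> nat \<Rightarrow> nat \<times> nat" where
  "cellof lam T i = (THE x. x \<in> cells lam \<and> T x = i)"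

definition rowof :: "nat list \<Rightarrow> tab \<Rightarrow> nat \<Rightarrow> nat" where
  "rowof lam T i = fst (cellof lam T i)"

definition colof :: "nat list \<Rightarrow> tab \<Rightarrow> nat \<Rightarrow> nat" where
  "colof lam T i = snd (cellof lam T i)"

definition CT :: "nat list \<Rightarrow> tab \<Rightarrow> nat \<Rightarrow> int" where
  "CT lam T i = int (colof lam T i) - int (rowof lam T i)"

definition tswap :: "tab \<Rightarrow> nat \<Rightarrow> nat \<Rightarrow> tab" where
  "tswap T i j = (\<lambda>x. if T x = i then j else if T x = j then i else T x)"

definition coefA :: "int \<Rightarrow> K" where
  "coefA m = (sK - 1) / (1 - sK powi m)"

definition coefB :: "int \<Rightarrow> K" where
  "coefB m = sK * (1 - sK powi (m + 1)) * (1 - sK powi (m - 1)) / (1 - sK powi m)^2"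

text \<open>Tmat lam i T T' = coefficient of T' in T T_i.  The last case is the one
  determined by the formula for T^{(i,i+1)} together with the quadratic relation
  T_i^2 = (s-1) T_i + s:  if U T_i = a U + b T then T T_i = ((s-1)-a) T + ((s-1)a+s-a^2)/b U.\<close>
definition Tmat :: "nat list \<Rightarrow> nat \<Rightarrow> tab \<Rightarrow> tab \<Rightarrow> K" where
  "Tmat lam i T T' =
    (if rowof lam T i = rowof lam T (i + 1) then (if T' = T then sK else 0)
     else if colof lam T i = colof lam T (i + 1) then (if T' = T then -1 else 0)
     else if rowof lam T i > rowof lam T (i + 1) then
       (let m = CT lam T (i + 1) - CT lam T i in
        if T' = T then coefA m else if T' = tswap T i (i + 1) then coefB m else 0)
     else
       (let m = CT lam T i - CT lam T (i + 1); a = coefA m; b = coefB m in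
        if T' = T then (sK - 1) - a
        else if T' = tswap T i (i + 1) then ((sK - 1) * a + sK - a^2) / b else 0))"

text \<open>Matrix of T_1 T_2 ... T_k (right action, row-vector convention).\<close>
fun Mprod :: "nat \<Rightarrow> nat list \<Rightarrow> nat \<Rightarrow> tab \<Rightarrow> tab \<Rightarrow> K" where
  "Mprod N lam 0 T T' = (if T' = T then 1 else 0)"
| "Mprod N lam (Suc k) T T' = (\<Sum>T''\<in>Tab N lam. Mprod N lam k T T'' * Tmat lam (Suc k) T'' T')"

text \<open>An element of K[x^{+-1}] (x) V_lambda is sum_T F(T) (x) T, represented by
  F :: tab => lpoly with F T in LP N and F T = 0 for T not in Tab N lam.\<close>
definition VP :: "nat \<Rightarrow> nat list \<Rightarrow> (tab \<Rightarrow> lpoly) set" where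
  "VP N lam = {F. (\<forall>T. F T \<in> LP N) \<and> (\<forall>T. T \<notin> Tab N lam \<longrightarrow> F T = 0)}"

definition ropV :: "nat \<Rightarrow> nat list \<Rightarrow> ((tab \<Rightarrow> lpoly) \<Rightarrow> (tab \<Rightarrow> lpoly))
    \<Rightarrow> (tab \<Rightarrow> lpoly) \<Rightarrow> (tab \<Rightarrow> lpoly)" where
  "ropV N lam f = (\<lambda>F. if F \<in> VP N lam then f F else (\<lambda>_. 0))"

definition bT :: "nat \<Rightarrow> nat list \<Rightarrow> nat \<Rightarrow> (tab \<Rightarrow> lpoly) \<Rightarrow> (tab \<Rightarrow> lpoly)" where
  "bT N lam i = ropV N lam (\<lambda>F T'. if T' \<in> Tab N lam then
      lconst (1 - sK) * Xv (i + 1) * ddiff i (F T')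
      + (\<Sum>T\<in>Tab N lam. lconst (Tmat lam i T T') * lp_swap i (F T))
    else 0)"

definition bw :: "nat \<Rightarrow> nat list \<Rightarrow> (tab \<Rightarrow> lpoly) \<Rightarrow> (tab \<Rightarrow> lpoly)" where
  "bw N lam = ropV N lam (\<lambda>F T'. if T' \<in> Tab N lam then
      (\<Sum>T\<in>Tab N lam. lconst (Mprod N lam (N - 1) T T') * lp_w N (F T))
    else 0)"

definition bw_inv :: "nat \<Rightarrow> nat list \<Rightarrow> (tab \<Rightarrow> lpoly) \<Rightarrow> (tab \<Rightarrow> lpoly)" where
  "bw_inv N lam = ropV N lam (the_inv_into (VP N lam) (bw N lam))"

definition bx :: "nat \<Rightarrow> nat list \<Rightarrow> nat \<Rightarrow> (tab \<Rightarrow> lpoly) \<Rightarrow> (tab \<Rightarrow> lpoly)" where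
  "bx N lam i = ropV N lam (\<lambda>F T. Xv i * F T)"

definition bx_inv :: "nat \<Rightarrow> nat list \<Rightarrow> nat \<Rightarrow> (tab \<Rightarrow> lpoly) \<Rightarrow> (tab \<Rightarrow> lpoly)" where
  "bx_inv N lam i = ropV N lam (\<lambda>F T. Xinv i * F T)"

inductive_set gen_alg :: "('v \<Rightarrow> 'v) set \<Rightarrow> ('v \<Rightarrow> 'v) \<Rightarrow> ('v \<Rightarrow> 'v \<Rightarrow> 'v)
    \<Rightarrow> (K \<Rightarrow> 'v \<Rightarrow> 'v) \<Rightarrow> ('v \<Rightarrow> 'v) set"
  for G u add sm where
  unit: "u \<in> gen_alg G u add sm"
| gen: "g \<in> G \<Longrightarrow> g \<in> gen_alg G u add sm"
| add: "f \<in> gen_alg G u add sm \<Longrightarrow> g \<in> gen_alg G u add sm \<Longrightarrow> (\<lambda>v. add (f v) (g v)) \<in> gen_alg G u add sm"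
| smul: "f \<in> gen_alg G u add sm \<Longrightarrow> (\<lambda>v. sm c (f v)) \<in> gen_alg G u add sm"
| comp: "f \<in> gen_alg G u add sm \<Longrightarrow> g \<in> gen_alg G u add sm \<Longrightarrow> f \<circ> g \<in> gen_alg G u add sm"

definition addV :: "(tab \<Rightarrow> lpoly) \<Rightarrow> (tab \<Rightarrow> lpoly) \<Rightarrow> (tab \<Rightarrow> lpoly)" where
  "addV F G = (\<lambda>T. F T + G T)"

definition smV :: "K \<Rightarrow> (tab \<Rightarrow> lpoly) \<Rightarrow> (tab \<Rightarrow> lpoly)" where
  "smV c F = (\<lambda>T. lconst c * F T)"

definition HL :: "nat \<Rightarrow> (lpoly \<Rightarrow> lpoly) set" where
  "HL N = gen_alg ({TxL N i | i. 1 \<le> i \<and> i \<le> N - 1} \<union> {wxL N, wxL_inv N}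
                   \<union> {xL N i | i. 1 \<le> i \<and> i \<le> N} \<union> {xL_inv N i | i. 1 \<le> i \<and> i \<le> N})
            (ropL N id) (+) (\<lambda>c p. lconst c * p)"

definition HV :: "nat \<Rightarrow> nat list \<Rightarrow> ((tab \<Rightarrow> lpoly) \<Rightarrow> (tab \<Rightarrow> lpoly)) set" where
  "HV N lam = gen_alg ({bT N lam i | i. 1 \<le> i \<and> i \<le> N - 1} \<union> {bw N lam, bw_inv N lam}
                   \<union> {bx N lam i | i. 1 \<le> i \<and> i \<le> N} \<union> {bx_inv N lam i | i. 1 \<le> i \<and> i \<le> N})
            (ropV N lam id) addV smV"

end

theory Submission
  imports Defs "HOL-Computational_Algebra.Polynomial_Factorial"
begin

text \<open>
  Put \<open>a\<^sub>i = (1 - s) x\<^bsub>i+1\<^esub> / (x\<^sub>i - x\<^bsub>i+1\<^esub>)\<close>. Over the rational functions \<open>T\<^sub>i\<^sup>x = a\<^sub>i + (s - a\<^sub>i) s\<^sub>i\<close>, while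
  \<open>\<^bold>T\<^sub>i = a\<^sub>i + (s - a\<^sub>i) S\<^sub>i\<close> with the normalised intertwiner
  \<open>S\<^sub>i = (s - a\<^sub>i)\<^sup>-\<^sup>1 (T\<^sub>i - a\<^sub>i) \<otimes> s\<^sub>i\<close>. The Hecke relations on \<open>V\<^sub>\<lambda>\<close> say that the \<open>S\<^sub>i\<close> and \<open>\<^bold>w\<close>
  satisfy the defining relations of the extended affine symmetric group (the braid relation is the
  Yang--Baxter equation), just as the field automorphisms \<open>s\<^sub>i\<close> and \<open>w\<close> do. Hence every group
  element \<open>b\<close> acts both by a field automorphism \<open>g\<^sub>b\<close> and by an invertible \<open>g\<^sub>b\<close>-semilinear operator
  \<open>U\<^sub>b\<close>, and the generators of the two algebras have the same expansions \<open>\<Sum> c\<^sub>b g\<^sub>b\<close> and \<open>\<Sum> c\<^sub>b U\<^sub>b\<close>.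
  The \<open>g\<^sub>b\<close> are pairwise distinct, so by Dedekind's independence of characters the coefficients
  \<open>c\<^sub>b\<close> are determined by the operator on either side, and
  \<open>\<Sum> c\<^sub>b g\<^sub>b \<mapsto> \<Sum> c\<^sub>b U\<^sub>b\<close> is the isomorphism.
\<close>

section \<open>Windows of the extended affine symmetric group\<close>

text \<open>Extending an assignment from generators to an algebra normally means checking every
  relation between them, hence knowing a presentation. Expansions over the group avoid this: an
  equality of operators becomes an equality of coefficients, and one coefficient list serves both
  sides. The price is that a product of intertwiners must depend only on the group element, not on
  the word. So the group is realised concretely by \<open>N\<close>-periodic injections of the
  integers (bijective, since they act injectively on finitely many residues), and a Matsumoto
  argument attaches the operators to them. Integer maps also make faithfulness visible: distinct
  maps send some extended variable to different places, because \<open>q\<close> is not a root of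
  unity. Coefficients have denominators, so expansions are evaluated over the fraction field, but
  the operators live on Laurent polynomials, so independence must be proved by testing on these
  alone. Operators are functions under \<open>\<circ>\<close>, so words are reversed relative to the
  right action, in the same way on both sides.\<close>

definition affine_window :: "int \<Rightarrow> (int \<Rightarrow> int) set" where
  "affine_window N = {b. inj b \<and> (\<forall>i. b (i + N) = b i + N)}"

text \<open>The simple reflection, exchanging positions \<open>i\<close> and \<open>i + 1\<close> in
  every period at once. Here \<open>i\<close> is any integer; the residue class of 0 is the affine
  node, absent from the given generators.\<close>

definition affine_swap :: "int \<Rightarrow> int \<Rightarrow> int \<Rightarrow> int" where
  "affine_swap N i k = (if N dvd k - i then k + 1 else if N dvd k - i - 1 then k - 1 else k)"

lemma affine_window_add_mult:
  assumes "b \<in> affine_window N" shows "b (i + N * t) = b i + N * t"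
proof (induction t rule: int_induct[where k = 0])
  case base then show ?case by simp
next
  case (step1 t)
  have "b (i + N * (t + 1)) = b ((i + N * t) + N)" by (simp add: algebra_simps)
  also have "\<dots> = b (i + N * t) + N" using assms unfolding affine_window_def by blast
  finally show ?case using step1 by (simp add: algebra_simps)
next
  case (step2 t)
  have "b (i + N * (t - 1) + N) = b (i + N * (t - 1)) + N" using assms unfolding affine_window_def by blast
  then show ?case using step2 by (simp add: algebra_simps)
qed

lemma int_unit_of_dvd: assumes "N \<ge> (2::int)" shows "\<not> N dvd 1" "\<not> N dvd -1"
  using assms by (auto dest: zdvd_imp_le)

lemma affine_swap_add_mult: "affine_swap N i (k + N * t) = affine_swap N i k + N * t"
proof -
  have "k + N * t - i = (k - i) + N * t" "k + N * t - i - 1 = (k - i - 1) + N * t" by simp_all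
  then have "N dvd k + N * t - i \<longleftrightarrow> N dvd k - i" "N dvd k + N * t - i - 1 \<longleftrightarrow> N dvd k - i - 1"
    by (metis dvd_add_left_iff dvd_triv_left)+
  then show ?thesis by (simp add: affine_swap_def)
qed

lemma affine_swap_cong:
  assumes "N dvd i - j" shows "affine_swap N i = affine_swap N j"
proof
  fix k
  have "N dvd k - i \<longleftrightarrow> N dvd k - j" using dvd_add_left_iff[OF assms, of "k - i"] by simp
  moreover have "N dvd k - i - 1 \<longleftrightarrow> N dvd k - j - 1" using dvd_add_left_iff[OF assms, of "k - i - 1"] by (simp add: algebra_simps)
  ultimately show "affine_swap N i k = affine_swap N j k" by (simp add: affine_swap_def)
qed

lemma affine_swap_left [simp]: "affine_swap N i i = i + 1"
  by (simp add: affine_swap_def)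

lemma affine_swap_right [simp]: "N \<ge> 2 \<Longrightarrow> affine_swap N i (i + 1) = i"
  using int_unit_of_dvd[of N] by (simp add: affine_swap_def)

lemma affine_swap_other:
  "\<not> N dvd k - i \<Longrightarrow> \<not> N dvd k - i - 1 \<Longrightarrow> affine_swap N i k = k"
  by (simp add: affine_swap_def)

lemma affine_swap_cases:
  fixes N i k :: int
  obtains t where "k = i + N * t" | t where "k = (i + 1) + N * t" 
    | "\<not> N dvd k - i" "\<not> N dvd k - i - 1"
  by (metis add.commute diff_add_cancel diff_diff_eq dvdE)

lemma affine_swap_invol: assumes "N \<ge> 2" shows "affine_swap N i (affine_swap N i k) = k"
proof (rule affine_swap_cases[of k i N])
  fix t assume "k = i + N * t" then show ?thesis using assms by (simp add: affine_swap_add_mult)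
next
  fix t assume "k = (i + 1) + N * t" then show ?thesis using assms
    by (simp only: affine_swap_add_mult affine_swap_right affine_swap_left)
next
  assume "\<not> N dvd k - i" "\<not> N dvd k - i - 1" then show ?thesis by (simp add: affine_swap_other)
qed

lemma affine_swap_window: assumes "N \<ge> 2" shows "affine_swap N i \<in> affine_window N"
proof -
  have "inj (affine_swap N i)" by (rule inj_on_inverseI[where g = "affine_swap N i"]) (simp add: affine_swap_invol assms)
  moreover have "affine_swap N i (k + N) = affine_swap N i k + N" for k
    using affine_swap_add_mult[of N i k 1] by simp
  ultimately show ?thesis by (simp add: affine_window_def)
qed

lemma affine_window_comp: "b \<in> affine_window N \<Longrightarrow> c \<in> affine_window N \<Longrightarrow> b \<circ> c \<in> affine_window N"
  by (auto simp: affine_window_def intro: inj_compose)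

lemma affine_shift_window: "(\<lambda>j. j + k) \<in> affine_window N"
  by (auto simp: affine_window_def inj_on_def)

lemma affine_swap_shift: "affine_swap N (i + k) (j + k) = affine_swap N i j + k"
  by (simp add: affine_swap_def)

text \<open>The hypotheses say that \<open>i\<close> and \<open>j\<close> are neither equal nor
  adjacent on the cycle of residues. Each reflection then fixes both positions moved by the other,
  and periodicity reduces the claim to these positions.\<close>

lemma affine_swap_commute:
  assumes "N \<ge> 2" "\<not> N dvd i - j" "\<not> N dvd i - j - 1" "\<not> N dvd i - j + 1"
  shows "affine_swap N i \<circ> affine_swap N j = affine_swap N j \<circ> affine_swap N i"
proof
  fix k
  have neg: "\<not> N dvd j - i" "\<not> N dvd j - i - 1" "\<not> N dvd j - i + 1"
    using assms dvd_minus_iff[of N "i - j"] dvd_minus_iff[of N "i - j + 1"] dvd_minus_iff[of N "i - j - 1"]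
    by (auto simp: algebra_simps)
  have j1: "affine_swap N i j = j" "affine_swap N i (j + 1) = j + 1"
    "affine_swap N j i = i" "affine_swap N j (i + 1) = i + 1"
    using assms neg by (auto intro!: affine_swap_other simp: algebra_simps)
  have eqv: "affine_swap N a (c + N * t) = affine_swap N a c + N * t" for a c t
    by (rule affine_swap_add_mult)
  show "(affine_swap N i \<circ> affine_swap N j) k = (affine_swap N j \<circ> affine_swap N i) k"
  proof (rule affine_swap_cases[of k i N])
    fix t assume "k = i + N * t" then show ?thesis using assms j1 by (simp add: eqv)
  next
    fix t assume k: "k = (i + 1) + N * t" show ?thesis unfolding k o_apply eqv using assms j1 by simp
  next
    assume ki: "\<not> N dvd k - i" "\<not> N dvd k - i - 1"
    then have ski: "affine_swap N i k = k" by (rule affine_swap_other)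
    show ?thesis
    proof (rule affine_swap_cases[of k j N])
      fix t assume "k = j + N * t" then show ?thesis using assms j1 by (simp add: eqv)
    next
      fix t assume k: "k = (j + 1) + N * t" show ?thesis unfolding k o_apply eqv using assms j1 by simp
    next
      assume "\<not> N dvd k - j" "\<not> N dvd k - j - 1"
      then show ?thesis using ski by (simp add: affine_swap_other)
    qed
  qed
qed

text \<open>With \<open>N \<ge> 3\<close> the positions \<open>i\<close>, \<open>i + 1\<close>,
  \<open>i + 2\<close> have distinct residues, and both sides reverse this triple in every period.
  For \<open>N = 2\<close> the two reflections satisfy no such relation.\<close>

lemma affine_swap_braid:
  assumes "N \<ge> 3"
  shows "affine_swap N i \<circ> affine_swap N (i + 1) \<circ> affine_swap N i
       = affine_swap N (i + 1) \<circ> affine_swap N i \<circ> affine_swap N (i + 1)"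
proof
  fix k
  have eqv: "affine_swap N a (c + N * t) = affine_swap N a c + N * t" for a c t
    by (rule affine_swap_add_mult)
  have n2: "\<not> N dvd 2" "\<not> N dvd 1" "\<not> N dvd -1" using assms by (auto dest: zdvd_imp_le)
  have v: "affine_swap N i i = i + 1" "affine_swap N i (i + 1) = i" "affine_swap N i (i + 2) = i + 2"
    "affine_swap N (i + 1) i = i" "affine_swap N (i + 1) (i + 1) = i + 2" "affine_swap N (i + 1) (i + 2) = i + 1"
    using assms n2 dvd_minus_iff[of N 2] by (auto simp: affine_swap_def)
  show "(affine_swap N i \<circ> affine_swap N (i + 1) \<circ> affine_swap N i) k
     = (affine_swap N (i + 1) \<circ> affine_swap N i \<circ> affine_swap N (i + 1)) k"
  proof (rule affine_swap_cases[of k i N])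
    fix t assume k: "k = i + N * t" show ?thesis unfolding k o_apply eqv v ..
  next
    fix t assume k: "k = (i + 1) + N * t" show ?thesis unfolding k o_apply eqv v ..
  next
    assume ki: "\<not> N dvd k - i" "\<not> N dvd k - i - 1"
    show ?thesis
    proof (cases "N dvd k - (i + 2)")
      case True
      then obtain t where k: "k = (i + 2) + N * t" by (metis diff_add_cancel dvdE add.commute)
      show ?thesis unfolding k o_apply eqv v ..
    next
      case False
      have "affine_swap N i k = k" using ki by (rule affine_swap_other)
      moreover have "affine_swap N (i + 1) k = k"
        using ki False by (intro affine_swap_other) (simp_all add: algebra_simps)
      ultimately show ?thesis by simp
    qed
  qed
qed

text \<open>Lets the summation window start at \<open>i\<close>, so that the two positions exchanged
  by a reflection are never split across its boundary.\<close>

lemma sum_periodic_window: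
  fixes f :: "int \<Rightarrow> int"
  assumes "N \<ge> 1" "\<And>i. f (i + N) = f i"
  shows "sum f {i..<i + N} = sum f {0..<N}"
proof (induction i rule: int_induct[where k = 0])
  have step: "sum f {i + 1..<i + 1 + N} = sum f {i..<i + N}" for i
  proof -
    have "{i + 1..<i + 1 + N} = insert (i + N) {i + 1..<i + N}" "{i..<i + N} = insert i {i + 1..<i + N}"
      using assms(1) by auto
    then show ?thesis using assms(2) by simp
  qed
  {
    case base then show ?case by simp
  next
    case (step1 i) then show ?case using step by simp
  next
    case (step2 i) then show ?case using step[of "i - 1"] by simp
  }
qed

text \<open>Used in place of the length function: it strictly decreases when a descent is removed.\<close>
definition displacement :: "int \<Rightarrow> (int \<Rightarrow> int) \<Rightarrow> int" where
  "displacement N b = (\<Sum>k\<in>{0..<N}. (b k - k)^2)"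

lemma displacement_nonneg: "displacement N b \<ge> 0"
  by (simp add: displacement_def sum_nonneg)

text \<open>Only the squares at \<open>i\<close> and \<open>i + 1\<close> change, and their
  quadratic parts cancel. Removing a descent therefore lowers the measure by at least 2.\<close>

lemma displacement_swap:
  assumes "N \<ge> 2" "b \<in> affine_window N"
  shows "displacement N (b \<circ> affine_swap N i) = displacement N b - 2 * (b i - b (i + 1))"
proof -
  have per: "displacement N c = (\<Sum>k\<in>{i..<i + N}. (c k - k)^2)" if "c \<in> affine_window N" for c
    unfolding displacement_def using assms that
    by (subst sum_periodic_window) (auto simp: affine_window_def)
  have spl: "{i..<i + N} = insert i (insert (i + 1) {i + 2..<i + N})" using assms by auto
  have same: "(\<Sum>k\<in>{i + 2..<i + N}. ((b \<circ> affine_swap N i) k - k)^2) = (\<Sum>k\<in>{i + 2..<i + N}. (b k - k)^2)"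
  proof (rule sum.cong)
    fix k assume k: "k \<in> {i + 2..<i + N}"
    have "\<not> N dvd k - i" "\<not> N dvd k - i - 1" using k by (auto dest: zdvd_imp_le)
    then show "((b \<circ> affine_swap N i) k - k)^2 = (b k - k)^2" by (simp add: affine_swap_other)
  qed simp
  show ?thesis
    unfolding per[OF assms(2)] per[OF affine_window_comp[OF assms(2) affine_swap_window[OF assms(1)]]]
    using assms same by (simp add: spl) (simp add: algebra_simps power2_eq_square)
qed

text \<open>The \<open>N\<close> increments over one period are positive integers with sum
  \<open>N\<close>, so each of them is 1. Windows without descents are thus exactly the shifts, the
  base of the descent induction.\<close>

lemma affine_window_increasing:
  assumes "N \<ge> 1" "b \<in> affine_window N" "\<And>i. b i < b (i + 1)"
  shows "b = (\<lambda>j. j + b 0)"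
proof -
  have ge: "b (i + int n) \<ge> b i + int n" for i n
  proof (induction n)
    case (Suc n) then show ?case using assms(3)[of "i + int n"] by (simp add: algebra_simps)
  qed simp
  have one: "b (i + 1) = b i + 1" for i
  proof -
    have "b (i + 1 + int (nat (N - 1))) \<ge> b (i + 1) + int (nat (N - 1))" by (rule ge)
    then have "b (i + N) \<ge> b (i + 1) + (N - 1)" using assms(1) by simp
    moreover have "b (i + N) = b i + N" using assms(2) by (simp add: affine_window_def)
    ultimately show ?thesis using assms(3)[of i] by simp
  qed
  have "b j = j + b 0" for j
  proof (induction j rule: int_induct[where k = 0])
    case (step2 j) then show ?case using one[of "j - 1"] by simp
  qed (simp_all add: one)
  then show ?thesis by blast
qed

section \<open>Matsumoto's theorem: operators attached to windows\<close>

locale affine_action =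
  fixes N :: int and S :: "int \<Rightarrow> 'a \<Rightarrow> 'a" and P :: "int \<Rightarrow> 'a \<Rightarrow> 'a"
  assumes N2: "N \<ge> 2"
    and S_invol: "S i \<circ> S i = id"
    and S_commute: "\<not> N dvd i - j \<Longrightarrow> \<not> N dvd i - j - 1 \<Longrightarrow> \<not> N dvd i - j + 1 \<Longrightarrow> S i \<circ> S j = S j \<circ> S i"
    and S_braid: "N \<ge> 3 \<Longrightarrow> S i \<circ> S (i + 1) \<circ> S i = S (i + 1) \<circ> S i \<circ> S (i + 1)"
    and S_periodic: "S (i + N) = S i"
    and P_zero: "P 0 = id"
    and P_add: "P (j + k) = P j \<circ> P k"
    and P_S: "P k \<circ> S i = S (i + k) \<circ> P k"
begin

lemma S_cong: "N dvd i - j \<Longrightarrow> S i = S j"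
proof -
  have "S (j + N * t) = S j" for t
  proof (induction t rule: int_induct[where k = 0])
    case (step1 t) then show ?case using S_periodic[of "j + N * t"] by (simp add: algebra_simps)
  next
    case (step2 t) then show ?case using S_periodic[of "j + N * (t - 1)"] by (simp add: algebra_simps)
  qed simp
  then show "N dvd i - j \<Longrightarrow> S i = S j" by (metis add.commute diff_add_cancel dvdE)
qed

text \<open>The side condition says that every letter creates a new descent, so
  \<open>displacement\<close> grows along the word. These are the reduced words, ending in a shift
  on the left.\<close>

inductive reduced :: "(int \<Rightarrow> int) \<Rightarrow> ('a \<Rightarrow> 'a) \<Rightarrow> bool" where
  shift: "reduced (\<lambda>j. j + k) (P k)"
| step: "reduced b u \<Longrightarrow> b i < b (i + 1) \<Longrightarrow> reduced (b \<circ> affine_swap N i) (u \<circ> S i)"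

lemma reduced_window: "reduced b u \<Longrightarrow> b \<in> affine_window N"
  by (induction rule: reduced.induct)
    (auto intro: affine_shift_window affine_window_comp affine_swap_window[OF N2] simp del: o_apply)

lemma swap_swap: "b \<circ> affine_swap N i \<circ> affine_swap N i = b"
  by (rule ext) (simp add: affine_swap_invol N2)

lemma reduced_exists: "b \<in> affine_window N \<Longrightarrow> \<exists>u. reduced b u"
proof (induction "nat (displacement N b)" arbitrary: b rule: less_induct)
  case less
  show ?case
  proof (cases "\<exists>i. b (i + 1) < b i")
    case True
    then obtain i where i: "b (i + 1) < b i" by blast
    let ?c = "b \<circ> affine_swap N i"
    have "nat (displacement N ?c) < nat (displacement N b)"
      using displacement_swap[OF N2 less.prems, of i] i displacement_nonneg[of N ?c] by simp
    then obtain u where "reduced ?c u"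
      using less.hyps affine_window_comp[OF less.prems affine_swap_window[OF N2]] by blast
    moreover have "?c i < ?c (i + 1)" using i N2 by simp
    ultimately have "reduced (?c \<circ> affine_swap N i) (u \<circ> S i)" by (rule reduced.step)
    then show ?thesis unfolding swap_swap by blast
  next
    case False
    have "b i \<noteq> b (i + 1)" for i using less.prems by (auto simp: affine_window_def dest: injD)
    with False have "\<And>i. b i < b (i + 1)" by (metis linorder_neqE)
    then have "b = (\<lambda>j. j + b 0)" using less.prems N2 by (intro affine_window_increasing) auto
    then show ?thesis using reduced.shift[of "b 0"] by metis
  qed
qed

lemma window_induct:
  assumes "b \<in> affine_window N" "\<And>k. Q (\<lambda>j. j + k)" "\<And>b i. Q b \<Longrightarrow> Q (b \<circ> affine_swap N i)"
  shows "Q b"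
proof -
  have "reduced b u \<Longrightarrow> Q b" for u by (induction rule: reduced.induct) (rule assms(2), erule assms(3))
  then show ?thesis using reduced_exists[OF assms(1)] by blast
qed

text \<open>Diamond argument behind Matsumoto's theorem. Two words for \<open>b\<close> end in
  descents \<open>i\<close> and \<open>j\<close>. Removing both descents leads down to a common
  window: along a hexagon if the indices are adjacent, along a square if they are far apart. The
  induction hypothesis compares the words on each side, and one braid or commutation relation closes
  the figure.\<close>

lemma reduced_unique: "reduced b u \<Longrightarrow> reduced b u' \<Longrightarrow> u = u'"
proof (induction "nat (displacement N b)" arbitrary: b u u' rule: less_induct)
  case less
  note bw = reduced_window[OF less.prems(1)]
  have IH: "v = v'" if "reduced (b \<circ> affine_swap N i) v" "reduced (b \<circ> affine_swap N i) v'" "b (i + 1) < b i" for i v v'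
  proof (rule less.hyps[OF _ that(1,2)])
    show "nat (displacement N (b \<circ> affine_swap N i)) < nat (displacement N b)"
      using displacement_swap[OF N2 bw, of i] that(3) displacement_nonneg[of N "b \<circ> affine_swap N i"] by simp
  qed
  have inv: "(\<exists>k. b = (\<lambda>j. j + k) \<and> v = P k) \<or> 
       (\<exists>i v1. reduced (b \<circ> affine_swap N i) v1 \<and> b (i + 1) < b i \<and> v = v1 \<circ> S i)" if "reduced b v" for v
    using that
  proof (cases rule: reduced.cases)
    case (shift k) then show ?thesis by blast
  next
    case (step c w i)
    have "b \<circ> affine_swap N i = c" unfolding step by (rule swap_swap)
    moreover have "b (i + 1) < b i" using step N2 by simp
    ultimately show ?thesis using step by blast
  qed
  have nodesc: "\<not> b (i + 1) < b i" if "b = (\<lambda>j. j + k)" for i k using that by simp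
  have adj: "v \<circ> S i = v' \<circ> S (i + 1)"
    if v: "reduced (b \<circ> affine_swap N i) v" "b (i + 1) < b i"
      and v': "reduced (b \<circ> affine_swap N (i + 1)) v'" "b (i + 1 + 1) < b (i + 1)" for i v v'
  proof -
    \<comment> \<open>Consecutive descents at \<open>i\<close> and \<open>i + 1\<close> give
      \<open>b (i + 2) < b i\<close>, impossible for \<open>N = 2\<close>, where
      \<open>b (i + 2) = b i + 2\<close>.\<close>
    have N3: "N \<ge> 3"
    proof (rule ccontr)
      assume "\<not> ?thesis" then have "N = 2" using N2 by simp
      moreover have "b (i + N) = b i + N" using bw by (simp add: affine_window_def)
      ultimately show False using v(2) v'(2) by (simp add: add.commute)
    qed
    let ?s = "affine_swap N i" and ?t = "affine_swap N (i + 1)"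
    have n2: "\<not> N dvd 2" "\<not> N dvd 1" "\<not> N dvd -1" using N3 by (auto dest: zdvd_imp_le)
    have vals: "?s i = i + 1" "?s (i + 1) = i" "?s (i + 2) = i + 2"
      "?t i = i" "?t (i + 1) = i + 2" "?t (i + 2) = i + 1"
      using N2 n2 dvd_minus_iff[of N 2] by (auto simp: affine_swap_def)
    \<comment> \<open>Bottom of the hexagon: the three decreasing values at \<open>i\<close>,
      \<open>i + 1\<close>, \<open>i + 2\<close> are put in increasing order.\<close>
    define c where "c = b \<circ> ?s \<circ> ?t \<circ> ?s"
    have c': "c = b \<circ> ?t \<circ> ?s \<circ> ?t" unfolding c_def using affine_swap_braid[OF N3, of i] by (simp add: o_assoc[symmetric])
    have "c \<in> affine_window N" unfolding c_def by (intro affine_window_comp bw affine_swap_window N2)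
    then obtain r where r: "reduced c r" using reduced_exists by blast
    have e1: "c \<circ> ?s \<circ> ?t = b \<circ> ?s" unfolding c_def swap_swap ..
    have e2: "c \<circ> ?t \<circ> ?s = b \<circ> ?t" unfolding c' swap_swap ..
    have "reduced (c \<circ> ?s \<circ> ?t) (r \<circ> S i \<circ> S (i + 1))"
      using v(2) v'(2) N2 by (intro reduced.step r) (auto simp: c_def vals add.assoc)
    then have a: "v = r \<circ> S i \<circ> S (i + 1)" unfolding e1 by (rule IH[OF v(1) _ v(2)])
    have "reduced (c \<circ> ?t \<circ> ?s) (r \<circ> S (i + 1) \<circ> S i)"
      using v(2) v'(2) N2 by (intro reduced.step r) (auto simp: c_def vals add.assoc)
    then have b: "v' = r \<circ> S (i + 1) \<circ> S i" unfolding e2 by (rule IH[OF v'(1) _ v'(2)])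
    show ?thesis unfolding a b using S_braid[OF N3, of i] by (simp add: o_assoc[symmetric])
  qed
  consider k k' where "b = (\<lambda>j. j + k)" "u = P k" "b = (\<lambda>j. j + k')" "u' = P k'"
    | i v j v' where "reduced (b \<circ> affine_swap N i) v" "b (i + 1) < b i" "u = v \<circ> S i"
        "reduced (b \<circ> affine_swap N j) v'" "b (j + 1) < b j" "u' = v' \<circ> S j"
    using inv[OF less.prems(1)] inv[OF less.prems(2)] nodesc by blast
  then show ?case
  proof cases
    case 1
    then have "k = k'" by (metis add_left_cancel)
    with 1 show ?thesis by simp
  next
    case 2
    \<comment> \<open>Being a descent depends only on the residue of the position, so the cases
      below can be split by residues of \<open>i - j\<close>.\<close>
    have cong: "b (k + 1) < b k \<longleftrightarrow> b (l + 1) < b l" if "N dvd k - l" for k l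
    proof -
      from that obtain t where "k - l = N * t" by (rule dvdE)
      then have "k = l + N * t" by simp
      then show ?thesis using affine_window_add_mult[OF bw, of l t] affine_window_add_mult[OF bw, of "l + 1" t]
        by (simp add: algebra_simps)
    qed
    consider "N dvd i - j" | "N dvd j - (i + 1)" | "N dvd i - (j + 1)"
      | "\<not> N dvd i - j" "\<not> N dvd i - j - 1" "\<not> N dvd i - j + 1"
      using dvd_minus_iff[of N "i - j + 1"] by (auto simp: algebra_simps)
    then show ?thesis
    proof cases
      assume "N dvd i - j"
      then show ?thesis using 2 IH[of i v v'] S_cong affine_swap_cong by metis
    next
      assume h: "N dvd j - (i + 1)"
      show ?thesis using 2 adj[of i v v'] S_cong[OF h] affine_swap_cong[OF h] cong[OF h] by simp
    next
      assume h: "N dvd i - (j + 1)"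
      show ?thesis using 2 adj[of j v' v] S_cong[OF h] affine_swap_cong[OF h] cong[OF h] by simp
    next
      assume far: "\<not> N dvd i - j" "\<not> N dvd i - j - 1" "\<not> N dvd i - j + 1"
      let ?s = "affine_swap N i" and ?t = "affine_swap N j"
      have neg: "\<not> N dvd j - i" "\<not> N dvd j - i - 1" "\<not> N dvd j - i + 1"
        using far dvd_minus_iff[of N "i - j"] dvd_minus_iff[of N "i - j + 1"] dvd_minus_iff[of N "i - j - 1"]
        by (auto simp: algebra_simps)
      have fix_pts: "?s j = j" "?s (j + 1) = j + 1" "?t i = i" "?t (i + 1) = i + 1"
        using far neg by (auto intro!: affine_swap_other simp: algebra_simps)
      \<comment> \<open>Bottom of the square: both descents are removed, independently of each
        other.\<close>
      define c where "c = b \<circ> ?s \<circ> ?t"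
      have c': "c = b \<circ> ?t \<circ> ?s" unfolding c_def using affine_swap_commute[OF N2 far] by (simp add: o_assoc[symmetric])
      have "c \<in> affine_window N" unfolding c_def by (intro affine_window_comp bw affine_swap_window N2)
      then obtain r where r: "reduced c r" using reduced_exists by blast
      have e1: "c \<circ> ?t = b \<circ> ?s" unfolding c_def swap_swap ..
      have e2: "c \<circ> ?s = b \<circ> ?t" unfolding c' swap_swap ..
      have "reduced (c \<circ> ?t) (r \<circ> S j)"
        using 2 N2 by (intro reduced.step r) (auto simp: c_def fix_pts)
      then have a: "v = r \<circ> S j" unfolding e1 by (rule IH[OF 2(1) _ 2(2)])
      have "reduced (c \<circ> ?s) (r \<circ> S i)"
        using 2 N2 by (intro reduced.step r) (auto simp: c_def fix_pts)
      then have b: "v' = r \<circ> S i" unfolding e2 by (rule IH[OF 2(4) _ 2(5)])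
      show ?thesis unfolding 2 a b using S_commute[OF far] by (simp add: o_assoc[symmetric])
    qed
  qed
qed

definition U :: "(int \<Rightarrow> int) \<Rightarrow> 'a \<Rightarrow> 'a" where
  "U b = (THE u. reduced b u)"

lemma U_reduced: "reduced b u \<Longrightarrow> U b = u"
  unfolding U_def using reduced_unique by blast

lemma reduced_U: "b \<in> affine_window N \<Longrightarrow> reduced b (U b)"
  using U_reduced reduced_exists by metis

text \<open>At an ascent this extends a reduced word. At a descent it is the same relation for the
  shorter window, read backwards by means of \<open>S_invol\<close>.\<close>

lemma U_swap:
  assumes "b \<in> affine_window N" shows "U (b \<circ> affine_swap N i) = U b \<circ> S i"
proof (cases "b i < b (i + 1)")
  case True
  then show ?thesis by (intro U_reduced reduced.step reduced_U assms)
next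
  case False
  moreover have "b i \<noteq> b (i + 1)" using assms by (auto simp: affine_window_def dest: injD)
  ultimately have "(b \<circ> affine_swap N i) i < (b \<circ> affine_swap N i) (i + 1)" using N2 by simp
  then have "reduced (b \<circ> affine_swap N i \<circ> affine_swap N i) (U (b \<circ> affine_swap N i) \<circ> S i)"
    by (intro reduced.step reduced_U affine_window_comp assms affine_swap_window N2)
  then have "U b = U (b \<circ> affine_swap N i) \<circ> S i" unfolding swap_swap by (rule U_reduced)
  then show ?thesis using S_invol by (simp add: o_assoc[symmetric])
qed

lemma U_shift_comp: "b \<in> affine_window N \<Longrightarrow> U (b \<circ> (\<lambda>j. j + k)) = U b \<circ> P k"
proof -
  have "reduced b u \<Longrightarrow> U (b \<circ> (\<lambda>j. j + k)) = u \<circ> P k" for u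
  proof (induction rule: reduced.induct)
    case (shift l)
    have "(\<lambda>j. j + l) \<circ> (\<lambda>j. j + k) = (\<lambda>j. j + (l + k))" by (auto simp: algebra_simps)
    then show ?case using U_reduced[OF reduced.shift[of "l + k"]] P_add by simp
  next
    case (step b u i)
    have "b \<circ> affine_swap N i \<circ> (\<lambda>j. j + k) = b \<circ> (\<lambda>j. j + k) \<circ> affine_swap N (i - k)"
      using affine_swap_shift[of N "i - k" k] by (auto simp: fun_eq_iff)
    then have "U (b \<circ> affine_swap N i \<circ> (\<lambda>j. j + k)) = U (b \<circ> (\<lambda>j. j + k)) \<circ> S (i - k)"
      using U_swap affine_window_comp[OF reduced_window[OF step(1)] affine_shift_window] by simp
    also have "\<dots> = u \<circ> (P k \<circ> S (i - k))" unfolding step by (simp add: o_assoc)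
    finally show ?case unfolding P_S by (simp only: o_assoc diff_add_cancel)
  qed
  then show "b \<in> affine_window N \<Longrightarrow> U (b \<circ> (\<lambda>j. j + k)) = U b \<circ> P k" using reduced_U by blast
qed

lemma U_shift: "U (\<lambda>j. j + k) = P k"
  by (rule U_reduced[OF reduced.shift])

lemma U_id: "U id = id"
  using U_shift[of 0] P_zero by (simp add: id_def)

lemma U_affine_swap: "U (affine_swap N i) = S i"
  using U_swap[of id i] affine_shift_window[of 0 N] by (simp add: U_id id_def[symmetric])

lemma U_comp:
  assumes "b \<in> affine_window N" "c \<in> affine_window N" shows "U (b \<circ> c) = U b \<circ> U c"
proof -
  have "U (b \<circ> c) = U b \<circ> u" if "reduced c u" for u using that
  proof (induction rule: reduced.induct)
    case (shift k) then show ?case by (rule U_shift_comp[OF assms(1)])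
  next
    case (step c u i)
    show ?case using U_swap[OF affine_window_comp[OF assms(1) reduced_window[OF step(1)]], of i]
      unfolding step(3) by (simp only: o_assoc)
  qed
  then show ?thesis using reduced_U assms by blast
qed

end

section \<open>Integer powers, and the action rebuilt from finitely many generators\<close>

definition zpow :: "('a \<Rightarrow> 'a) \<Rightarrow> int \<Rightarrow> 'a \<Rightarrow> 'a" where
  "zpow f k = (if k \<ge> 0 then f ^^ nat k else inv f ^^ nat (- k))"

lemma zpow_succ: assumes "bij f" shows "zpow f (k + 1) = zpow f k \<circ> f"
proof (cases "k \<ge> 0")
  case True
  then have "nat (k + 1) = Suc (nat k)" by simp
  then show ?thesis using True by (simp add: zpow_def funpow_Suc_right del: funpow.simps)
next
  case False
  have inv: "inv f \<circ> f = id" using assms by (simp add: bij_is_inj)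
  have "nat (- k) = Suc (nat (- (k + 1)))" using False by simp
  then have "inv f ^^ nat (- k) \<circ> f = inv f ^^ nat (- (k + 1)) \<circ> (inv f \<circ> f)"
    by (simp add: funpow_Suc_right o_assoc del: funpow.simps)
  then have "inv f ^^ nat (- k) \<circ> f = inv f ^^ nat (- (k + 1))" using inv by simp
  moreover have "zpow f (k + 1) = inv f ^^ nat (- (k + 1))"
    using False by (cases "k = -1") (simp_all add: zpow_def)
  ultimately show ?thesis using False by (simp add: zpow_def)
qed

lemma zpow_zero [simp]: "zpow f 0 = id"
  by (simp add: zpow_def)

lemma zpow_one: "zpow f 1 = f"
  by (simp add: zpow_def)

lemma zpow_add: assumes "bij f" shows "zpow f (j + k) = zpow f j \<circ> zpow f k"
proof (induction k rule: int_induct[where k = 0])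
  case (step1 k)
  have "zpow f (j + (k + 1)) = zpow f (j + k) \<circ> f" using zpow_succ[OF assms, of "j + k"] by (simp add: add.assoc)
  then show ?case unfolding step1 zpow_succ[OF assms] by (simp only: o_assoc)
next
  case (step2 k)
  have surj: "surj f" using assms by (rule bij_is_surj)
  have "zpow f (j + (k - 1)) \<circ> f = zpow f (j + k)" using zpow_succ[OF assms, of "j + k - 1"] by (simp add: algebra_simps)
  also have "\<dots> = zpow f j \<circ> zpow f (k - 1) \<circ> f" unfolding step2
    using zpow_succ[OF assms, of "k - 1"] by (simp add: o_assoc)
  finally show ?case using surj by (metis fun.map_comp surj_fun_eq comp_surj image_eqI)
qed simp

text \<open>The simple reflections are spread over all integer indices by conjugation with \<open>W\<close>; the
  hypothesis on \<open>W \<circ> W\<close> makes the resulting family \<open>N\<close>-periodic.\<close>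
lemma affine_action_of_generators:
  fixes N :: nat and R :: "nat \<Rightarrow> 'a \<Rightarrow> 'a" and W :: "'a \<Rightarrow> 'a"
  assumes N: "N \<ge> 2" and W: "bij W"
    and invol: "\<And>i. 1 \<le> i \<Longrightarrow> i < N \<Longrightarrow> R i \<circ> R i = id"
    and commute: "\<And>i j. 1 \<le> i \<Longrightarrow> i + 1 < j \<Longrightarrow> j < N \<Longrightarrow> R i \<circ> R j = R j \<circ> R i"
    and braid: "\<And>i. 1 \<le> i \<Longrightarrow> i + 1 < N \<Longrightarrow> R i \<circ> R (i + 1) \<circ> R i = R (i + 1) \<circ> R i \<circ> R (i + 1)"
    and rot: "\<And>i. 1 \<le> i \<Longrightarrow> i + 1 < N \<Longrightarrow> W \<circ> R (i + 1) = R i \<circ> W"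
    and wrap: "W \<circ> W \<circ> R 1 = R (N - 1) \<circ> W \<circ> W"
  defines "P \<equiv> \<lambda>k. zpow W (- k)"
  defines "S \<equiv> \<lambda>i. P (i - 1) \<circ> R 1 \<circ> P (1 - i)"
  shows "affine_action (int N) S P" and "\<And>i. 1 \<le> i \<Longrightarrow> i < N \<Longrightarrow> S (int i) = R i"
    and "P (- 1) = W"
proof -
  have P0: "P 0 = id" by (simp add: P_def)
  have Padd: "P (j + k) = P j \<circ> P k" for j k using zpow_add[OF W, of "- j" "- k"] by (simp add: P_def)
  have Pinv: "P k \<circ> P (- k) = id" for k using Padd[of k "- k"] P0 by simp
  \<comment> \<open>The sign in \<open>P\<close> is negative because \<open>W\<close> plays the
    shift by -1, as \<open>w\<close> lowers the index of a variable.\<close>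
  show PW: "P (- 1) = W" by (simp add: P_def zpow_one)
  have PS: "P k \<circ> S i = S (i + k) \<circ> P k" for k i
  proof -
    have "P k \<circ> S i = (P k \<circ> P (i - 1)) \<circ> R 1 \<circ> P (1 - i)" by (simp add: S_def o_assoc)
    also have "P k \<circ> P (i - 1) = P (i + k - 1)" by (simp add: Padd[symmetric] algebra_simps)
    also have "P (1 - i) = P (1 - (i + k)) \<circ> P k" by (simp add: Padd[symmetric] algebra_simps)
    finally show ?thesis unfolding S_def by (simp only: o_assoc)
  qed
  have conj: "S (i + k) = P k \<circ> S i \<circ> P (- k)" for i k
    unfolding PS using Pinv[of k] by (simp add: o_assoc[symmetric])
  have S1: "S 1 = R 1" by (simp add: S_def P0)
  show SR: "S (int i) = R i" if "1 \<le> i" "i < N" for i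
    using that
  proof (induction i rule: nat_induct_at_least)
    case base then show ?case using S1 by simp
  next
    case (Suc i)
    have "P 1 \<circ> P (- 1) = id" by (rule Pinv)
    then have "R (i + 1) = P 1 \<circ> (W \<circ> R (i + 1))" unfolding PW by (simp add: o_assoc)
    also have "\<dots> = P 1 \<circ> S (int i) \<circ> P (- 1)" using rot[of i] Suc PW by (simp add: o_assoc)
    also have "\<dots> = S (int i + 1)" by (rule conj[symmetric])
    finally show ?case by (simp add: add.commute)
  qed
  \<comment> \<open>Conjugation by \<open>W \<circ> W\<close> lowers indices by 2, and
    \<open>wrap\<close> says that it takes \<open>R 1\<close> to \<open>R (N - 1)\<close>.
    Conjugating back raises \<open>N - 1\<close> to \<open>N + 1\<close>, so the index
    \<open>N + 1\<close> carries the same operator as 1.\<close>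
  have SN: "S (1 + int N) = S 1"
  proof -
    have P2: "P (- 2) = W \<circ> W" using Padd[of "-1" "-1"] PW by simp
    have "S (1 + int N) = S ((int N - 1) + 2)" by simp
    also have "\<dots> = P 2 \<circ> R (N - 1) \<circ> P (- 2)" unfolding conj using SR[of "N - 1"] N by (simp add: of_nat_diff)
    also have "\<dots> = P 2 \<circ> (R (N - 1) \<circ> W \<circ> W)" unfolding P2 by (simp add: o_assoc)
    also have "\<dots> = (P 2 \<circ> P (- 2)) \<circ> R 1" unfolding wrap[symmetric] P2 by (simp add: o_assoc)
    finally show ?thesis using Pinv[of 2] S1 by simp
  qed
  have per: "S (i + int N) = S i" for i
    using conj[of "1 + int N" "i - 1"] conj[of 1 "i - 1"] SN by (simp add: algebra_simps)
  have per': "S (i + int N * t) = S i" for i t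
  proof (induction t rule: int_induct[where k = 0])
    case (step1 t) then show ?case using per[of "i + int N * t"] by (simp add: algebra_simps)
  next
    case (step2 t) then show ?case using per[of "i + int N * (t - 1)"] by (simp add: algebra_simps)
  qed simp
  have cc: "(P k \<circ> A \<circ> P (- k)) \<circ> (P k \<circ> B \<circ> P (- k)) = P k \<circ> (A \<circ> B) \<circ> P (- k)" for k A B
  proof -
    have "P (- k) \<circ> P k = id" using Pinv[of "- k"] by simp
    then have "P (- k) \<circ> (P k \<circ> X) = X" for X :: "'a \<Rightarrow> 'a" by (simp add: o_assoc)
    then show ?thesis by (simp add: o_assoc[symmetric])
  qed
  show "affine_action (int N) S P"
  proof
    show "2 \<le> int N" using N by simp
    show "S i \<circ> S i = id" for i
    proof -
      have "S i = P (i - 1) \<circ> R 1 \<circ> P (- (i - 1))" by (simp add: S_def)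
      then show ?thesis using cc[of "i - 1" "R 1" "R 1"] invol[of 1] N Pinv[of "i - 1"] by simp
    qed
    show "S i \<circ> S j = S j \<circ> S i"
      if far: "\<not> int N dvd i - j" "\<not> int N dvd i - j - 1" "\<not> int N dvd i - j + 1" for i j
    proof -
      \<comment> \<open>The residue of \<open>j - i\<close>. The three conditions exclude 0, 1 and
        \<open>N - 1\<close>, so a conjugation moves the pair to 1 and \<open>1 + d\<close> with
        \<open>1 + d \<le> N - 1\<close>, where \<open>commute\<close> applies.\<close>
      define d where "d = (j - i) mod int N"
      define t where "t = (j - i) div int N"
      have dt: "j = i + d + int N * t" by (simp add: d_def t_def)
      have d: "0 \<le> d" "d < int N" using N by (simp_all add: d_def)
      have "d \<noteq> 0" using far(1) dt by (auto simp: algebra_simps)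
      moreover have "d \<noteq> 1" using far(3) dt by (auto simp: algebra_simps)
      moreover have "d \<noteq> int N - 1"
      proof
        assume "d = int N - 1"
        then have "i - j - 1 = int N * (- t - 1)" using dt by (simp add: algebra_simps)
        then show False using far(2) by simp
      qed
      ultimately have d2: "2 \<le> d" "d \<le> int N - 2" using d by auto
      have j: "S j = S ((1 + d) + (i - 1))" unfolding dt per' by (simp add: algebra_simps)
      have i: "S i = S (1 + (i - 1))" by simp
      have "S (1 + d) = R (nat (1 + d))" using SR[of "nat (1 + d)"] d2 by simp
      moreover have "R 1 \<circ> R (nat (1 + d)) = R (nat (1 + d)) \<circ> R 1"
        using commute[of 1 "nat (1 + d)"] d2 N by simp
      ultimately show ?thesis unfolding j i conj cc S1 by simp
    qed
    show "S i \<circ> S (i + 1) \<circ> S i = S (i + 1) \<circ> S i \<circ> S (i + 1)" if N3: "3 \<le> int N" for i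
    proof -
      have S2: "S 2 = R 2" using SR[of 2] N3 by simp
      have s1: "S i = P (i - 1) \<circ> R 1 \<circ> P (- (i - 1))" using conj[of 1 "i - 1"] S1 by simp
      have "i + 1 = 2 + (i - 1)" by simp
      then have s2: "S (i + 1) = P (i - 1) \<circ> R 2 \<circ> P (- (i - 1))" using conj[of 2 "i - 1"] S2 by metis
      show ?thesis unfolding s1 s2 cc using braid[of 1] N3 by (simp add: numeral_2_eq_2)
    qed
    show "S (i + int N) = S i" for i by (rule per)
    show "P 0 = id" by (rule P0)
    show "P (j + k) = P j \<circ> P k" for j k by (rule Padd)
    show "P k \<circ> S i = S (i + k) \<circ> P k" for k i by (rule PS)
  qed
qed

section \<open>Rational functions in the variables\<close>

lemma poly_mapping_sum_singles: "p = (\<Sum>m\<in>Poly_Mapping.keys p. Poly_Mapping.single m (Poly_Mapping.lookup p m))"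
proof (rule poly_mapping_eqI)
  fix k
  show "Poly_Mapping.lookup p k
      = Poly_Mapping.lookup (\<Sum>m\<in>Poly_Mapping.keys p. Poly_Mapping.single m (Poly_Mapping.lookup p m)) k"
    by (cases "k \<in> Poly_Mapping.keys p")
      (auto simp: lookup_sum lookup_single when_def in_keys_iff sum.delta)
qed

text \<open>The membership in \<open>keys p\<close> makes the rule usable when only some exponents
  are admissible, as in \<open>LP N\<close>.\<close>

lemma poly_mapping_single_induct [case_names zero single add]:
  assumes "P 0" "\<And>m c. c \<noteq> 0 \<Longrightarrow> m \<in> Poly_Mapping.keys p \<Longrightarrow> P (Poly_Mapping.single m c)"
    "\<And>p q. P p \<Longrightarrow> P q \<Longrightarrow> P (p + q)"
  shows "P (p :: 'a \<Rightarrow>\<^sub>0 'b::comm_monoid_add)"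
proof -
  have "A \<subseteq> Poly_Mapping.keys p \<Longrightarrow> P (\<Sum>m\<in>A. Poly_Mapping.single m (Poly_Mapping.lookup p m))" if "finite A" for A
    using that
  proof (induction A rule: finite_induct)
    case (insert x A)
    then show ?case by (simp, intro assms) (auto simp: in_keys_iff)
  qed (simp add: assms(1))
  from this[of "Poly_Mapping.keys p"] show ?thesis by (simp add: poly_mapping_sum_singles[symmetric])
qed

section \<open>Monomial substitutions on Laurent polynomials\<close>

lemma lp_map_superset:
  assumes "finite A" "Poly_Mapping.keys p \<subseteq> A"
  shows "lp_map c \<tau> p = (\<Sum>m\<in>A. Poly_Mapping.single (\<tau> m) (c m * Poly_Mapping.lookup p m))"
  unfolding lp_map_def using assms by (intro sum.mono_neutral_left) (auto simp: in_keys_iff)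

lemma lp_map_zero [simp]: "lp_map c \<tau> 0 = 0"
  by (simp add: lp_map_def)

lemma lp_map_single [simp]: "lp_map c \<tau> (Poly_Mapping.single m a) = Poly_Mapping.single (\<tau> m) (c m * a)"
  by (simp add: lp_map_def)

lemma lp_map_add: "lp_map c \<tau> (p + q) = lp_map c \<tau> p + lp_map c \<tau> q"
proof -
  let ?A = "Poly_Mapping.keys p \<union> Poly_Mapping.keys q"
  have "finite ?A" "Poly_Mapping.keys (p + q) \<subseteq> ?A" by (auto simp: Poly_Mapping.keys_add)
  then show ?thesis
    by (simp add: lp_map_superset[of ?A] lookup_add distrib_left single_add sum.distrib)
qed

lemma lp_map_mult:
  assumes "\<And>m n. c (m + n) = c m * c n" "\<And>m n. \<tau> (m + n) = \<tau> m + \<tau> n"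
  shows "lp_map c \<tau> (p * q) = lp_map c \<tau> p * lp_map c \<tau> q"
proof (induction p rule: poly_mapping_single_induct)
  case (single m a)
  show ?case
    by (induction q rule: poly_mapping_single_induct)
      (simp_all add: mult_single assms lp_map_add distrib_left, simp_all add: mult_ac)
qed (simp_all add: lp_map_add distrib_right)

lemma lp_map_comp: "lp_map c \<tau> (lp_map d \<rho> p) = lp_map (\<lambda>m. c (\<rho> m) * d m) (\<lambda>m. \<tau> (\<rho> m)) p"
  by (induction p rule: poly_mapping_single_induct) (simp_all add: lp_map_add mult.assoc)

lemma lp_map_ident: "lp_map (\<lambda>_. 1) (\<lambda>m. m) p = p"
  by (induction p rule: poly_mapping_single_induct) (simp_all add: lp_map_add)

lemma lookup_mono_perm:
  assumes "bij \<sigma>" shows "Poly_Mapping.lookup (mono_perm \<sigma> m) k = Poly_Mapping.lookup m (\<sigma> k)"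
proof -
  have "{k. Poly_Mapping.lookup m (\<sigma> k) \<noteq> 0} = \<sigma> -` {k. Poly_Mapping.lookup m k \<noteq> 0}" by auto
  then have "finite {k. Poly_Mapping.lookup m (\<sigma> k) \<noteq> 0}"
    using finite_vimageI[OF _ bij_is_inj[OF assms], of "{k. Poly_Mapping.lookup m k \<noteq> 0}"] by simp
  then show ?thesis by (simp add: mono_perm_def)
qed

lemma mono_perm_add: "bij \<sigma> \<Longrightarrow> mono_perm \<sigma> (m + n) = mono_perm \<sigma> m + mono_perm \<sigma> n"
  by (rule poly_mapping_eqI) (simp add: lookup_mono_perm lookup_add)

text \<open>\<open>mono_perm\<close> precomposes exponent vectors, so variables are moved by the
  inverse of \<open>\<sigma>\<close>. This is why the substitution of \<open>x_(k-1)\<close> for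
  \<open>x_k\<close> is written with \<open>cyc\<close>, which raises indices.\<close>

lemma mono_perm_single:
  assumes "bij \<sigma>" "\<sigma> l = k" shows "mono_perm \<sigma> (Poly_Mapping.single k a) = Poly_Mapping.single l a"
  using assms by (intro poly_mapping_eqI) (auto simp: lookup_mono_perm lookup_single when_def dest: bij_is_inj injD)

definition uncyc :: "nat \<Rightarrow> nat \<Rightarrow> nat" where
  "uncyc N j = (if j = 1 then N else if 2 \<le> j \<and> j \<le> N then j - 1 else j)"

lemma cyc_uncyc: "0 < N \<Longrightarrow> cyc N (uncyc N j) = j" "0 < N \<Longrightarrow> uncyc N (cyc N j) = j"
  by (auto simp: cyc_def uncyc_def)

lemma bij_cyc: "0 < N \<Longrightarrow> bij (cyc N)" and bij_uncyc: "0 < N \<Longrightarrow> bij (uncyc N)"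
  using cyc_uncyc by (metis bijI')+

lemma bij_swp: "bij (swp i)"
  by (rule o_bij[of "swp i"]) (auto simp: swp_def)

text \<open>The substitution of \<open>q^(-1) x_1\<close> for \<open>x_N\<close> and of
  \<open>x_(k+1)\<close> for \<open>x_k\<close> otherwise; hence the exponent of \<open>q\<close> is
  read off at \<open>N\<close> instead of 1.\<close>

definition lp_w_inv :: "nat \<Rightarrow> lpoly \<Rightarrow> lpoly" where
  "lp_w_inv N p = lp_map (\<lambda>m. qK powi (- Poly_Mapping.lookup m N)) (mono_perm (uncyc N)) p"

lemma qK_nonzero: "qK \<noteq> 0"
  by (simp add: qK_def Zero_fract_def eq_fract)

lemma lp_w_lp_w_inv: assumes "0 < N" shows "lp_w N (lp_w_inv N p) = p"
proof -
  have "mono_perm (cyc N) (mono_perm (uncyc N) m) = m" for m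
    by (rule poly_mapping_eqI) (simp add: lookup_mono_perm bij_cyc bij_uncyc cyc_uncyc assms)
  then show ?thesis using qK_nonzero lp_map_ident[of p] unfolding lp_w_def lp_w_inv_def lp_map_comp 
    by (simp add: lookup_mono_perm bij_uncyc assms uncyc_def power_int_minus)
qed

lemma lp_w_inv_lp_w: assumes "0 < N" shows "lp_w_inv N (lp_w N p) = p"
proof -
  have "mono_perm (uncyc N) (mono_perm (cyc N) m) = m" for m
    by (rule poly_mapping_eqI) (simp add: lookup_mono_perm bij_cyc bij_uncyc cyc_uncyc assms)
  then show ?thesis using qK_nonzero lp_map_ident[of p] unfolding lp_w_def lp_w_inv_def lp_map_comp 
    by (simp add: lookup_mono_perm bij_cyc assms cyc_def power_int_minus)
qed

section \<open>The field of rational functions and its automorphisms\<close>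

type_synonym lrat = "lpoly fract"

text \<open>The result is independent of the chosen fraction when \<open>h\<close> is an injective
  ring homomorphism, the only case in which it is evaluated.\<close>

definition fract_map :: "(lpoly \<Rightarrow> lpoly) \<Rightarrow> lrat \<Rightarrow> lrat" where
  "fract_map h z = (SOME y. \<exists>a b. b \<noteq> 0 \<and> z = Fract a b \<and> y = Fract (h a) (h b))"

definition rconst :: "K \<Rightarrow> lrat" where "rconst c = to_fract (lconst c)"
definition rvar :: "nat \<Rightarrow> lrat" where "rvar k = to_fract (Xv k)"

definition field_hom :: "(lrat \<Rightarrow> lrat) \<Rightarrow> bool" where
  "field_hom h \<longleftrightarrow> (\<forall>a b. h (a + b) = h a + h b) \<and> (\<forall>a b. h (a * b) = h a * h b) \<and> (\<forall>c. h (rconst c) = rconst c)"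

lemma lconst_simps [simp]: "lconst 0 = 0" "lconst 1 = 1"
  by (simp_all add: lconst_def)

lemma lconst_hom: "lconst (a + b) = lconst a + lconst b" "lconst (a * b) = lconst a * lconst b"
    "lconst (- a) = - lconst a" "lconst (a - b) = lconst a - lconst b"
  by (simp_all add: lconst_def single_add single_diff single_uminus mult_single)

lemma lconst_eq_iff [simp]: "lconst a = lconst b \<longleftrightarrow> a = b"
  by (metis lconst_def lookup_single_eq)

lemma rconst_simps [simp]: "rconst 0 = 0" "rconst 1 = 1" 
  by (simp_all add: rconst_def)

lemma rconst_hom: "rconst (a + b) = rconst a + rconst b" "rconst (a * b) = rconst a * rconst b" "rconst (- a) = - rconst a" "rconst (a - b) = rconst a - rconst b"
  by (simp_all add: rconst_def lconst_hom)

lemma rconst_eq_iff [simp]: "rconst a = rconst b \<longleftrightarrow> a = b"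
  by (simp add: rconst_def)

lemma rconst_eq_0_iff [simp]: "rconst a = 0 \<longleftrightarrow> a = 0"
  using rconst_eq_iff[of a 0] by simp

lemma rconst_sum: "rconst (sum f A) = (\<Sum>x\<in>A. rconst (f x))"
  by (induction A rule: infinite_finite_induct) (simp_all add: rconst_hom)

lemma field_homD:
  assumes "field_hom h"
  shows "h (a + b) = h a + h b" "h (a * b) = h a * h b" "h (rconst c) = rconst c" "h 0 = 0" "h 1 = 1"
    "h (- a) = - h a" "h (a - b) = h a - h b" "h (inverse a) = inverse (h a)" "h (a / b) = h a / h b"
    "h a = 0 \<longleftrightarrow> a = 0" "h (sum f A) = (\<Sum>x\<in>A. h (f x))"
proof -
  show add: "h (a + b) = h a + h b" and mul: "h (a * b) = h a * h b" and c: "h (rconst c) = rconst c" for a b c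
    using assms by (auto simp: field_hom_def)
  show z: "h 0 = 0" and o: "h 1 = 1" using c[of 0] c[of 1] by simp_all
  show m: "h (- a) = - h a" for a using add[of a "- a"] z by (simp add: eq_neg_iff_add_eq_0 add.commute)
  show "h (a - b) = h a - h b" using add[of a "- b"] m by simp
  show i: "h (inverse a) = inverse (h a)" for a
  proof (cases "a = 0")
    case False
    then have "h a * h (inverse a) = 1" using mul[of a "inverse a"] o by simp
    then show ?thesis by (metis inverse_unique)
  qed (simp add: z)
  show "h (a / b) = h a / h b" by (simp add: divide_inverse mul i)
  show "h a = 0 \<longleftrightarrow> a = 0"
  proof
    assume "h a = 0"
    then have "h (a * inverse a) = 0" using mul by simp
    then show "a = 0" using o by (cases "a = 0") auto
  qed (simp add: z)
  show "h (sum f A) = (\<Sum>x\<in>A. h (f x))"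
    by (induction A rule: infinite_finite_induct) (simp_all add: z add)
qed

lemma field_hom_comp: "field_hom g \<Longrightarrow> field_hom h \<Longrightarrow> field_hom (g \<circ> h)"
  by (simp add: field_hom_def)

lemma field_hom_id: "field_hom id"
  by (simp add: field_hom_def)

context
  fixes h :: "lpoly \<Rightarrow> lpoly"
  assumes h_add: "\<And>p q. h (p + q) = h p + h q" and h_mult: "\<And>p q. h (p * q) = h p * h q"
    and h_const: "\<And>c. h (lconst c) = lconst c" and h_inj: "\<And>p. h p = 0 \<Longrightarrow> p = 0"
begin

lemma fract_map_Fract: assumes "b \<noteq> 0" shows "fract_map h (Fract a b) = Fract (h a) (h b)"
  unfolding fract_map_def
proof (rule some_equality)
  fix y assume "\<exists>a' b'. b' \<noteq> 0 \<and> Fract a b = Fract a' b' \<and> y = Fract (h a') (h b')"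
  then obtain a' b' where ab: "b' \<noteq> 0" "Fract a b = Fract a' b'" "y = Fract (h a') (h b')" by blast
  then have "a * b' = a' * b" using assms by (simp add: eq_fract)
  then have "h a * h b' = h a' * h b" by (metis h_mult)
  moreover have "h b \<noteq> 0" "h b' \<noteq> 0" using ab(1) assms h_inj by blast+
  ultimately show "y = Fract (h a) (h b)" using ab(3) by (simp add: eq_fract)
qed (use assms in blast)

lemma fract_map_to_fract: "fract_map h (to_fract p) = to_fract (h p)"
  using fract_map_Fract[of 1 p] h_const[of 1] by (simp add: to_fract_def)

lemma fract_map_field_hom: "field_hom (fract_map h)"
  unfolding field_hom_def
proof (intro conjI allI)
  fix u v :: lrat and c
  obtain a b where u: "u = Fract a b" "b \<noteq> 0" by (cases u)
  obtain a' b' where v: "v = Fract a' b'" "b' \<noteq> 0" by (cases v)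
  have nz: "h b \<noteq> 0" "h b' \<noteq> 0" using u v h_inj by auto
  show "fract_map h (u + v) = fract_map h u + fract_map h v"
    using u v nz by (simp add: fract_map_Fract h_add h_mult)
  show "fract_map h (u * v) = fract_map h u * fract_map h v"
    using u v nz by (simp add: fract_map_Fract h_mult)
  show "fract_map h (rconst c) = rconst c" by (simp add: rconst_def fract_map_to_fract h_const)
qed

end

text \<open>Negative exponents are reached by cancelling a nonzero variable, and fractions by
  compatibility with division. All later identities between automorphisms are reduced to values on
  variables by this rule.\<close>

lemma field_hom_eqI:
  assumes g: "field_hom g" and h: "field_hom h" and x: "\<And>k. g (rvar k) = h (rvar k)"
  shows "g = h"
proof -
  have xm: "g (to_fract (Poly_Mapping.single (Poly_Mapping.single k n) 1))
      = h (to_fract (Poly_Mapping.single (Poly_Mapping.single k n) 1))" for k n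
  proof (induction n rule: int_induct[where k = 0])
    case base then show ?case using field_homD(5)[OF g] field_homD(5)[OF h] by simp
  next
    case (step1 n)
    have "Poly_Mapping.single (Poly_Mapping.single k (n + 1)) 1 = Poly_Mapping.single (Poly_Mapping.single k n) (1::K) * Xv k"
      by (simp add: Xv_def mult_single single_add)
    then show ?case using step1 x[of k] by (simp add: field_homD[OF g] field_homD[OF h] rvar_def)
  next
    case (step2 n)
    have e: "Poly_Mapping.single (Poly_Mapping.single k (n - 1)) 1 * Xv k = Poly_Mapping.single (Poly_Mapping.single k n) (1::K)"
      by (simp add: Xv_def mult_single single_add[symmetric])
    have nz: "h (rvar k) \<noteq> 0" by (simp add: field_homD[OF h] rvar_def Xv_def) (metis lookup_single_eq lookup_zero one_neq_zero)
    have "g (to_fract (Poly_Mapping.single (Poly_Mapping.single k (n - 1)) 1)) * g (rvar k) = 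
        h (to_fract (Poly_Mapping.single (Poly_Mapping.single k (n - 1)) 1)) * h (rvar k)"
      using step2 by (simp add: field_homD[OF g, symmetric] field_homD[OF h, symmetric] rvar_def to_fract_mult[symmetric] e del: to_fract_mult)
    then show ?case using nz x by simp
  qed
  have m: "g (to_fract (Poly_Mapping.single m 1)) = h (to_fract (Poly_Mapping.single m 1))" for m
  proof (induction m rule: poly_mapping_single_induct)
    case zero then show ?case using field_homD(5)[OF g] field_homD(5)[OF h] by simp
  next
    case (add p q)
    have "Poly_Mapping.single (p + q) (1::K) = Poly_Mapping.single p 1 * Poly_Mapping.single q 1" by (simp add: mult_single)
    then show ?case using add by (simp add: field_homD[OF g] field_homD[OF h])
  qed (rule xm)
  have p: "g (to_fract p) = h (to_fract p)" for p
  proof (induction p rule: poly_mapping_single_induct)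
    case zero then show ?case using field_homD(4)[OF g] field_homD(4)[OF h] by simp
  next
    case (single k c)
    have "Poly_Mapping.single k c = lconst c * Poly_Mapping.single k 1" by (simp add: lconst_def mult_single)
    then show ?case using m by (simp add: field_homD[OF g] field_homD[OF h] rconst_def[symmetric])
  qed (simp add: field_homD[OF g] field_homD[OF h])
  show ?thesis
  proof
    fix z show "g z = h z" by (cases z) (simp add: Fract_conv_to_fract field_homD[OF g] field_homD[OF h] p)
  qed
qed

definition swap_aut :: "nat \<Rightarrow> lrat \<Rightarrow> lrat" where "swap_aut i = fract_map (lp_swap i)"
definition rot_aut :: "nat \<Rightarrow> lrat \<Rightarrow> lrat" where "rot_aut N = fract_map (lp_w N)"
definition rot_aut_inv :: "nat \<Rightarrow> lrat \<Rightarrow> lrat" where "rot_aut_inv N = fract_map (lp_w_inv N)"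

lemma mono_perm_zero [simp]: "mono_perm \<sigma> 0 = 0"
  by (simp add: mono_perm_def)

lemma lp_swap_hom:
  "lp_swap i (p + q) = lp_swap i p + lp_swap i q" "lp_swap i (p * q) = lp_swap i p * lp_swap i q"
  "lp_swap i (lconst c) = lconst c" "lp_swap i (lp_swap i p) = p"
proof -
  have "mono_perm (swp i) (mono_perm (swp i) m) = m" for m
    by (rule poly_mapping_eqI) (simp add: lookup_mono_perm bij_swp, simp add: swp_def)
  then show "lp_swap i (lp_swap i p) = p" using lp_map_ident[of p] by (simp add: lp_swap_def lp_map_comp)
qed (simp_all add: lp_swap_def lp_map_add lp_map_mult mono_perm_add bij_swp lconst_def)

lemma lp_w_hom:
  assumes "0 < N" shows
  "lp_w N (p + q) = lp_w N p + lp_w N q" "lp_w N (p * q) = lp_w N p * lp_w N q"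
  "lp_w N (lconst c) = lconst c"
  using assms qK_nonzero by (simp_all add: lp_w_def lp_map_add lp_map_mult mono_perm_add bij_cyc lconst_def 
      lookup_add power_int_add)

lemma lp_w_inv_hom:
  assumes "0 < N" shows
  "lp_w_inv N (p + q) = lp_w_inv N p + lp_w_inv N q" "lp_w_inv N (p * q) = lp_w_inv N p * lp_w_inv N q"
  "lp_w_inv N (lconst c) = lconst c"
  using assms qK_nonzero by (simp_all add: lp_w_inv_def lp_map_add lp_map_mult mono_perm_add bij_uncyc lconst_def 
      lookup_add power_int_add power_int_diff power_int_minus)

lemma swap_aut_hom: "field_hom (swap_aut i)" and swap_aut_to_fract: "swap_aut i (to_fract p) = to_fract (lp_swap i p)"
proof -
  have inj: "p = 0" if "lp_swap i p = 0" for p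
    using lp_swap_hom(4)[of i p] that by (simp add: lp_swap_def)
  show "field_hom (swap_aut i)" unfolding swap_aut_def by (rule fract_map_field_hom[OF lp_swap_hom(1-3) inj])
  show "swap_aut i (to_fract p) = to_fract (lp_swap i p)"
    unfolding swap_aut_def by (rule fract_map_to_fract[OF lp_swap_hom(1-3) inj])
qed

lemma rot_aut_hom: "0 < N \<Longrightarrow> field_hom (rot_aut N)" and rot_aut_to_fract: "0 < N \<Longrightarrow> rot_aut N (to_fract p) = to_fract (lp_w N p)"
proof -
  assume N: "0 < N"
  have inj: "p = 0" if "lp_w N p = 0" for p
    using lp_w_inv_lp_w[OF N, of p] that by (simp add: lp_w_inv_def)
  show "field_hom (rot_aut N)" unfolding rot_aut_def by (rule fract_map_field_hom[OF lp_w_hom[OF N] inj])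
  show "rot_aut N (to_fract p) = to_fract (lp_w N p)"
    unfolding rot_aut_def by (rule fract_map_to_fract[OF lp_w_hom[OF N] inj])
qed

lemma rot_aut_inv_hom: "0 < N \<Longrightarrow> field_hom (rot_aut_inv N)"
  and rot_aut_inv_to_fract: "0 < N \<Longrightarrow> rot_aut_inv N (to_fract p) = to_fract (lp_w_inv N p)"
proof -
  assume N: "0 < N"
  have inj: "p = 0" if "lp_w_inv N p = 0" for p
    using lp_w_lp_w_inv[OF N, of p] that by (simp add: lp_w_def)
  show "field_hom (rot_aut_inv N)" unfolding rot_aut_inv_def by (rule fract_map_field_hom[OF lp_w_inv_hom[OF N] inj])
  show "rot_aut_inv N (to_fract p) = to_fract (lp_w_inv N p)"
    unfolding rot_aut_inv_def by (rule fract_map_to_fract[OF lp_w_inv_hom[OF N] inj])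
qed

lemma rvar_inj: "rvar k = rvar l \<Longrightarrow> k = l"
  by (simp add: rvar_def Xv_def) (metis keys_single one_neq_zero singleton_iff)

lemma swap_aut_rvar: "swap_aut i (rvar k) = rvar (swp i k)"
proof -
  have "mono_perm (swp i) (Poly_Mapping.single k 1) = Poly_Mapping.single (swp i k) 1"
    by (rule mono_perm_single[OF bij_swp]) (simp add: swp_def)
  then show ?thesis by (simp add: rvar_def swap_aut_to_fract lp_swap_def Xv_def)
qed

lemma rot_aut_rvar: assumes "0 < N" shows "rot_aut N (rvar k) = (if k = 1 then rconst qK else 1) * rvar (uncyc N k)"
proof -
  have "mono_perm (cyc N) (Poly_Mapping.single k 1) = Poly_Mapping.single (uncyc N k) 1"
    by (rule mono_perm_single[OF bij_cyc[OF assms]]) (simp add: cyc_uncyc assms)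
  then show ?thesis
    by (simp add: rvar_def rconst_def rot_aut_to_fract assms lp_w_def Xv_def lconst_def lookup_single mult_single when_def to_fract_mult[symmetric] del: to_fract_mult)
qed

lemma to_fract_power: "to_fract (a ^ n) = to_fract a ^ n"
  by (induction n) simp_all

section \<open>Infinite order of \<open>q\<close> and \<open>s\<close>; integer-indexed
  variables\<close>

lemma qK_power_eq_1: "qK ^ n = 1 \<Longrightarrow> n = 0"
proof -
  assume "qK ^ n = 1"
  moreover have "qK ^ n = to_fract ([:[:0, 1:]:] ^ n)" by (simp add: qK_def to_fract_def[symmetric] to_fract_power)
  ultimately have "[:[:0, 1:]:] ^ n = (1 :: complex poly poly)" by (metis to_fract_1 to_fract_eq_iff)
  moreover have "[:p:] ^ n = [:p ^ n:]" for p :: "complex poly" by (induction n) simp_all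
  ultimately have "[:0, 1:] ^ n = (1 :: complex poly)" by (simp add: one_pCons)
  then have "degree ([:0, 1:] ^ n :: complex poly) = 0" by simp
  then show "n = 0" by (subst (asm) degree_power_eq) auto
qed

lemma sK_power_eq_1: "sK ^ n = 1 \<Longrightarrow> n = 0"
proof -
  assume "sK ^ n = 1"
  moreover have "sK ^ n = to_fract ([:0, 1:] ^ n)" by (simp add: sK_def to_fract_def[symmetric] to_fract_power)
  ultimately have "[:0, 1:] ^ n = (1 :: complex poly poly)" by (metis to_fract_1 to_fract_eq_iff)
  then have "degree ([:0, 1:] ^ n :: complex poly poly) = 0" by simp
  then show "n = 0" by (subst (asm) degree_power_eq) auto
qed

lemma sK_nonzero: "sK \<noteq> 0"
  by (simp add: sK_def Zero_fract_def eq_fract)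

lemma powi_inj:
  fixes x :: "'a::field"
  assumes "x \<noteq> 0" "\<And>n. x ^ n = 1 \<Longrightarrow> n = 0" "x powi a = x powi b" shows "a = b"
proof -
  have *: "a = b" if "x powi a = x powi b" "a \<ge> b" for a b
  proof -
    have "x powi (a - b) = 1" using that assms(1) by (simp add: power_int_diff)
    then have "x ^ nat (a - b) = 1" using that(2) by (simp add: power_int_def)
    then show ?thesis using assms(2) that(2) by fastforce
  qed
  then show ?thesis using assms(3) by (metis linear)
qed

lemmas qK_powi_inj = powi_inj[OF qK_nonzero qK_power_eq_1]
lemmas sK_powi_inj = powi_inj[OF sK_nonzero sK_power_eq_1]

text \<open>The variables extended to all integer indices by \<open>X\<^bsub>j - N\<^esub> = q X\<^bsub>j\<^esub>\<close>, so that \<open>w\<close> becomes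
  the shift \<open>X\<^sub>j \<mapsto> X\<^bsub>j - 1\<^esub>\<close>.\<close>
definition pvar :: "nat \<Rightarrow> int \<Rightarrow> lrat" where
  "pvar N j = rconst (qK powi (- ((j - 1) div int N))) * rvar (nat ((j - 1) mod int N) + 1)"

lemma pvar_nat: assumes "1 \<le> k" "k \<le> N" shows "pvar N (int k) = rvar k"
proof -
  have "(int k - 1) div int N = 0" "(int k - 1) mod int N = int k - 1" using assms by simp_all
  then show ?thesis using assms by (simp add: pvar_def nat_diff_distrib)
qed

lemma pvar_add_mult: assumes "0 < N" shows "pvar N (j + int N * t) = rconst (qK powi (- t)) * pvar N j"
proof -
  have "j + int N * t - 1 = (j - 1) + t * int N" by simp
  then have "(j + int N * t - 1) div int N = t + (j - 1) div int N"
      "(j + int N * t - 1) mod int N = (j - 1) mod int N"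
    using assms by (simp_all only: div_mult_self1 mod_mult_self1)
  moreover have "qK powi (- (t + e)) = qK powi (- t) * qK powi (- e)" for e
    using power_int_add[of qK "- t" "- e"] qK_nonzero by simp
  ultimately show ?thesis by (simp add: pvar_def rconst_hom mult.assoc del: minus_add_distrib)
qed

lemma pvar_cases:
  assumes "0 < N"
  obtains k t where "1 \<le> k" "k \<le> N" "j = int k + int N * t"
proof
  let ?k = "nat ((j - 1) mod int N) + 1"
  have "0 \<le> (j - 1) mod int N" "(j - 1) mod int N < int N" using assms by simp_all
  then show "1 \<le> ?k" "?k \<le> N" by auto
  have "int ?k = (j - 1) mod int N + 1" using \<open>0 \<le> (j - 1) mod int N\<close> by simp
  then show "j = int ?k + int N * ((j - 1) div int N)" using mult_div_mod_eq[of "int N" "j - 1"] by linarith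
qed

lemma rconst_rvar_inj: assumes "rconst a * rvar k = rconst b * rvar l" "a \<noteq> 0" shows "a = b" "k = l"
proof -
  have "rconst c * rvar k = to_fract (Poly_Mapping.single (Poly_Mapping.single k 1) c)" for c k
    by (simp add: rconst_def rvar_def lconst_def Xv_def mult_single to_fract_mult[symmetric] del: to_fract_mult)
  with assms(1) have e: "Poly_Mapping.single (Poly_Mapping.single k (1::int)) a = Poly_Mapping.single (Poly_Mapping.single l 1) b"
    by simp
  then have "b \<noteq> 0" using assms(2) by (metis keys_single keys_zero insert_not_empty single_zero)
  with e assms(2) have "Poly_Mapping.single k (1::int) = Poly_Mapping.single l 1" by (metis keys_single singleton_inject)
  then show "k = l" by (metis keys_single singleton_inject one_neq_zero)
  with e show "a = b" by (metis lookup_single_eq)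
qed

text \<open>Indices in the same residue class differ by a power of \<open>q\<close>, and
  \<open>q\<close> has infinite order. This is the source of the distinctness of the automorphisms
  of distinct windows.\<close>

lemma pvar_inj: assumes "0 < N" "pvar N i = pvar N j" shows "i = j"
proof -
  obtain k t where k: "1 \<le> k" "k \<le> N" "i = int k + int N * t" using pvar_cases[OF assms(1)] .
  obtain l u where l: "1 \<le> l" "l \<le> N" "j = int l + int N * u" using pvar_cases[OF assms(1)] .
  have e: "rconst (qK powi (- t)) * rvar k = rconst (qK powi (- u)) * rvar l"
    using assms(2) unfolding k(3) l(3) pvar_add_mult[OF assms(1)] pvar_nat[OF k(1,2)] pvar_nat[OF l(1,2)] .
  have "qK powi (- t) \<noteq> 0" using qK_nonzero by simp
  from rconst_rvar_inj[OF e this] have "qK powi (- t) = qK powi (- u)" "k = l" .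
  then show ?thesis using qK_powi_inj[of "- t" "- u"] k l by simp
qed

text \<open>The field has a variable for every natural number. Those outside \<open>1..N\<close>
  must be fixed explicitly, or the automorphism would not be determined by \<open>b\<close>.\<close>

definition acts_by :: "nat \<Rightarrow> (int \<Rightarrow> int) \<Rightarrow> (lrat \<Rightarrow> lrat) \<Rightarrow> bool" where
  "acts_by N b h \<longleftrightarrow> field_hom h \<and> (\<forall>j. h (pvar N j) = pvar N (b j)) \<and> (\<forall>k. k \<notin> {1..N} \<longrightarrow> h (rvar k) = rvar k)"

lemma acts_by_unique: "acts_by N b g \<Longrightarrow> acts_by N b h \<Longrightarrow> g = h"
proof (rule field_hom_eqI)
  fix k assume "acts_by N b g" "acts_by N b h"
  then show "g (rvar k) = h (rvar k)"
    using pvar_nat[of k N] by (cases "k \<in> {1..N}") (auto simp: acts_by_def, metis)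
qed (auto simp: acts_by_def)

lemma acts_by_comp: "acts_by N b g \<Longrightarrow> acts_by N c h \<Longrightarrow> acts_by N (b \<circ> c) (g \<circ> h)"
  by (auto simp: acts_by_def intro: field_hom_comp)

lemma acts_by_id: "acts_by N id id"
  by (auto simp: acts_by_def field_hom_id)

lemma acts_byI:
  assumes "0 < N" "field_hom h" "\<And>k. k \<notin> {1..N} \<Longrightarrow> h (rvar k) = rvar k"
    and "\<And>k. 1 \<le> k \<Longrightarrow> k \<le> N \<Longrightarrow> h (rvar k) = pvar N (b (int k))"
    and "\<And>j t. b (j + int N * t) = b j + int N * t"
  shows "acts_by N b h"
  unfolding acts_by_def
proof (intro conjI allI impI)
  fix j
  obtain k t where k: "1 \<le> k" "k \<le> N" "j = int k + int N * t" using pvar_cases[OF assms(1)] .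
  show "h (pvar N j) = pvar N (b j)"
    unfolding k(3) pvar_add_mult[OF assms(1)] pvar_nat[OF k(1,2)] assms(5) field_homD[OF assms(2)] assms(4)[OF k(1,2)] ..
qed (use assms in auto)

lemma swap_aut_acts: assumes "1 \<le> i" "i < N" shows "acts_by N (affine_swap (int N) (int i)) (swap_aut i)"
proof (rule acts_byI)
  show "0 < N" using assms by simp
  show "swap_aut i (rvar k) = rvar k" if "k \<notin> {1..N}" for k using that assms by (auto simp: swap_aut_rvar swp_def)
  show "swap_aut i (rvar k) = pvar N (affine_swap (int N) (int i) (int k))" if k: "1 \<le> k" "k \<le> N" for k
  proof -
    have dvd: "int N dvd int k - int l \<longleftrightarrow> k = l" if "1 \<le> l" "l \<le> N" for l
      using that k zdvd_not_zless[of "int k - int l" "int N"] zdvd_not_zless[of "int l - int k" "int N"]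
        dvd_minus_iff[of "int N" "int k - int l"]
      by (cases k l rule: linorder_cases) auto
    have "int N dvd int k - int i - 1 \<longleftrightarrow> k = i + 1" using dvd[of "i + 1"] assms by (simp add: algebra_simps)
    then have "affine_swap (int N) (int i) (int k) = int (swp i k)"
      using dvd[of i] assms by (auto simp: affine_swap_def swp_def)
    moreover have "1 \<le> swp i k" "swp i k \<le> N" using assms k by (auto simp: swp_def)
    ultimately show ?thesis by (simp add: pvar_nat swap_aut_rvar)
  qed
qed (simp_all add: swap_aut_hom affine_swap_add_mult)

lemma rot_aut_acts: assumes "0 < N" shows "acts_by N (\<lambda>j. j + (- 1)) (rot_aut N)"
proof (rule acts_byI[OF assms rot_aut_hom[OF assms]])
  show "rot_aut N (rvar k) = rvar k" if "k \<notin> {1..N}" for k using that assms by (auto simp: rot_aut_rvar uncyc_def)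
  show "rot_aut N (rvar k) = pvar N (int k + - 1)" if k: "1 \<le> k" "k \<le> N" for k
  proof (cases "k = 1")
    case True
    have "pvar N (int N + int N * (- 1)) = rconst (qK powi 1) * rvar N"
      unfolding pvar_add_mult[OF assms] using pvar_nat[of N N] assms by simp
    then show ?thesis using True assms by (simp add: rot_aut_rvar uncyc_def)
  next
    case False
    then have "pvar N (int (k - 1)) = rvar (k - 1)" using k by (intro pvar_nat) auto
    then show ?thesis using False k assms by (simp add: rot_aut_rvar uncyc_def of_nat_diff)
  qed
qed simp

lemma rot_aut_rot_aut_inv: assumes "0 < N" shows "rot_aut N (rot_aut_inv N z) = z" "rot_aut_inv N (rot_aut N z) = z"
proof -
  have "rot_aut N \<circ> rot_aut_inv N = id"
    by (rule field_hom_eqI) (auto intro: field_hom_comp field_hom_id rot_aut_hom rot_aut_inv_hom assms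
        simp: rvar_def rot_aut_to_fract rot_aut_inv_to_fract assms lp_w_lp_w_inv)
  moreover have "rot_aut_inv N \<circ> rot_aut N = id"
    by (rule field_hom_eqI) (auto intro: field_hom_comp field_hom_id rot_aut_hom rot_aut_inv_hom assms
        simp: rvar_def rot_aut_to_fract rot_aut_inv_to_fract assms lp_w_inv_lp_w)
  ultimately show "rot_aut N (rot_aut_inv N z) = z" "rot_aut_inv N (rot_aut N z) = z" by (metis comp_apply id_apply)+
qed

section \<open>Seminormal coefficients and tableaux\<close>

text \<open>Every case of \<open>Tmat\<close> has diagonal entry \<open>coefA m\<close> with \<open>m = CT (i + 1) - CT i\<close>, also for cells in
  the same row (\<open>m = - 1\<close>) or column (\<open>m = 1\<close>). \<open>offdiag m\<close> is the matching off-diagonal entry into a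
  tableau with content difference \<open>m\<close>; it vanishes exactly when the swapped filling is not standard,
  so the Hecke relations become identities between functions of contents.\<close>
definition offdiag :: "int \<Rightarrow> K" where
  "offdiag m = (if m < 0 then coefB (- m) else if m = 1 then 0 else 1)"

lemma sK_powi_neq_1: "m \<noteq> 0 \<Longrightarrow> sK powi m \<noteq> 1"
  using sK_powi_inj[of m 0] by auto

lemma coefA_uminus: assumes "m \<noteq> 0" shows "coefA (- m) = sK - 1 - coefA m"
proof -
  have "sK powi m \<noteq> 0" "sK powi m \<noteq> 1" using sK_nonzero sK_powi_neq_1[OF assms] by simp_all
  then show ?thesis unfolding coefA_def power_int_minus by (simp add: field_simps)
qed

lemma coefA_one: "coefA 1 = - 1" "coefA (- 1) = sK"
proof -
  have "sK \<noteq> 1" using sK_powi_neq_1[of 1] by simp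
  then show "coefA 1 = - 1" by (simp add: coefA_def field_simps)
  then show "coefA (- 1) = sK" by (subst coefA_uminus) simp_all
qed

text \<open>With \<open>a = coefA m\<close> the right side is \<open>(s - a) (a + 1)\<close>. It is
  the product of off-diagonal entries which the quadratic relation forces on a 2 by 2 block with
  diagonal \<open>a\<close>, \<open>s - 1 - a\<close>.\<close>

lemma coefB_coefA: assumes "m \<noteq> 0" shows "coefB m = (sK - 1) * coefA m + sK - (coefA m)^2"
proof -
  define u where "u = sK powi m"
  have u: "u \<noteq> 1" "u \<noteq> 0" using sK_nonzero sK_powi_neq_1[OF assms] by (simp_all add: u_def)
  have p: "sK powi (m + 1) = u * sK" "sK powi (m - 1) = u / sK"
    using sK_nonzero by (simp_all add: u_def power_int_add power_int_diff)
  have d: "1 - u \<noteq> 0" using u by simp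
  have e: "sK * (1 - u / sK) = sK - u" using sK_nonzero by (simp add: field_simps)
  have "coefB m * (1 - u)^2 = (1 - u * sK) * (sK * (1 - u / sK))"
    using d unfolding coefB_def p u_def[symmetric] by simp
  also have "\<dots> = (1 - u * sK) * (sK - u)" unfolding e ..
  finally have 1: "coefB m * (1 - u)^2 = (1 - u * sK) * (sK - u)" .
  have a: "coefA m * (1 - u) = sK - 1" using d by (simp add: coefA_def u_def[symmetric])
  have "((sK - 1) * coefA m + sK - (coefA m)^2) * (1 - u)^2
      = (sK - 1) * (coefA m * (1 - u)) * (1 - u) + sK * (1 - u)^2 - (coefA m * (1 - u))^2"
    by (simp add: power2_eq_square algebra_simps)
  also have "\<dots> = (1 - u * sK) * (sK - u)" unfolding a by (simp add: power2_eq_square algebra_simps)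
  finally have "((sK - 1) * coefA m + sK - (coefA m)^2) * (1 - u)^2 = coefB m * (1 - u)^2" using 1 by simp
  then show ?thesis using d by simp
qed

text \<open>Since \<open>s\<close> is not a root of unity, no factor vanishes; this makes the
  division in the last case of \<open>Tmat\<close> legitimate.\<close>

lemma coefB_nonzero: assumes "m \<ge> 2" shows "coefB m \<noteq> 0"
  using sK_powi_neq_1[of "m + 1"] sK_powi_neq_1[of m] sK_powi_neq_1[of "m - 1"] sK_nonzero assms
  by (simp add: coefB_def)

lemma offdiag_mult: assumes "m \<noteq> 0" shows "offdiag m * offdiag (- m) = (sK - 1) * coefA m + sK - (coefA m)^2"
proof -
  have "coefB (- m) = coefB m"
    unfolding coefB_coefA[OF assms] using assms by (simp add: coefB_coefA coefA_uminus power2_eq_square algebra_simps)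
  moreover have "coefB 1 = 0" by (simp add: coefB_def)
  ultimately have "offdiag m * offdiag (- m) = coefB m" using assms by (auto simp: offdiag_def)
  then show ?thesis using coefB_coefA[OF assms] by simp
qed

text \<open>Used twice. With \<open>u\<close> a power of \<open>s\<close> to a content it yields the
  braid relation on tableaux; with \<open>u\<close> a variable it yields the parameter condition of
  the Yang-Baxter equation.\<close>

lemma dunkl_coef_identity:
  fixes u1 u2 u3 w :: "'a::field"
  assumes "u1 \<noteq> u2" "u1 \<noteq> u3" "u2 \<noteq> u3"
  shows "w * u1 / (u1 - u3) * (w * u1 / (u1 - u2) + w * u2 / (u2 - u3) - w)
       = (w * u1 / (u1 - u2)) * (w * u2 / (u2 - u3))"
proof -
  have d: "u1 - u2 \<noteq> 0" "u1 - u3 \<noteq> 0" "u2 - u3 \<noteq> 0" using assms by auto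
  have "w * u1 / (u1 - u2) + w * u2 / (u2 - u3) - w = w * (u1 - u3) * u2 / ((u1 - u2) * (u2 - u3))"
    using d by (simp add: divide_simps) (simp add: algebra_simps)
  then have "w * u1 / (u1 - u3) * (w * u1 / (u1 - u2) + w * u2 / (u2 - u3) - w)
      = (u1 - u3) * (w * u1 * (w * u2)) / ((u1 - u3) * ((u1 - u2) * (u2 - u3)))"
    by (simp add: mult_ac)
  also have "\<dots> = w * u1 * (w * u2) / ((u1 - u2) * (u2 - u3))" using d(2) by (rule mult_divide_mult_cancel_left)
  finally show ?thesis by simp
qed

lemma coefA_content: "coefA (b - a) = (sK - 1) * sK powi a / (sK powi a - sK powi b)"
proof -
  have "sK powi a \<noteq> 0" using sK_nonzero by simp
  then have "1 - sK powi (b - a) = (sK powi a - sK powi b) / sK powi a"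
    using sK_nonzero by (simp add: power_int_diff field_simps)
  then show ?thesis by (simp add: coefA_def)
qed

lemma coefA_identity:
  assumes "a \<noteq> b" "a \<noteq> c" "b \<noteq> c"
  shows "coefA (c - a) * (coefA (b - a) + coefA (c - b) - (sK - 1)) = coefA (b - a) * coefA (c - b)"
  unfolding coefA_content using assms by (intro dunkl_coef_identity) (metis sK_powi_inj)+

section \<open>Tableaux: consecutive entries and their contents\<close>

lemma partition_nth_mono:
  assumes "is_partition N lam" "r \<le> r'" "r' < length lam" shows "lam ! r' \<le> lam ! r"
proof -
  have "sorted_wrt (\<ge>) lam" using assms(1) by (simp add: is_partition_def sorted_wrt_rev)
  then show ?thesis using assms(2,3) by (cases "r = r'") (auto simp: sorted_wrt_iff_nth_less)
qed

lemma cells_down: "is_partition N lam \<Longrightarrow> (r', c') \<in> cells lam \<Longrightarrow> r \<le> r' \<Longrightarrow> c \<le> c' \<Longrightarrow> (r, c) \<in> cells lam"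
  using partition_nth_mono[of N lam r r'] by (auto simp: cells_def)

text \<open>Exchanging two entries may destroy standardness, but cells and contents still make sense
  for arbitrary bijective fillings, so intermediate fillings can be handled without case
  distinctions.\<close>

definition fillings :: "nat \<Rightarrow> nat list \<Rightarrow> tab set" where
  "fillings N lam = {T. bij_betw T (cells lam) {1..N} \<and> (\<forall>x. x \<notin> cells lam \<longrightarrow> T x = 0)}"

lemma Tab_fillings: "T \<in> Tab N lam \<Longrightarrow> T \<in> fillings N lam"
  by (simp add: Tab_def fillings_def)

lemma cellof_filling:
  assumes "T \<in> fillings N lam" "1 \<le> k" "k \<le> N"
  shows "cellof lam T k \<in> cells lam" "T (cellof lam T k) = k"
proof -
  have b: "bij_betw T (cells lam) {1..N}" using assms by (simp add: fillings_def)
  then obtain x where x: "x \<in> cells lam" "T x = k" using assms unfolding bij_betw_def by (metis atLeastAtMost_iff imageE)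
  have "\<exists>!x. x \<in> cells lam \<and> T x = k"
    using x b by (metis bij_betw_def inj_onD)
  from theI'[OF this] show "cellof lam T k \<in> cells lam" "T (cellof lam T k) = k" by (auto simp: cellof_def)
qed

lemma cellof_eq:
  assumes "T \<in> fillings N lam" "x \<in> cells lam" "T x = k"
  shows "cellof lam T k = x"
  unfolding cellof_def
  by (rule the_equality) (use assms in \<open>auto simp: fillings_def bij_betw_def dest: inj_onD\<close>)

lemma tswap_invol: "tswap (tswap T i j) i j = T"
  by (auto simp: tswap_def)

lemma tswap_swp: "1 \<le> i \<Longrightarrow> tswap T i (i + 1) x = swp i (T x)"
  by (simp add: tswap_def swp_def)

lemma swp_swp [simp]: "swp i (swp i k) = k"
  by (simp add: swp_def)

lemma tswap_filling:
  assumes "T \<in> fillings N lam" "1 \<le> i" "i < N" shows "tswap T i (i + 1) \<in> fillings N lam"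
proof -
  have "bij_betw (swp i) {1..N} {1..N}"
    by (rule bij_betw_byWitness[where f' = "swp i"]) (use assms in \<open>auto simp: swp_def\<close>)
  then have "bij_betw (swp i \<circ> T) (cells lam) {1..N}"
    using assms by (intro bij_betw_trans[where B = "{1..N}"]) (auto simp: fillings_def)
  moreover have "tswap T i (i + 1) = swp i \<circ> T" using tswap_swp[OF assms(2)] by auto
  ultimately show ?thesis using assms by (auto simp: fillings_def swp_def)
qed

lemma cellof_tswap:
  assumes "T \<in> fillings N lam" "1 \<le> i" "i < N" "1 \<le> k" "k \<le> N"
  shows "cellof lam (tswap T i (i + 1)) k = cellof lam T (swp i k)"
proof (rule cellof_eq[OF tswap_filling[OF assms(1-3)]])
  have "1 \<le> swp i k" "swp i k \<le> N" using assms by (auto simp: swp_def)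
  from cellof_filling[OF assms(1) this]
  show "cellof lam T (swp i k) \<in> cells lam" "tswap T i (i + 1) (cellof lam T (swp i k)) = k"
    by (simp_all add: tswap_swp[OF assms(2)] del: One_nat_def)
qed

lemma CT_tswap:
  assumes "T \<in> fillings N lam" "1 \<le> i" "i < N" "1 \<le> k" "k \<le> N"
  shows "CT lam (tswap T i (i + 1)) k = CT lam T (swp i k)"
  by (simp only: CT_def rowof_def colof_def cellof_tswap[OF assms])

lemma tswap_neq:
  assumes "T \<in> fillings N lam" "1 \<le> i" "i < N" shows "tswap T i (i + 1) \<noteq> T"
proof
  assume "tswap T i (i + 1) = T"
  moreover have "tswap T i (i + 1) (cellof lam T i) = i + 1"
    using cellof_filling[OF assms(1), of i] assms by (simp add: tswap_def)
  ultimately show False using cellof_filling[OF assms(1), of i] assms by simp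
qed

lemma Tab_strict:
  assumes "is_partition N lam" "T \<in> Tab N lam" "(r', c') \<in> cells lam" "r \<le> r'" "c \<le> c'" "(r, c) \<noteq> (r', c')"
  shows "T (r', c') < T (r, c)"
proof -
  have cl: "(r, c) \<in> cells lam" "(r, c') \<in> cells lam" using cells_down[OF assms(1,3)] assms(4,5) by auto
  have 1: "T (r, c') < T (r, c)" if "c < c'" using assms(2) cl that by (simp add: Tab_def)
  have 2: "T (r', c') < T (r, c')" if "r < r'" using assms(2,3) cl that by (auto simp: Tab_def)
  show ?thesis using assms(4-6) 1 2 by (cases "r = r'"; cases "c = c'") auto
qed

context
  fixes N lam T i
  assumes part: "is_partition N lam" and T: "T \<in> Tab N lam" and i: "1 \<le> i" "i < N"
begin

abbreviation (input) "ri \<equiv> rowof lam T i"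
abbreviation (input) "ci \<equiv> colof lam T i"
abbreviation (input) "rj \<equiv> rowof lam T (i + 1)"
abbreviation (input) "cj \<equiv> colof lam T (i + 1)"

lemma consecutive_cells:
  "(ri, ci) \<in> cells lam" "T (ri, ci) = i" "(rj, cj) \<in> cells lam" "T (rj, cj) = i + 1"
  using cellof_filling[OF Tab_fillings[OF T], of i] cellof_filling[OF Tab_fillings[OF T], of "i + 1"] i
  by (simp_all add: rowof_def colof_def)

text \<open>A further cell in this rectangle would carry an entry strictly between \<open>i\<close>
  and \<open>i + 1\<close>.\<close>

lemma between_consecutive:
  assumes "(r, c) \<in> cells lam" "rj \<le> r" "cj \<le> c" "r \<le> ri" "c \<le> ci" 
  shows "(r, c) = (ri, ci) \<or> (r, c) = (rj, cj)"
proof (rule ccontr)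
  assume "\<not> ?thesis"
  then have "T (ri, ci) < T (r, c)" "T (r, c) < T (rj, cj)"
    using Tab_strict[OF part T consecutive_cells(1) assms(4,5)] Tab_strict[OF part T assms(1-3)] by blast+
  then show False using consecutive_cells by simp
qed

lemma not_below: "\<not> (ri \<le> rj \<and> ci \<le> cj)"
proof
  assume "ri \<le> rj \<and> ci \<le> cj"
  moreover have "(ri, ci) \<noteq> (rj, cj)" using consecutive_cells(2,4) by (metis n_not_Suc_n Suc_eq_plus1)
  ultimately have "T (rj, cj) < T (ri, ci)" using Tab_strict[OF part T consecutive_cells(3)] by blast
  then show False using consecutive_cells by simp
qed

lemma content_same_row: assumes "ri = rj" shows "CT lam T (i + 1) - CT lam T i = - 1"
proof -
  have lt: "cj < ci" using not_below assms by simp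
  have "(ri, cj + 1) \<in> cells lam" using cells_down[OF part consecutive_cells(1), of ri "cj + 1"] lt by simp
  from between_consecutive[OF this] have "cj + 1 = ci" using assms lt by auto
  then show ?thesis using assms by (simp add: CT_def)
qed

lemma content_same_col: assumes "ci = cj" shows "CT lam T (i + 1) - CT lam T i = 1"
proof -
  have lt: "rj < ri" using not_below assms by simp
  have "(rj + 1, ci) \<in> cells lam" using cells_down[OF part consecutive_cells(1), of "rj + 1" ci] lt by simp
  from between_consecutive[OF this] have "rj + 1 = ri" using assms lt by auto
  then show ?thesis using assms by (simp add: CT_def)
qed

text \<open>If \<open>i\<close> is higher than \<open>i + 1\<close>, it must also lie strictly to
  the left: otherwise a corner of the rectangle between them would be a third cell. Row and column
  then each contribute at least 1 to the content difference.\<close>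

lemma content_generic:
  assumes "ri \<noteq> rj" "ci \<noteq> cj"
  shows "ri > rj \<Longrightarrow> CT lam T (i + 1) - CT lam T i \<ge> 2" "\<not> ri > rj \<Longrightarrow> CT lam T (i + 1) - CT lam T i \<le> - 2"
proof -
  show "CT lam T (i + 1) - CT lam T i \<ge> 2" if gt: "ri > rj"
  proof -
    have "\<not> cj < ci"
    proof
      assume lt: "cj < ci"
      have "(rj, ci) \<in> cells lam" using cells_down[OF part consecutive_cells(1), of rj ci] gt by simp
      from between_consecutive[OF this] show False using gt lt by auto
    qed
    then show ?thesis using assms gt by (simp add: CT_def)
  qed
  show "CT lam T (i + 1) - CT lam T i \<le> - 2" if "\<not> ri > rj"
    using that assms not_below by (simp add: CT_def)
qed

text \<open>Exchanging \<open>i\<close> and \<open>i + 1\<close> reverses only the comparison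
  between these two entries, which standardness does not constrain when they share neither row nor
  column.\<close>

lemma tswap_Tab: assumes "ri \<noteq> rj" "ci \<noteq> cj" shows "tswap T i (i + 1) \<in> Tab N lam"
proof -
  have lt: "tswap T i (i + 1) y < tswap T i (i + 1) x"
    if "T y < T x" "x \<in> cells lam" "y \<in> cells lam" "\<not> (fst x \<noteq> fst y \<and> snd x \<noteq> snd y)" for x y
  proof -
    have "\<not> (T y = i \<and> T x = i + 1)"
      using that(2-4) assms cellof_eq[OF Tab_fillings[OF T] that(2)] cellof_eq[OF Tab_fillings[OF T] that(3)]
      by (auto simp: rowof_def colof_def)
    then show ?thesis using that(1) by (auto simp: tswap_def)
  qed
  show ?thesis
    using tswap_filling[OF Tab_fillings[OF T] i] T lt unfolding Tab_def fillings_def by auto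
qed

lemma content_neq_0: "CT lam T (i + 1) - CT lam T i \<noteq> 0"
  using content_same_row content_same_col content_generic by (metis neg_0_le_iff_le not_numeral_le_zero zero_neq_one zero_neq_neg_one)

lemma offdiag_nonzero_tswap: assumes "offdiag (CT lam T (i + 1) - CT lam T i) \<noteq> 0" shows "tswap T i (i + 1) \<in> Tab N lam"
proof (rule tswap_Tab)
  show "ri \<noteq> rj" using content_same_row assms by (auto simp: offdiag_def coefB_def)
  show "ci \<noteq> cj" using content_same_col assms by (auto simp: offdiag_def)
qed

lemma Tmat_diag: "Tmat lam i T T = coefA (CT lam T (i + 1) - CT lam T i)"
proof -
  consider "ri = rj" | "ri \<noteq> rj" "ci = cj" | "ri \<noteq> rj" "ci \<noteq> cj" "ri > rj" | "ri \<noteq> rj" "ci \<noteq> cj" "\<not> ri > rj" by blast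
  then show ?thesis
  proof cases
    case 1 then show ?thesis using content_same_row by (simp add: Tmat_def coefA_one)
  next
    case 2 then show ?thesis using content_same_col by (simp add: Tmat_def coefA_one)
  next
    case 3 then show ?thesis by (simp add: Tmat_def Let_def)
  next
    case 4
    have "coefA (- (CT lam T i - CT lam T (i + 1))) = sK - 1 - coefA (CT lam T i - CT lam T (i + 1))"
      using content_neq_0 by (intro coefA_uminus) simp
    then show ?thesis using 4 by (simp add: Tmat_def Let_def)
  qed
qed

lemma Tmat_zero: "T' \<noteq> T \<Longrightarrow> T' \<noteq> tswap T i (i + 1) \<or> ri = rj \<or> ci = cj \<Longrightarrow> Tmat lam i T T' = 0"
  by (auto simp: Tmat_def Let_def)

text \<open>In the last case of \<open>Tmat\<close> the quotient equals 1 by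
  \<open>coefB_coefA\<close>: the basis is normalised so that one direction of an exchange has
  coefficient 1 and the other carries \<open>coefB\<close>.\<close>

lemma Tmat_offdiag: 
  assumes "ri \<noteq> rj" "ci \<noteq> cj"
  shows "Tmat lam i T (tswap T i (i + 1)) = offdiag (CT lam T i - CT lam T (i + 1))"
proof (cases "ri > rj")
  case True
  then show ?thesis using assms content_generic(1) tswap_neq[OF Tab_fillings[OF T] i]
    by (auto simp: Tmat_def Let_def offdiag_def)
next
  case False
  define m where "m = CT lam T i - CT lam T (i + 1)"
  have m: "m \<ge> 2" using content_generic(2)[OF assms False] by (simp add: m_def)
  have "((sK - 1) * coefA m + sK - (coefA m)^2) / coefB m = 1"
    using coefB_nonzero[OF m] coefB_coefA[of m] m by simp
  moreover have "Tmat lam i T (tswap T i (i + 1)) = ((sK - 1) * coefA m + sK - (coefA m)^2) / coefB m"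
    using False assms tswap_neq[OF Tab_fillings[OF T] i] by (simp add: Tmat_def Let_def m_def)
  moreover have "offdiag m = 1" using m by (simp add: offdiag_def)
  ultimately show ?thesis unfolding m_def[symmetric] by simp
qed

end

lemma finite_Tab: "finite (Tab N lam)"
proof -
  have "(cells lam) = Sigma {..<length lam} (\<lambda>r. {..<lam ! r})" by (auto simp: cells_def)
  then have "finite (cells lam)" by simp
  moreover have "Tab N lam \<subseteq> {T. \<forall>x. (x \<in> cells lam \<longrightarrow> T x \<in> {1..N}) \<and> (x \<notin> cells lam \<longrightarrow> T x = 0)}"
    by (auto simp: Tab_def bij_betw_def)
  ultimately show ?thesis using finite_set_of_finite_funs[of "cells lam" "{1..N}" 0] finite_subset by blast
qed

text \<open>Two cells on one diagonal span a rectangle with two further distinct corners. Their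
  entries would lie strictly between \<open>i\<close> and \<open>i + 2\<close>, where only one
  number is available. This keeps the third denominator of the braid relation nonzero.\<close>

lemma consecutive_contents_distinct:
  assumes part: "is_partition N lam" and T: "T \<in> Tab N lam" and i: "1 \<le> i" "i + 1 < N"
  shows "CT lam T i \<noteq> CT lam T (i + 2)"
proof
  assume eq: "CT lam T i = CT lam T (i + 2)"
  let ?r = "rowof lam T (i + 2)" and ?c = "colof lam T (i + 2)" and ?r' = "rowof lam T i" and ?c' = "colof lam T i"
  have cl: "(?r', ?c') \<in> cells lam" "T (?r', ?c') = i" "(?r, ?c) \<in> cells lam" "T (?r, ?c) = i + 2"
    using cellof_filling[OF Tab_fillings[OF T], of i] cellof_filling[OF Tab_fillings[OF T], of "i + 2"] i
    by (simp_all add: rowof_def colof_def)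
  have "(?r', ?c') \<noteq> (?r, ?c)" using cl(2,4) by (metis add_eq_self_zero zero_neq_numeral)
  then have "\<not> (?r' \<le> ?r \<and> ?c' \<le> ?c)"
    using Tab_strict[OF part T cl(3), of ?r' ?c'] cl by auto
  then have lt: "?r < ?r'" "?c < ?c'" using eq by (auto simp: CT_def)
  have c1: "(?r, ?c') \<in> cells lam" "(?r', ?c) \<in> cells lam" using cells_down[OF part cl(1)] lt by auto
  have "T (?r', ?c') < T (?r, ?c')" "T (?r, ?c') < T (?r, ?c)" "T (?r', ?c') < T (?r', ?c)" "T (?r', ?c) < T (?r, ?c)"
    using lt by (intro Tab_strict[OF part T] cl c1; simp)+
  then have "T (?r, ?c') = i + 1" "T (?r', ?c) = i + 1" using cl by auto
  then have "(?r, ?c') = (?r', ?c)" using c1 cellof_eq[OF Tab_fillings[OF T]] by metis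
  then show False using lt by simp
qed

text \<open>Recovering coefficients from operators on the vector-valued side requires a nonzero
  vector in \<open>V\<close>.\<close>

lemma Tab_nonempty: assumes "is_partition N lam" shows "Tab N lam \<noteq> {}"
proof -
  \<comment> \<open>The row reading filling: \<open>N\<close>, \<open>N - 1\<close>, ... along the
    rows from the bottom; \<open>sum_list (take r lam)\<close> counts the cells in lower
    rows.\<close>
  define T :: tab where "T = (\<lambda>(r, c). if (r, c) \<in> cells lam then N - sum_list (take r lam) - c else 0)"
  have sN: "sum_list lam = N" using assms by (simp add: is_partition_def)
  have step: "sum_list (take (Suc r) lam) = sum_list (take r lam) + lam ! r" if "r < length lam" for r
    using that by (simp add: take_Suc_conv_app_nth)
  have mono: "sum_list (take r lam) \<le> sum_list (take r' lam)" if "r \<le> r'" for r r'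
    using that by (metis le_add1 le_add_diff_inverse sum_list_append take_add)
  have leN: "sum_list (take r lam) \<le> N" for r
    using mono[of r "r + length lam"] sN by simp
  have lt: "T (r', c') < T (r, c)" if "(r, c) \<in> cells lam" "(r', c') \<in> cells lam" "r < r' \<or> (r = r' \<and> c < c')" for r c r' c'
  proof -
    have a: "sum_list (take r' lam) + c' < N"
      using step[of r'] leN[of "Suc r'"] that(2) by (auto simp: cells_def)
    have "sum_list (take r lam) + c < sum_list (take r' lam) + c'"
    proof (cases "r < r'")
      case True
      then have "sum_list (take (Suc r) lam) \<le> sum_list (take r' lam)" by (intro mono) simp
      then show ?thesis using step[of r] that(1) by (auto simp: cells_def)
    next
      case False then show ?thesis using that(3) by simp
    qed
    then show ?thesis using a that by (simp add: T_def)
  qed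
  have rng: "T x \<in> {1..N}" if "x \<in> cells lam" for x
  proof -
    obtain r c where x: "x = (r, c)" by (cases x)
    have "sum_list (take r lam) + c < N" using step[of r] leN[of "Suc r"] that x by (auto simp: cells_def)
    then show ?thesis using that x by (auto simp: T_def)
  qed
  have inj: "inj_on T (cells lam)"
  proof (rule inj_onI, rule ccontr)
    fix x y assume xy: "x \<in> cells lam" "y \<in> cells lam" "T x = T y" "x \<noteq> y"
    obtain r c r' c' where "x = (r, c)" "y = (r', c')" by (metis surj_pair)
    then show False using xy lt[of r c r' c'] lt[of r' c' r c]
      by (cases r r' rule: linorder_cases; cases c c' rule: linorder_cases) auto
  qed
  have cl: "cells lam = Sigma {..<length lam} (\<lambda>r. {..<lam ! r})" by (auto simp: cells_def)
  have "card (cells lam) = (\<Sum>r<length lam. lam ! r)" unfolding cl by (subst card_SigmaI) auto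
  also have "\<dots> = N" using sN by (simp add: sum_list_sum_nth atLeast0LessThan)
  finally have "card (cells lam) = N" .
  then have "T ` cells lam = {1..N}"
    using rng inj by (intro card_subset_eq) (auto simp: card_image)
  then have "T \<in> Tab N lam" using inj lt by (auto simp: Tab_def bij_betw_def T_def)
  then show ?thesis by blast
qed

section \<open>The Hecke algebra action on vector-valued functions\<close>

text \<open>Outside \<open>Tab\<close> the operator is the scalar \<open>s\<close>, so that the Hecke relations hold for arbitrary
  functions and no support condition has to be carried along.\<close>
definition hecke :: "nat \<Rightarrow> nat list \<Rightarrow> nat \<Rightarrow> (tab \<Rightarrow> lrat) \<Rightarrow> (tab \<Rightarrow> lrat)" where
  "hecke N lam i F = (\<lambda>T'. if T' \<in> Tab N lam then (\<Sum>T\<in>Tab N lam. rconst (Tmat lam i T T') * F T) else rconst sK * F T')"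

definition content_diff :: "nat list \<Rightarrow> tab \<Rightarrow> nat \<Rightarrow> int" where
  "content_diff lam T i = CT lam T (i + 1) - CT lam T i"

lemma content_diff_tswap:
  assumes "T \<in> fillings N lam" "1 \<le> i" "i < N"
  shows "content_diff lam (tswap T i (i + 1)) i = - content_diff lam T i"
  using assms by (simp add: content_diff_def CT_tswap[OF assms, simplified] swp_def)

lemma hecke_add: "hecke N lam i (\<lambda>T. F T + G T) = (\<lambda>T. hecke N lam i F T + hecke N lam i G T)"
  by (auto simp: hecke_def distrib_left sum.distrib)

lemma hecke_scale: "hecke N lam i (\<lambda>T. a * F T) = (\<lambda>T. a * hecke N lam i F T)"
  by (auto simp: hecke_def sum_distrib_left mult_ac)

lemma hecke_minus: "hecke N lam i (\<lambda>T. F T - G T) = (\<lambda>T. hecke N lam i F T - hecke N lam i G T)"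
  by (auto simp: hecke_def right_diff_distrib sum_subtractf)

lemma hecke_divide: "hecke N lam i (\<lambda>T. F T / a) = (\<lambda>T. hecke N lam i F T / a)"
  using hecke_scale[of N lam i "inverse a" F] by (simp add: field_simps)

lemma hecke_hom: "field_hom h \<Longrightarrow> hecke N lam i (\<lambda>T. h (F T)) = (\<lambda>T. h (hecke N lam i F T))"
  by (auto simp: hecke_def field_homD)

lemma hecke_off: "T \<notin> Tab N lam \<Longrightarrow> hecke N lam i F T = rconst sK * F T"
  by (simp add: hecke_def)

context
  fixes N lam
  assumes part: "is_partition N lam"
begin

text \<open>The value at \<open>T'\<close> collects a column of \<open>Tmat\<close>, so the
  off-diagonal entry is that of the exchanged tableau into \<open>T'\<close>. If the exchanged
  filling is not standard, \<open>offdiag\<close> is 0 and the extra term is harmless.\<close>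

lemma hecke_Tab:
  assumes T': "T' \<in> Tab N lam" and i: "1 \<le> i" "i < N"
  shows "hecke N lam i F T' = rconst (coefA (content_diff lam T' i)) * F T' + rconst (offdiag (content_diff lam T' i)) * F (tswap T' i (i + 1))"
proof -
  let ?U = "tswap T' i (i + 1)"
  note f = Tab_fillings[OF T']
  have neq: "?U \<noteq> T'" by (rule tswap_neq[OF f i])
  have swap_cell: "cellof lam ?U i = cellof lam T' (i + 1)" "cellof lam ?U (i + 1) = cellof lam T' i"
    using cellof_tswap[OF f i, of i] cellof_tswap[OF f i, of "i + 1"] i by (simp_all add: swp_def)
  have summand: "rconst (Tmat lam i T T') * F T = (if T = T' then rconst (coefA (content_diff lam T' i)) * F T' else 0)
      + (if T = ?U then rconst (offdiag (content_diff lam T' i)) * F ?U else 0)" if T: "T \<in> Tab N lam" for T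
  proof -
    consider "T = T'" | "T = ?U" | "T \<noteq> T'" "T \<noteq> ?U" by blast
    then show ?thesis
    proof cases
      case 1 then show ?thesis using neq Tmat_diag[OF part T' i] by (simp add: content_diff_def)
    next
      case 2
      have "Tmat lam i ?U T' = offdiag (content_diff lam T' i)"
      proof (cases "rowof lam ?U i = rowof lam ?U (i + 1) \<or> colof lam ?U i = colof lam ?U (i + 1)")
        case True
        then have "Tmat lam i ?U T' = 0" using Tmat_zero[OF part _ i, of ?U T'] T 2 neq by auto
        moreover have "rowof lam T' i = rowof lam T' (i + 1) \<or> colof lam T' i = colof lam T' (i + 1)"
          using True swap_cell by (auto simp: rowof_def colof_def)
        then have "content_diff lam T' i = - 1 \<or> content_diff lam T' i = 1"
          using content_same_row[OF part T' i] content_same_col[OF part T' i] unfolding content_diff_def by blast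
        then have "offdiag (content_diff lam T' i) = 0" by (auto simp: offdiag_def coefB_def)
        ultimately show ?thesis by simp
      next
        case False
        then have "Tmat lam i ?U (tswap ?U i (i + 1)) = offdiag (CT lam ?U i - CT lam ?U (i + 1))"
          using Tmat_offdiag[OF part _ i] T 2 by blast
        then show ?thesis
          using swap_cell by (simp only: tswap_invol content_diff_def CT_def rowof_def colof_def)
      qed
      then show ?thesis using 2 neq by simp
    next
      case 3
      have "T' \<noteq> tswap T i (i + 1)" using 3 by (metis tswap_invol)
      then show ?thesis using 3 Tmat_zero[OF part T i, of T'] by simp
    qed
  qed
  have "hecke N lam i F T' = (\<Sum>T\<in>Tab N lam. (if T = T' then rconst (coefA (content_diff lam T' i)) * F T' else 0)
      + (if T = ?U then rconst (offdiag (content_diff lam T' i)) * F ?U else 0))"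
    using T' summand by (simp add: hecke_def cong: sum.cong)
  also have "\<dots> = rconst (coefA (content_diff lam T' i)) * F T' + (if ?U \<in> Tab N lam then rconst (offdiag (content_diff lam T' i)) * F ?U else 0)"
    using T' finite_Tab by (simp add: sum.distrib sum.delta)
  also have "(if ?U \<in> Tab N lam then rconst (offdiag (content_diff lam T' i)) * F ?U else 0) = rconst (offdiag (content_diff lam T' i)) * F ?U"
    using offdiag_nonzero_tswap[OF part T' i] by (auto simp: content_diff_def)
  finally show ?thesis .
qed

text \<open>The local formula without a test for membership in \<open>Tab\<close>, so that
  compositions can be expanded mechanically even where an intermediate filling is not
  standard.\<close>

definition hecke_loc :: "nat \<Rightarrow> (tab \<Rightarrow> lrat) \<Rightarrow> (tab \<Rightarrow> lrat)" where
  "hecke_loc i F T = rconst (coefA (content_diff lam T i)) * F T + rconst (offdiag (content_diff lam T i)) * F (tswap T i (i + 1))"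

text \<open>Agreement of \<open>F\<close> and \<open>G\<close> is assumed on \<open>Tab\<close>
  only, which is what lets the rule be applied to nested occurrences.\<close>

lemma hecke_hecke_loc:
  assumes i: "1 \<le> i" "i < N" and eq: "\<And>T. T \<in> Tab N lam \<Longrightarrow> F T = G T" and T: "T \<in> Tab N lam"
  shows "hecke N lam i F T = hecke_loc i G T"
proof (cases "offdiag (content_diff lam T i) = 0")
  case True
  then show ?thesis using hecke_Tab[OF T i] eq[OF T] by (simp add: hecke_loc_def)
next
  case False
  then have "tswap T i (i + 1) \<in> Tab N lam" using offdiag_nonzero_tswap[OF part T i] by (simp add: content_diff_def)
  then show ?thesis using hecke_Tab[OF T i] eq T by (simp add: hecke_loc_def)
qed

lemma hecke_quadratic:
  assumes i: "1 \<le> i" "i < N"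
  shows "hecke N lam i (hecke N lam i F) T = rconst (sK - 1) * hecke N lam i F T + rconst sK * F T"
proof (cases "T \<in> Tab N lam")
  case True
  let ?m = "content_diff lam T i" and ?U = "tswap T i (i + 1)"
  have m: "?m \<noteq> 0" using content_neq_0[OF part True i] by (simp add: content_diff_def)
  have mU: "content_diff lam ?U i = - ?m" by (rule content_diff_tswap[OF Tab_fillings[OF True] i])
  have "hecke N lam i (hecke N lam i F) T = rconst (coefA ?m) * (rconst (coefA ?m) * F T + rconst (offdiag ?m) * F ?U)
     + rconst (offdiag ?m) * (rconst (coefA (- ?m)) * F ?U + rconst (offdiag (- ?m)) * F T)"
  proof -
    have "hecke N lam i (hecke N lam i F) T = hecke_loc i (hecke_loc i F) T" by (intro hecke_hecke_loc i True refl)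
    then show ?thesis using mU by (simp add: hecke_loc_def tswap_invol)
  qed
  also have "\<dots> = rconst (coefA ?m ^ 2 + offdiag ?m * offdiag (- ?m)) * F T
      + rconst (offdiag ?m * (coefA ?m + coefA (- ?m))) * F ?U"
    by (simp add: rconst_hom power2_eq_square algebra_simps)
  also have "\<dots> = rconst ((sK - 1) * coefA ?m + sK) * F T + rconst (offdiag ?m * (sK - 1)) * F ?U"
    using m by (simp add: offdiag_mult coefA_uminus)
  also have "\<dots> = rconst (sK - 1) * hecke N lam i F T + rconst sK * F T"
    unfolding hecke_Tab[OF True i] by (simp add: rconst_hom algebra_simps)
  finally show ?thesis .
next
  case False
  then show ?thesis by (simp add: hecke_off rconst_hom algebra_simps)
qed

lemma hecke_commute:
  assumes i: "1 \<le> i" "i + 1 < j" "j < N"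
  shows "hecke N lam i (hecke N lam j F) T = hecke N lam j (hecke N lam i F) T"
proof (cases "T \<in> Tab N lam")
  case True
  note f = Tab_fillings[OF True]
  have i': "1 \<le> i" "i < N" and j': "1 \<le> j" "j < N" using i by auto
  let ?a = "content_diff lam T i" and ?b = "content_diff lam T j" and ?U = "tswap T i (i + 1)" and ?V = "tswap T j (j + 1)"
  have c: "content_diff lam ?U j = ?b" "content_diff lam ?V i = ?a"
    unfolding content_diff_def using i CT_tswap[OF f i', of j] CT_tswap[OF f i', of "j + 1"]
      CT_tswap[OF f j', of i] CT_tswap[OF f j', of "i + 1"] by (simp_all add: swp_def)
  have "tswap ?U j (j + 1) = tswap ?V i (i + 1)" using i by (auto simp: tswap_def)
  moreover have "hecke N lam i (hecke N lam j F) T = hecke_loc i (hecke_loc j F) T" by (intro hecke_hecke_loc i' j' True refl)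
  moreover have "hecke N lam j (hecke N lam i F) T = hecke_loc j (hecke_loc i F) T" by (intro hecke_hecke_loc i' j' True refl)
  ultimately show ?thesis using c by (simp add: hecke_loc_def algebra_simps)
qed (simp add: hecke_off)

text \<open>\<open>F0\<close> to \<open>F5\<close> are the values on the six fillings in the orbit
  of \<open>i\<close>, \<open>i + 1\<close>, \<open>i + 2\<close>. The diagonal coefficients
  \<open>a\<close>, \<open>b\<close>, \<open>c\<close> belong to the three content differences;
  \<open>e\<close>, \<open>f\<close>, \<open>g\<close> lead away from the base filling and
  \<open>e'\<close>, \<open>f'\<close> lead back.\<close>

lemma hecke_braid_algebra:
  fixes a b c :: "'a::comm_ring_1"
  assumes "c * (a + b - w) = a * b" "e * e' = w * a + v - a * a" "f * f' = w * b + v - b * b"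
  shows "a * (b * (a * F0 + e * F1) + f * (c * F2 + g * F3))
      + e * (c * ((w - a) * F1 + e' * F0) + g * (b * F4 + f * F5))
    = b * (a * (b * F0 + f * F2) + e * (c * F1 + g * F4))
      + f * (c * ((w - b) * F2 + f' * F0) + g * (a * F3 + e * F5))"
proof -
  have 1: "a * b + c * (w - a) = b * c" "b * a + c * (w - b) = a * c"
    using assms(1) by (simp_all add: algebra_simps)
  have "a * b * a + e * e' * c = a * b * a + (w * a + v - a * a) * c" unfolding assms(2) ..
  also have "\<dots> = b * a * b + (w * b + v - b * b) * c + (a - b) * (a * b - c * (a + b - w))" by (simp add: algebra_simps)
  also have "\<dots> = b * a * b + f * f' * c" unfolding assms(1,3) by simp
  finally have 2: "a * b * a + e * e' * c = b * a * b + f * f' * c" .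
  have "a * (b * (a * F0 + e * F1) + f * (c * F2 + g * F3))
      + e * (c * ((w - a) * F1 + e' * F0) + g * (b * F4 + f * F5))
    = (a * b * a + e * e' * c) * F0 + e * (a * b + c * (w - a)) * F1 + f * (a * c) * F2
      + a * f * g * F3 + e * g * b * F4 + e * g * f * F5" by (simp add: algebra_simps)
  also have "\<dots> = (b * a * b + f * f' * c) * F0 + e * (b * c) * F1 + f * (b * a + c * (w - b)) * F2
      + a * f * g * F3 + e * g * b * F4 + e * g * f * F5" unfolding 1 2 ..
  also have "\<dots> = b * (a * (b * F0 + f * F2) + e * (c * F1 + g * F4))
      + f * (c * ((w - b) * F2 + f' * F0) + g * (a * F3 + e * F5))" by (simp add: algebra_simps)
  finally show ?thesis .
qed

text \<open>All six fillings have contents permuted from \<open>c1\<close>, \<open>c2\<close>,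
  \<open>c3\<close>, so the relation becomes an identity in three content differences. Some of the
  fillings may fail to be standard, which is why \<open>hecke_loc\<close> is used.\<close>

lemma hecke_braid:
  assumes i: "1 \<le> i" "i + 1 < N"
  shows "hecke N lam i (hecke N lam (i + 1) (hecke N lam i F)) T = hecke N lam (i + 1) (hecke N lam i (hecke N lam (i + 1) F)) T"
proof (cases "T \<in> Tab N lam")
  case True
  note f = Tab_fillings[OF True]
  define j where "j = i + 1"
  have i': "1 \<le> i" "i < N" and j': "1 \<le> j" "j < N" using i by (auto simp: j_def)
  define c1 where "c1 = CT lam T i"
  define c2 where "c2 = CT lam T (i + 1)"
  define c3 where "c3 = CT lam T (i + 2)"
  have ne: "c1 \<noteq> c2" "c2 \<noteq> c3" "c1 \<noteq> c3"
    using content_neq_0[OF part True i'] content_neq_0[OF part True j'] consecutive_contents_distinct[OF part True i]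
    by (simp_all add: c1_def c2_def c3_def j_def)
  define s where "s = (\<lambda>T. tswap T i (i + 1))"
  define t where "t = (\<lambda>T. tswap T j (j + 1))"
  have sf: "s U \<in> fillings N lam" and tf: "t U \<in> fillings N lam" if "U \<in> fillings N lam" for U
    using that tswap_filling i' j' by (auto simp: s_def t_def)
  have CTs: "CT lam (s U) i = CT lam U (i + 1)" "CT lam (s U) (i + 1) = CT lam U i" "CT lam (s U) (i + 2) = CT lam U (i + 2)"
    and CTt: "CT lam (t U) i = CT lam U i" "CT lam (t U) (i + 1) = CT lam U (i + 2)" "CT lam (t U) (i + 2) = CT lam U (i + 1)"
    if "U \<in> fillings N lam" for U
    unfolding s_def t_def
    using CT_tswap[OF that i', of i] CT_tswap[OF that i', of "i + 1"] CT_tswap[OF that i', of "i + 2"]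
      CT_tswap[OF that j', of i] CT_tswap[OF that j', of "i + 1"] CT_tswap[OF that j', of "i + 2"] i
    by (simp_all add: swp_def j_def)
  have d: "content_diff lam T i = c2 - c1" "content_diff lam T j = c3 - c2"
     "content_diff lam (s T) i = c1 - c2" "content_diff lam (s T) j = c3 - c1"
     "content_diff lam (t T) i = c3 - c1" "content_diff lam (t T) j = c2 - c3"
     "content_diff lam (t (s T)) i = c3 - c2" "content_diff lam (t (s T)) j = c1 - c3"
     "content_diff lam (s (t T)) i = c1 - c3" "content_diff lam (s (t T)) j = c2 - c1"
    by (simp_all add: content_diff_def j_def CTs CTt sf tf f c1_def c2_def c3_def del: add_2_eq_Suc' add.assoc flip: one_add_one)
       (simp_all add: CTs[simplified] CTt[simplified] sf tf f)
  have inv: "s (s U) = U" "t (t U) = U" for U by (simp_all add: s_def t_def tswap_invol)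
  have long: "s (t (s T)) = t (s (t T))"
    unfolding s_def t_def j_def using i by (auto simp: tswap_def)
  have tEs: "hecke_loc i G U = rconst (coefA (content_diff lam U i)) * G U + rconst (offdiag (content_diff lam U i)) * G (s U)"
    and tEt: "hecke_loc j G U = rconst (coefA (content_diff lam U j)) * G U + rconst (offdiag (content_diff lam U j)) * G (t U)" for G U
    by (simp_all add: hecke_loc_def s_def t_def)
  have neg: "rconst (coefA (c1 - c2)) = rconst (sK - 1) - rconst (coefA (c2 - c1))"
    "rconst (coefA (c2 - c3)) = rconst (sK - 1) - rconst (coefA (c3 - c2))"
    using coefA_uminus[of "c2 - c1"] coefA_uminus[of "c3 - c2"] ne by (auto simp: rconst_hom)
  have prod: "rconst (offdiag (c2 - c1)) * rconst (offdiag (c1 - c2))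
      = rconst (sK - 1) * rconst (coefA (c2 - c1)) + rconst sK - rconst (coefA (c2 - c1)) * rconst (coefA (c2 - c1))"
    "rconst (offdiag (c3 - c2)) * rconst (offdiag (c2 - c3))
      = rconst (sK - 1) * rconst (coefA (c3 - c2)) + rconst sK - rconst (coefA (c3 - c2)) * rconst (coefA (c3 - c2))"
    using arg_cong[OF offdiag_mult[of "c2 - c1"], of rconst] arg_cong[OF offdiag_mult[of "c3 - c2"], of rconst] ne
    by (simp_all only: rconst_hom power2_eq_square) auto
  have base: "rconst (coefA (c3 - c1)) * (rconst (coefA (c2 - c1)) + rconst (coefA (c3 - c2)) - rconst (sK - 1))
      = rconst (coefA (c2 - c1)) * rconst (coefA (c3 - c2))"
    using arg_cong[OF coefA_identity[of c1 c2 c3], of rconst] ne by (simp only: rconst_hom) auto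
  have "hecke_loc i (hecke_loc j (hecke_loc i F)) T = hecke_loc j (hecke_loc i (hecke_loc j F)) T"
    unfolding tEs tEt d inv long neg
    by (rule hecke_braid_algebra[OF base prod])
  moreover have "hecke N lam i (hecke N lam j (hecke N lam i F)) T = hecke_loc i (hecke_loc j (hecke_loc i F)) T"
    by (intro hecke_hecke_loc i' j' True refl)
  moreover have "hecke N lam j (hecke N lam i (hecke N lam j F)) T = hecke_loc j (hecke_loc i (hecke_loc j F)) T"
    by (intro hecke_hecke_loc i' j' True refl)
  ultimately show ?thesis by (simp add: j_def)
qed (simp add: hecke_off)

end

section \<open>Normalised intertwiners\<close>

fun hecke_word :: "nat \<Rightarrow> nat list \<Rightarrow> nat \<Rightarrow> (tab \<Rightarrow> lrat) \<Rightarrow> (tab \<Rightarrow> lrat)" where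
  "hecke_word N lam 0 F = F"
| "hecke_word N lam (Suc k) F = hecke N lam (Suc k) (hecke_word N lam k F)"

text \<open>The Baxterised Hecke generator with spectral parameter \<open>a\<close>, normalised so
  that it acts as the identity wherever \<open>T_i\<close> acts as \<open>s\<close>.\<close>

definition rmat :: "nat \<Rightarrow> nat list \<Rightarrow> nat \<Rightarrow> lrat \<Rightarrow> (tab \<Rightarrow> lrat) \<Rightarrow> (tab \<Rightarrow> lrat)" where
  "rmat N lam i a F = (\<lambda>T. (hecke N lam i F T - a * F T) / (rconst sK - a))"

text \<open>For \<open>j = i + 1\<close> this is the \<open>a_i\<close> of the overview. Arbitrary
  pairs of integer indices are allowed so that window automorphisms merely permute the
  parameters.\<close>

definition xcoef :: "nat \<Rightarrow> int \<Rightarrow> int \<Rightarrow> lrat" where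
  "xcoef N i j = rconst (sK - 1) * pvar N j / (pvar N j - pvar N i)"

definition swap_op :: "nat \<Rightarrow> nat list \<Rightarrow> nat \<Rightarrow> (tab \<Rightarrow> lrat) \<Rightarrow> (tab \<Rightarrow> lrat)" where
  "swap_op N lam i F = rmat N lam i (xcoef N (int i) (int i + 1)) (\<lambda>T. swap_aut i (F T))"

definition rot_op :: "nat \<Rightarrow> nat list \<Rightarrow> (tab \<Rightarrow> lrat) \<Rightarrow> (tab \<Rightarrow> lrat)" where
  "rot_op N lam F = hecke_word N lam (N - 1) (\<lambda>T. rot_aut N (F T))"

lemma xcoef_acts: "acts_by N b h \<Longrightarrow> h (xcoef N i j) = xcoef N (b i) (b j)"
  by (simp add: acts_by_def xcoef_def field_homD)

lemma xcoef_flip: assumes "0 < N" "i \<noteq> j" shows "xcoef N i j + xcoef N j i = rconst (sK - 1)"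
proof -
  have ne: "pvar N i - pvar N j \<noteq> 0" using pvar_inj assms by auto
  have "xcoef N i j = - (rconst (sK - 1) * pvar N j / (pvar N i - pvar N j))"
    unfolding xcoef_def by (metis minus_diff_eq divide_minus_right)
  then have "xcoef N i j + xcoef N j i = (rconst (sK - 1) * (pvar N i - pvar N j)) / (pvar N i - pvar N j)"
    by (simp add: xcoef_def diff_divide_distrib right_diff_distrib)
  then show ?thesis using ne by simp
qed

lemma xcoef_identity:
  assumes "0 < N" "i \<noteq> j" "i \<noteq> k" "j \<noteq> k"
  shows "xcoef N i k * (xcoef N i j + xcoef N j k - rconst (sK - 1)) = xcoef N i j * xcoef N j k"
proof -
  have "pvar N k \<noteq> pvar N j" "pvar N k \<noteq> pvar N i" "pvar N j \<noteq> pvar N i" using pvar_inj[OF assms(1)] assms(2-4) by blast+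
  from dunkl_coef_identity[OF this, of "rconst (sK - 1)"] show ?thesis
    unfolding xcoef_def[symmetric] by (simp add: add.commute mult.commute)
qed

text \<open>Vanishing would amount to \<open>x_(i+1) = s x_i\<close>. The normalising denominator of
  the intertwiner is therefore nonzero.\<close>

lemma xcoef_neq: assumes "1 \<le> i" "i < N" shows "rconst sK - xcoef N (int i) (int i + 1) \<noteq> 0"
proof
  assume 0: "rconst sK - xcoef N (int i) (int i + 1) = 0"
  have x: "pvar N (int i) = rvar i" "pvar N (int i + 1) = rvar (i + 1)"
    using assms pvar_nat[of i N] pvar_nat[of "i + 1" N] by (simp_all add: add.commute)
  have ne: "rvar (i + 1) - rvar i \<noteq> 0" using rvar_inj[of "i + 1" i] by auto
  from 0 have "rconst sK * (rvar (i + 1) - rvar i) = rconst (sK - 1) * rvar (i + 1)" using ne by (simp add: xcoef_def x)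
  then have "rconst 1 * rvar (i + 1) = rconst sK * rvar i" by (simp add: rconst_hom algebra_simps)
  from rconst_rvar_inj(2)[OF this] show False by simp
qed

lemma rmat_hom:
  assumes "field_hom h" shows "(\<lambda>T. h (rmat N lam i a F T)) = rmat N lam i (h a) (\<lambda>T. h (F T))"
  by (simp add: rmat_def field_homD[OF assms] hecke_hom[OF assms])

lemma hecke_rmat: "hecke N lam j (rmat N lam i a F) = (\<lambda>T. (hecke N lam j (hecke N lam i F) T - a * hecke N lam j F T) / (rconst sK - a))"
  by (simp add: rmat_def hecke_divide hecke_minus hecke_scale)

lemma hecke_word_hom: "field_hom h \<Longrightarrow> hecke_word N lam k (\<lambda>T. h (F T)) = (\<lambda>T. h (hecke_word N lam k F T))"
  by (induction k) (simp_all add: hecke_hom)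

lemma hecke_word_lin: "hecke_word N lam k (\<lambda>T. (F T - a * G T) / c) = (\<lambda>T. (hecke_word N lam k F T - a * hecke_word N lam k G T) / c)"
  by (induction k) (simp_all add: hecke_divide hecke_minus hecke_scale)

context
  fixes N lam
  assumes part: "is_partition N lam" and N2: "N \<ge> 2"
begin

text \<open>When \<open>a + a' = s - 1\<close>, the quadratic relation turns
  \<open>(T_i - a) (T_i - a')\<close> into the scalar \<open>s + a a'\<close>, which equals the
  product of the two denominators.\<close>

lemma rmat_invol:
  assumes i: "1 \<le> i" "i < N" and a: "a + a' = rconst (sK - 1)" "rconst sK - a \<noteq> 0" "rconst sK - a' \<noteq> 0"
  shows "rmat N lam i a (rmat N lam i a' F) = F"
proof
  fix T
  let ?X = "hecke N lam i F T" and ?F = "F T"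
  have a': "a' = rconst (sK - 1) - a" using a(1) by (simp add: algebra_simps)
  have den: "(rconst sK - a') * (rconst sK - a) = rconst sK + a * a'"
    unfolding a' by (simp add: rconst_hom algebra_simps)
  have "rmat N lam i a (rmat N lam i a' F) T
     = ((hecke N lam i (hecke N lam i F) T - a' * ?X) / (rconst sK - a') - a * ((?X - a' * ?F) / (rconst sK - a'))) / (rconst sK - a)"
    by (simp add: rmat_def[of N lam i a] hecke_rmat) (simp add: rmat_def)
  also have "\<dots> = (rconst (sK - 1) * ?X + rconst sK * ?F - a' * ?X - a * (?X - a' * ?F)) / ((rconst sK - a') * (rconst sK - a))"
    unfolding hecke_quadratic[OF part i] by (simp add: diff_divide_distrib right_diff_distrib)
  also have "rconst (sK - 1) * ?X + rconst sK * ?F - a' * ?X - a * (?X - a' * ?F) = (rconst sK + a * a') * ?F"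
    unfolding a' by (simp add: algebra_simps)
  also have "\<dots> / ((rconst sK - a') * (rconst sK - a)) = ?F"
    using a(2,3) unfolding den[symmetric] by simp
  finally show "rmat N lam i a (rmat N lam i a' F) T = F T" .
qed

lemma rmat_commute:
  assumes i: "1 \<le> i" "i + 1 < j" "j < N"
  shows "rmat N lam i a (rmat N lam j b F) = rmat N lam j b (rmat N lam i a F)"
proof
  fix T
  have expand: "rmat N lam k a (rmat N lam l b F) T
     = (hecke N lam k (hecke N lam l F) T - b * hecke N lam k F T - (a * hecke N lam l F T - a * b * F T)) / ((rconst sK - b) * (rconst sK - a))" for k l a b
    by (simp add: rmat_def hecke_divide hecke_minus hecke_scale diff_divide_distrib right_diff_distrib)
  show "rmat N lam i a (rmat N lam j b F) T = rmat N lam j b (rmat N lam i a F) T"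
    unfolding expand hecke_commute[OF part i] by (simp add: algebra_simps)
qed

text \<open>The cubic terms agree by the braid relation, and the mixed quadratic terms agree
  outright. After reducing squares, the difference of the remaining linear terms is a multiple of
  \<open>a c - b (a + c - (s - 1))\<close>, which vanishes by hypothesis.\<close>

lemma rmat_yang_baxter:
  assumes i: "1 \<le> i" "i + 1 < N" and abc: "b * (a + c - rconst (sK - 1)) = a * c"
  shows "rmat N lam i a (rmat N lam (i + 1) b (rmat N lam i c F))
       = rmat N lam (i + 1) c (rmat N lam i b (rmat N lam (i + 1) a F))"
proof
  fix T
  define j where "j = i + 1"
  have i': "1 \<le> i" "i < N" and j': "1 \<le> j" "j < N" using i by (auto simp: j_def)
  define X where "X = (\<lambda>H. hecke N lam i H T)"
  define Y where "Y = (\<lambda>H. hecke N lam j H T)"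
  have quad: "X (hecke N lam i F) = rconst (sK - 1) * X F + rconst sK * F T" "Y (hecke N lam j F) = rconst (sK - 1) * Y F + rconst sK * F T"
    unfolding X_def Y_def by (rule hecke_quadratic[OF part i'], rule hecke_quadratic[OF part j'])
  have braid: "X (hecke N lam j (hecke N lam i F)) = Y (hecke N lam i (hecke N lam j F))"
    unfolding X_def Y_def j_def by (rule hecke_braid[OF part i])
  have expand: "rmat N lam k a (rmat N lam l b (rmat N lam k c F)) T
    = (hecke N lam k (hecke N lam l (hecke N lam k F)) T - c * hecke N lam k (hecke N lam l F) T - b * hecke N lam k (hecke N lam k F) T
        + b * c * hecke N lam k F T - a * hecke N lam l (hecke N lam k F) T + a * c * hecke N lam l F T 
        + a * b * hecke N lam k F T - a * b * c * F T) / ((rconst sK - c) * (rconst sK - b) * (rconst sK - a))" for k l a b c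
    by (simp add: rmat_def hecke_divide hecke_minus hecke_scale diff_divide_distrib add_divide_distrib right_diff_distrib mult.assoc)
  have "(a * c - b * (a + c - rconst (sK - 1))) * (Y F - X F) = 0" using abc by simp
  then have e: "- b * (rconst (sK - 1) * X F) + b * c * X F + a * c * Y F + a * b * X F
     = - b * (rconst (sK - 1) * Y F) + b * a * Y F + c * a * X F + c * b * Y F" by (simp add: algebra_simps)
  have num: "X (hecke N lam j (hecke N lam i F)) - c * X (hecke N lam j F) - b * X (hecke N lam i F)
        + b * c * X F - a * Y (hecke N lam i F) + a * c * Y F + a * b * X F - a * b * c * F T
     = Y (hecke N lam i (hecke N lam j F)) - a * Y (hecke N lam i F) - b * Y (hecke N lam j F)
        + b * a * Y F - c * X (hecke N lam j F) + c * a * X F + c * b * Y F - c * b * a * F T"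
    unfolding braid quad using e by (simp add: algebra_simps)
  have den: "(rconst sK - c) * (rconst sK - b) * (rconst sK - a) = (rconst sK - a) * (rconst sK - b) * (rconst sK - c)" by simp
  show "rmat N lam i a (rmat N lam (i + 1) b (rmat N lam i c F)) T
       = rmat N lam (i + 1) c (rmat N lam i b (rmat N lam (i + 1) a F)) T"
    unfolding j_def[symmetric] expand unfolding den using num by (simp only: X_def Y_def)
qed

section \<open>Conjugation by the word T_1 T_2 ... T_(N-1)\<close>

lemma hecke_word_hecke_far: "k + 1 < j \<Longrightarrow> j < N \<Longrightarrow> hecke_word N lam k (hecke N lam j F) = hecke N lam j (hecke_word N lam k F)"
proof (induction k)
  case (Suc k)
  have "hecke N lam (Suc k) (hecke N lam j G) = hecke N lam j (hecke N lam (Suc k) G)" for G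
    by (rule ext, rule hecke_commute[OF part]) (use Suc in auto)
  then show ?case using Suc by simp
qed simp

text \<open>A single braid relation, when the word reaches \<open>T_(i+1)\<close>, changes the
  index; all other letters commute past.\<close>

lemma hecke_word_hecke: 
  assumes i: "1 \<le> i"
  shows "i + 1 \<le> k \<Longrightarrow> k < N \<Longrightarrow> hecke_word N lam k (hecke N lam (i + 1) F) = hecke N lam i (hecke_word N lam k F)"
proof (induction k rule: nat_induct_at_least)
  case base
  obtain l where l: "i = Suc l" using i by (cases i) auto
  have "hecke_word N lam (i + 1) (hecke N lam (i + 1) F) = hecke N lam (i + 1) (hecke N lam i (hecke N lam (i + 1) (hecke_word N lam l F)))"
    using hecke_word_hecke_far[of l "i + 1" F] base l by simp
  also have "\<dots> = hecke N lam i (hecke N lam (i + 1) (hecke N lam i (hecke_word N lam l F)))"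
    using base by (intro ext hecke_braid[OF part i, symmetric]) simp
  finally show ?case using l by simp
next
  case (Suc k)
  have "hecke N lam (Suc k) (hecke N lam i G) = hecke N lam i (hecke N lam (Suc k) G)" for G
    by (rule ext, rule hecke_commute[OF part, symmetric]) (use Suc i in auto)
  then show ?case using Suc by simp
qed

fun hecke_tail :: "nat \<Rightarrow> (tab \<Rightarrow> lrat) \<Rightarrow> (tab \<Rightarrow> lrat)" where
  "hecke_tail 0 F = F"
| "hecke_tail (Suc k) F = hecke N lam (Suc (Suc k)) (hecke_tail k F)"

lemma hecke_tail_hecke: "hecke_tail k (hecke N lam 1 F) = hecke_word N lam (Suc k) F"
  by (induction k) simp_all

lemma hecke_word_hecke_word: "k + 2 \<le> N \<Longrightarrow> hecke_word N lam k (hecke_word N lam (N - 1) F) = hecke_word N lam (N - 1) (hecke_tail k F)"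
proof (induction k)
  case (Suc k)
  then show ?case using hecke_word_hecke[of "Suc k" "N - 1" "hecke_tail k F"] by simp
qed simp

text \<open>Peel the last letter off the outer word and push the remaining
  \<open>T_1 ... T_(N-2)\<close> through the inner word. They come out as
  \<open>T_2 ... T_(N-1)\<close>, which the extra \<open>T_1\<close> completes to a full
  word.\<close>

lemma hecke_word_wrap: "hecke_word N lam (N - 1) (hecke_word N lam (N - 1) (hecke N lam 1 F)) = hecke N lam (N - 1) (hecke_word N lam (N - 1) (hecke_word N lam (N - 1) F))"
proof -
  obtain n where "N = 2 + n" using N2 le_Suc_ex by blast
  then have n: "N = Suc (Suc n)" by simp
  have s: "hecke_word N lam (N - 1) G = hecke N lam (N - 1) (hecke_word N lam n G)" for G using n by simp
  have "hecke_word N lam (N - 1) (hecke_word N lam (N - 1) (hecke N lam 1 F)) = hecke N lam (N - 1) (hecke_word N lam n (hecke_word N lam (N - 1) (hecke N lam 1 F)))"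
    by (rule s)
  also have "\<dots> = hecke N lam (N - 1) (hecke_word N lam (N - 1) (hecke_tail n (hecke N lam 1 F)))" using hecke_word_hecke_word[of n] n by simp
  also have "\<dots> = hecke N lam (N - 1) (hecke_word N lam (N - 1) (hecke_word N lam (N - 1) F))" unfolding hecke_tail_hecke using n by simp
  finally show ?thesis .
qed

lemma hecke_word_rmat: "1 \<le> i \<Longrightarrow> i + 1 < N \<Longrightarrow> hecke_word N lam (N - 1) (rmat N lam (i + 1) a F) = rmat N lam i a (hecke_word N lam (N - 1) F)"
  unfolding rmat_def using hecke_word_hecke[of i "N - 1" F] by (simp add: hecke_word_lin)

lemma hecke_word_rmat_wrap: "hecke_word N lam (N - 1) (hecke_word N lam (N - 1) (rmat N lam 1 a F))
    = rmat N lam (N - 1) a (hecke_word N lam (N - 1) (hecke_word N lam (N - 1) F))"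
  unfolding rmat_def using hecke_word_wrap[of F] by (simp only: hecke_word_lin)

section \<open>Coxeter relations of the normalised intertwiners\<close>

lemma swap_op_hom: "field_hom h \<Longrightarrow> (\<lambda>T. h (swap_op N lam i F T)) = rmat N lam i (h (xcoef N (int i) (int i + 1))) (\<lambda>T. h (swap_aut i (F T)))"
  unfolding swap_op_def by (rule rmat_hom)

lemma affine_swap_int:
  assumes "1 \<le> i" "i < N" "1 \<le> k" "k \<le> N" shows "affine_swap (int N) (int i) (int k) = int (swp i k)"
proof -
  have "pvar N (affine_swap (int N) (int i) (int k)) = swap_aut i (pvar N (int k))"
    using swap_aut_acts[OF assms(1,2)] by (simp add: acts_by_def)
  also have "\<dots> = pvar N (int (swp i k))"
    using assms pvar_nat[of k N] pvar_nat[of "swp i k" N] by (auto simp: swap_aut_rvar swp_def)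
  finally show ?thesis by (rule pvar_inj[rotated]) (use N2 in simp)
qed

lemma swap_op_invol: assumes i: "1 \<le> i" "i < N" shows "swap_op N lam i \<circ> swap_op N lam i = id"
proof
  fix F
  have sw: "affine_swap (int N) (int i) (int i) = int i + 1" "affine_swap (int N) (int i) (int i + 1) = int i"
    using N2 by simp_all
  have "affine_swap (int N) (int i) \<circ> affine_swap (int N) (int i) = id"
    using N2 by (simp add: fun_eq_iff affine_swap_invol)
  then have "swap_aut i \<circ> swap_aut i = id"
    using acts_by_unique[OF acts_by_comp[OF swap_aut_acts[OF i] swap_aut_acts[OF i]], of id] acts_by_id by simp
  then have ss: "swap_aut i (swap_aut i z) = z" for z by (simp add: fun_eq_iff)
  have a': "swap_aut i (xcoef N (int i) (int i + 1)) = xcoef N (int i + 1) (int i)" using xcoef_acts[OF swap_aut_acts[OF i]] sw by simp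
  have e: "swap_aut i (rconst sK - xcoef N (int i) (int i + 1)) = rconst sK - xcoef N (int i + 1) (int i)"
    unfolding field_homD(7)[OF swap_aut_hom] field_homD(3)[OF swap_aut_hom] a' ..
  have ne: "rconst sK - xcoef N (int i + 1) (int i) \<noteq> 0"
    unfolding e[symmetric] using xcoef_neq[OF i] field_homD(10)[OF swap_aut_hom] by blast
  have "swap_op N lam i (swap_op N lam i F) = rmat N lam i (xcoef N (int i) (int i + 1)) (rmat N lam i (xcoef N (int i + 1) (int i)) F)"
    unfolding swap_op_def[of N lam i "swap_op N lam i F"] swap_op_hom[OF swap_aut_hom] a' ss ..
  also have "\<dots> = F" using N2 by (intro rmat_invol i xcoef_flip xcoef_neq ne) simp_all
  finally show "(swap_op N lam i \<circ> swap_op N lam i) F = id F" by simp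
qed

lemma swap_op_commute:
  assumes i: "1 \<le> i" "i + 1 < j" "j < N" shows "swap_op N lam i \<circ> swap_op N lam j = swap_op N lam j \<circ> swap_op N lam i"
proof
  fix F
  have i': "1 \<le> i" "i < N" and j': "1 \<le> j" "j < N" using i by auto
  have xcoef: "swap_aut i (xcoef N (int j) (int j + 1)) = xcoef N (int j) (int j + 1)" "swap_aut j (xcoef N (int i) (int i + 1)) = xcoef N (int i) (int i + 1)"
    using xcoef_acts[OF swap_aut_acts[OF i'], of "int j" "int j + 1"] xcoef_acts[OF swap_aut_acts[OF j'], of "int i" "int i + 1"]
      affine_swap_int[OF i', of j] affine_swap_int[OF i', of "j + 1"] affine_swap_int[OF j', of i] affine_swap_int[OF j', of "i + 1"] i
    by (simp_all add: swp_def add.commute)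
  have ss: "swap_aut i (swap_aut j z) = swap_aut j (swap_aut i z)" for z
  proof -
    have nd: "\<not> int N dvd m" if "1 \<le> \<bar>m\<bar>" "\<bar>m\<bar> < int N" for m
    proof
      assume "int N dvd m"
      then have "int N dvd \<bar>m\<bar>" by simp
      from zdvd_imp_le[OF this] that show False by linarith
    qed
    have "affine_swap (int N) (int i) \<circ> affine_swap (int N) (int j) = affine_swap (int N) (int j) \<circ> affine_swap (int N) (int i)"
      using i by (intro affine_swap_commute nd) auto
    then have "swap_aut i \<circ> swap_aut j = swap_aut j \<circ> swap_aut i"
      using acts_by_unique acts_by_comp[OF swap_aut_acts[OF i'] swap_aut_acts[OF j']] acts_by_comp[OF swap_aut_acts[OF j'] swap_aut_acts[OF i']] by metis
    then show ?thesis by (metis comp_apply)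
  qed
  show "(swap_op N lam i \<circ> swap_op N lam j) F = (swap_op N lam j \<circ> swap_op N lam i) F"
    unfolding o_apply swap_op_def[of N lam i "swap_op N lam j F"] swap_op_def[of N lam j "swap_op N lam i F"] swap_op_hom[OF swap_aut_hom] xcoef
    unfolding ss by (rule rmat_commute[OF i])
qed

text \<open>Collecting the automorphisms on the inside turns the parameters into those of the pairs
  \<open>(i, i+1)\<close>, \<open>(i, i+2)\<close>, \<open>(i+1, i+2)\<close>, in opposite orders on
  the two sides. This is the shape of the Yang-Baxter equation.\<close>

lemma swap_op_braid:
  assumes i: "1 \<le> i" "i + 1 < N"
  shows "swap_op N lam i \<circ> swap_op N lam (i + 1) \<circ> swap_op N lam i = swap_op N lam (i + 1) \<circ> swap_op N lam i \<circ> swap_op N lam (i + 1)"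
proof
  fix F
  define j where "j = i + 1"
  have i': "1 \<le> i" "i < N" and j': "1 \<le> j" "j < N" using i by (auto simp: j_def)
  let ?i = "int i"
  have jj: "int j = ?i + 1" "?i + 1 + 1 = ?i + 2" by (simp_all add: j_def)
  have sw: "affine_swap (int N) ?i ?i = ?i + 1" "affine_swap (int N) ?i (?i + 1) = ?i" "affine_swap (int N) ?i (?i + 2) = ?i + 2"
    "affine_swap (int N) (?i + 1) ?i = ?i" "affine_swap (int N) (?i + 1) (?i + 1) = ?i + 2" "affine_swap (int N) (?i + 1) (?i + 2) = ?i + 1"
    using affine_swap_int[OF i', of i] affine_swap_int[OF i', of "i + 1"] affine_swap_int[OF i', of "i + 2"]
      affine_swap_int[OF j', of i] affine_swap_int[OF j', of "i + 1"] affine_swap_int[OF j', of "i + 2"] i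
    by (simp_all add: swp_def j_def add.commute)
  note axi = xcoef_acts[OF swap_aut_acts[OF i']] and axj = xcoef_acts[OF swap_aut_acts[OF j']]
  have sss: "swap_aut i (swap_aut j (swap_aut i z)) = swap_aut j (swap_aut i (swap_aut j z))" for z
  proof -
    have "affine_swap (int N) ?i \<circ> affine_swap (int N) (int j) \<circ> affine_swap (int N) ?i
        = affine_swap (int N) (int j) \<circ> affine_swap (int N) ?i \<circ> affine_swap (int N) (int j)"
      unfolding jj using i by (intro affine_swap_braid) simp
    then have "swap_aut i \<circ> swap_aut j \<circ> swap_aut i = swap_aut j \<circ> swap_aut i \<circ> swap_aut j"
      using acts_by_unique acts_by_comp[OF acts_by_comp[OF swap_aut_acts[OF i'] swap_aut_acts[OF j']] swap_aut_acts[OF i']]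
        acts_by_comp[OF acts_by_comp[OF swap_aut_acts[OF j'] swap_aut_acts[OF i']] swap_aut_acts[OF j']] by metis
    then show ?thesis by (metis comp_apply)
  qed
  have L: "swap_op N lam i (swap_op N lam j (swap_op N lam i F)) = rmat N lam i (xcoef N ?i (?i + 1)) (rmat N lam j (xcoef N ?i (?i + 2))
      (rmat N lam i (xcoef N (?i + 1) (?i + 2)) (\<lambda>T. swap_aut i (swap_aut j (swap_aut i (F T))))))"
    unfolding swap_op_def rmat_hom[OF swap_aut_hom] axi axj jj sw ..
  have R: "swap_op N lam j (swap_op N lam i (swap_op N lam j F)) = rmat N lam j (xcoef N (?i + 1) (?i + 2)) (rmat N lam i (xcoef N ?i (?i + 2))
      (rmat N lam j (xcoef N ?i (?i + 1)) (\<lambda>T. swap_aut j (swap_aut i (swap_aut j (F T))))))"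
    unfolding swap_op_def rmat_hom[OF swap_aut_hom] axi axj jj sw ..
  have "swap_op N lam i (swap_op N lam j (swap_op N lam i F)) = swap_op N lam j (swap_op N lam i (swap_op N lam j F))"
    unfolding L R sss unfolding j_def using N2 by (intro rmat_yang_baxter i xcoef_identity) auto
  then show "(swap_op N lam i \<circ> swap_op N lam (i + 1) \<circ> swap_op N lam i) F = (swap_op N lam (i + 1) \<circ> swap_op N lam i \<circ> swap_op N lam (i + 1)) F"
    by (simp add: j_def)
qed

end

text \<open>Functions are defined on the whole type of fillings. The last clause ensures that those
  supported on \<open>Tab\<close> stay so, as required by \<open>VP\<close>.\<close>

definition semilinear_op :: "nat \<Rightarrow> nat list \<Rightarrow> (lrat \<Rightarrow> lrat) \<Rightarrow> ((tab \<Rightarrow> lrat) \<Rightarrow> (tab \<Rightarrow> lrat)) \<Rightarrow> bool" where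
  "semilinear_op N lam h A \<longleftrightarrow> bij A \<and> (\<forall>c F. A (\<lambda>T. c * F T) = (\<lambda>T. h c * A F T))
     \<and> (\<forall>F G. A (\<lambda>T. F T + G T) = (\<lambda>T. A F T + A G T))
     \<and> (\<forall>F T. T \<notin> Tab N lam \<longrightarrow> A F T = 0 \<longleftrightarrow> F T = 0)"

lemma semilinear_op_comp:
  assumes "semilinear_op N lam g A" "semilinear_op N lam h B" shows "semilinear_op N lam (g \<circ> h) (A \<circ> B)"
  using assms unfolding semilinear_op_def by (auto intro: bij_comp)

lemma semilinear_op_inv:
  assumes A: "semilinear_op N lam h A" and h: "\<And>c. h (h' c) = c"
  shows "semilinear_op N lam h' (inv A)"
proof -
  have b: "bij A" and sc: "\<And>c F. A (\<lambda>T. c * F T) = (\<lambda>T. h c * A F T)"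
    and ad: "\<And>F G. A (\<lambda>T. F T + G T) = (\<lambda>T. A F T + A G T)"
    and off: "\<And>F T. T \<notin> Tab N lam \<Longrightarrow> A F T = 0 \<longleftrightarrow> F T = 0"
    using A unfolding semilinear_op_def by blast+
  have AI: "A (inv A F) = F" for F using b by (simp add: bij_is_surj surj_f_inv_f)
  have inj: "inv A F = G" if "A G = F" for F G using b that by (metis bij_inv_eq_iff)
  show ?thesis unfolding semilinear_op_def
  proof (intro conjI allI impI)
    show "bij (inv A)" using b by (rule bij_imp_bij_inv)
    show "inv A (\<lambda>T. c * F T) = (\<lambda>T. h' c * inv A F T)" for c F
      by (rule inj) (simp add: sc AI h)
    show "inv A (\<lambda>T. F T + G T) = (\<lambda>T. inv A F T + inv A G T)" for F G
      by (rule inj) (simp add: ad AI)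
    show "inv A F T = 0 \<longleftrightarrow> F T = 0" if "T \<notin> Tab N lam" for F T
      using off[OF that, of "inv A F"] by (simp add: AI)
  qed
qed

lemma semilinear_op_zero: "semilinear_op N lam h A \<Longrightarrow> A (\<lambda>_. 0) = (\<lambda>_. 0)"
proof -
  assume "semilinear_op N lam h A"
  then have "\<And>F G. A (\<lambda>T. F T + G T) = (\<lambda>T. A F T + A G T)"
    unfolding semilinear_op_def by blast
  from fun_cong[OF this[of "\<lambda>_. 0" "\<lambda>_. 0"]] show ?thesis
    by (intro ext) (simp only: add_0 add_cancel_right_right)
qed

text \<open>The quadratic relation solved for the inverse. Only constants occur as coefficients, so
  Laurent polynomials are preserved.\<close>

definition hecke_inv :: "nat \<Rightarrow> nat list \<Rightarrow> nat \<Rightarrow> (tab \<Rightarrow> lrat) \<Rightarrow> (tab \<Rightarrow> lrat)" where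
  "hecke_inv N lam i F = (\<lambda>T. (hecke N lam i F T - rconst (sK - 1) * F T) / rconst sK)"

fun hecke_word_inv :: "nat \<Rightarrow> nat list \<Rightarrow> nat \<Rightarrow> (tab \<Rightarrow> lrat) \<Rightarrow> (tab \<Rightarrow> lrat)" where
  "hecke_word_inv N lam 0 F = F"
| "hecke_word_inv N lam (Suc k) F = hecke_word_inv N lam k (hecke_inv N lam (Suc k) F)"

definition rot_op_inv :: "nat \<Rightarrow> nat list \<Rightarrow> (tab \<Rightarrow> lrat) \<Rightarrow> (tab \<Rightarrow> lrat)" where
  "rot_op_inv N lam F = (\<lambda>T. rot_aut_inv N (hecke_word_inv N lam (N - 1) F T))"

context
  fixes N lam
  assumes part: "is_partition N lam" and N2: "N \<ge> 2"
begin

lemma hecke_hecke_inv: assumes i: "1 \<le> i" "i < N" shows "hecke N lam i (hecke_inv N lam i F) = F" "hecke_inv N lam i (hecke N lam i F) = F"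
  using sK_nonzero
  by (simp_all add: hecke_inv_def hecke_divide hecke_minus hecke_scale hecke_quadratic[OF part i] fun_eq_iff)

lemma hecke_word_hecke_word_inv: "k < N \<Longrightarrow> hecke_word N lam k (hecke_word_inv N lam k F) = F" "k < N \<Longrightarrow> hecke_word_inv N lam k (hecke_word N lam k F) = F"
proof (induction k arbitrary: F)
  case (Suc k)
  { case 1 then show ?case using Suc by (simp add: hecke_hecke_inv) }
  { case 2 then show ?case using Suc by (simp add: hecke_hecke_inv) }
qed simp_all

lemma rot_op_rot_op_inv: "rot_op N lam (rot_op_inv N lam F) = F" "rot_op_inv N lam (rot_op N lam F) = F"
  using N2 by (simp_all add: rot_op_def rot_op_inv_def rot_aut_rot_aut_inv hecke_word_hecke_word_inv)

lemma bij_rot_op: "bij (rot_op N lam)"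
  by (rule o_bij[of "rot_op_inv N lam"]) (simp_all add: fun_eq_iff rot_op_rot_op_inv)

lemma inv_rot_op: "inv (rot_op N lam) = rot_op_inv N lam"
  by (rule inv_equality) (simp_all add: rot_op_rot_op_inv)

lemma rot_aut_swap_aut:
  assumes i: "1 \<le> i" "i + 1 < N" shows "rot_aut N (swap_aut (i + 1) z) = swap_aut i (rot_aut N z)"
proof -
  have N0: "0 < N" and i': "1 \<le> i" "i < N" and j': "1 \<le> i + 1" "i + 1 < N" using i by auto
  have "(\<lambda>j. j + - 1) \<circ> affine_swap (int N) (int (i + 1)) = affine_swap (int N) (int i) \<circ> (\<lambda>j. j + - 1)"
    using affine_swap_shift[of "int N" "int i + 1" "- 1"] by (auto simp: fun_eq_iff add.commute)
  then have "rot_aut N \<circ> swap_aut (i + 1) = swap_aut i \<circ> rot_aut N"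
    using acts_by_unique acts_by_comp[OF rot_aut_acts[OF N0] swap_aut_acts[OF j']] acts_by_comp[OF swap_aut_acts[OF i'] rot_aut_acts[OF N0]] by metis
  then show ?thesis by (metis comp_apply)
qed

lemma rot_aut_rot_aut_swap_aut: "rot_aut N (rot_aut N (swap_aut 1 z)) = swap_aut (N - 1) (rot_aut N (rot_aut N z))"
proof -
  have N0: "0 < N" and i': "1 \<le> (1::nat)" "1 < N" and j': "1 \<le> N - 1" "N - 1 < N" using N2 by auto
  have sh: "affine_swap (int N) (k - 2) (j - 2) = affine_swap (int N) k j - 2" for k j
    using affine_swap_shift[of "int N" k "- 2" j] by simp
  \<comment> \<open>Shifting by -2 would send the index 1 to -1; replacing 1 by \<open>N + 1\<close>
    beforehand makes it land on \<open>N - 1\<close>.\<close>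
  have "affine_swap (int N) 1 = affine_swap (int N) (int (N - 1) + 2)"
    using N2 by (intro affine_swap_cong) (simp add: of_nat_diff)
  then have "((\<lambda>j. j + - 1) \<circ> (\<lambda>j. j + - 1)) \<circ> affine_swap (int N) (int 1)
      = affine_swap (int N) (int (N - 1)) \<circ> ((\<lambda>j. j + - 1) \<circ> (\<lambda>j. j + - 1))"
    using sh[of "int (N - 1) + 2"] by (auto simp: fun_eq_iff)
  then have "(rot_aut N \<circ> rot_aut N) \<circ> swap_aut 1 = swap_aut (N - 1) \<circ> (rot_aut N \<circ> rot_aut N)"
    using acts_by_unique acts_by_comp[OF acts_by_comp[OF rot_aut_acts[OF N0] rot_aut_acts[OF N0]] swap_aut_acts[OF i']]
      acts_by_comp[OF swap_aut_acts[OF j'] acts_by_comp[OF rot_aut_acts[OF N0] rot_aut_acts[OF N0]]] by metis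
  then show ?thesis by (metis comp_apply)
qed

lemma rot_op_swap_op:
  assumes i: "1 \<le> i" "i + 1 < N" shows "rot_op N lam \<circ> swap_op N lam (i + 1) = swap_op N lam i \<circ> rot_op N lam"
proof
  fix F
  have N0: "0 < N" using N2 by simp
  have a: "rot_aut N (xcoef N (int (i + 1)) (int (i + 1) + 1)) = xcoef N (int i) (int i + 1)"
    using xcoef_acts[OF rot_aut_acts[OF N0]] by (simp add: add.commute)
  have "rot_op N lam (swap_op N lam (i + 1) F) = hecke_word N lam (N - 1) (rmat N lam (i + 1) (xcoef N (int i) (int i + 1)) (\<lambda>T. swap_aut i (rot_aut N (F T))))"
    unfolding rot_op_def swap_op_def rmat_hom[OF rot_aut_hom[OF N0]] a rot_aut_swap_aut[OF i] ..
  also have "\<dots> = swap_op N lam i (rot_op N lam F)"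
    unfolding hecke_word_rmat[OF part N2 i] swap_op_def rot_op_def hecke_word_hom[OF swap_aut_hom] ..
  finally show "(rot_op N lam \<circ> swap_op N lam (i + 1)) F = (swap_op N lam i \<circ> rot_op N lam) F" by simp
qed

lemma rot_op_swap_op_wrap: "rot_op N lam \<circ> rot_op N lam \<circ> swap_op N lam 1 = swap_op N lam (N - 1) \<circ> rot_op N lam \<circ> rot_op N lam"
proof
  fix F
  have N0: "0 < N" using N2 by simp
  note oh = rot_aut_hom[OF N0]
  have a: "rot_aut N (rot_aut N (xcoef N (int 1) (int 1 + 1))) = xcoef N (int (N - 1)) (int (N - 1) + 1)"
  proof -
    have "rot_aut N (rot_aut N (xcoef N (int 1) (int 1 + 1))) = xcoef N (- 1) 0"
      using xcoef_acts[OF rot_aut_acts[OF N0]] by simp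
    \<comment> \<open>\<open>xcoef\<close> is homogeneous of degree 0, so the factor
      \<open>q\<close> acquired by both variables when their indices are lowered by \<open>N\<close>
      cancels.\<close>
    also have "\<dots> = xcoef N (int N - 1) (int N)"
    proof -
      have "pvar N (int N - 1 + int N * (- 1)) = rconst qK * pvar N (int N - 1)" "pvar N (int N + int N * (- 1)) = rconst qK * pvar N (int N)"
        by (simp_all only: pvar_add_mult[OF N0]) simp_all
      then have "pvar N (- 1) = rconst qK * pvar N (int N - 1)" "pvar N 0 = rconst qK * pvar N (int N)" by simp_all
      then have "xcoef N (- 1) 0 = (rconst qK * (rconst (sK - 1) * pvar N (int N))) / (rconst qK * (pvar N (int N) - pvar N (int N - 1)))"
        by (simp add: xcoef_def algebra_simps)
      also have "\<dots> = rconst (sK - 1) * pvar N (int N) / (pvar N (int N) - pvar N (int N - 1))"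
        by (rule mult_divide_mult_cancel_left) (simp add: qK_nonzero)
      finally show ?thesis by (simp add: xcoef_def)
    qed
    finally show ?thesis using N2 by (simp add: of_nat_diff)
  qed
  have "rot_op N lam (rot_op N lam (swap_op N lam 1 F)) = hecke_word N lam (N - 1) (hecke_word N lam (N - 1)
      (rmat N lam 1 (xcoef N (int (N - 1)) (int (N - 1) + 1)) (\<lambda>T. swap_aut (N - 1) (rot_aut N (rot_aut N (F T))))))"
    unfolding rot_op_def swap_op_def hecke_word_hom[OF oh, symmetric] rmat_hom[OF oh] a rot_aut_rot_aut_swap_aut ..
  also have "\<dots> = swap_op N lam (N - 1) (rot_op N lam (rot_op N lam F))"
    unfolding hecke_word_rmat_wrap[OF part N2] swap_op_def rot_op_def hecke_word_hom[OF swap_aut_hom, symmetric] hecke_word_hom[OF oh, symmetric] ..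
  finally show "(rot_op N lam \<circ> rot_op N lam \<circ> swap_op N lam 1) F = (swap_op N lam (N - 1) \<circ> rot_op N lam \<circ> rot_op N lam) F" by simp
qed

lemma semilinear_rot_op: "semilinear_op N lam (rot_aut N) (rot_op N lam)"
proof -
  have N0: "0 < N" using N2 by simp
  note oh = field_homD[OF rot_aut_hom[OF N0]]
  have lin: "hecke_word N lam k (\<lambda>T. c * F T) = (\<lambda>T. c * hecke_word N lam k F T)"
    "hecke_word N lam k (\<lambda>T. F T + G T) = (\<lambda>T. hecke_word N lam k F T + hecke_word N lam k G T)" for k c F G
    by (induction k) (simp_all add: hecke_scale hecke_add)
  have off: "hecke_word N lam k F T = 0 \<longleftrightarrow> F T = 0" if "T \<notin> Tab N lam" for k F T
    using that sK_nonzero by (induction k) (simp_all add: hecke_off)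
  show ?thesis unfolding semilinear_op_def
    using bij_rot_op off by (auto simp: rot_op_def oh lin)
qed

lemma semilinear_swap_op: assumes i: "1 \<le> i" "i < N" shows "semilinear_op N lam (swap_aut i) (swap_op N lam i)"
proof -
  note sh = field_homD[OF swap_aut_hom]
  have "bij (swap_op N lam i)" using swap_op_invol[OF part N2 i] by (metis o_bij)
  moreover have "swap_op N lam i F T = 0 \<longleftrightarrow> F T = 0" if "T \<notin> Tab N lam" for F T
  proof -
    have "swap_op N lam i F T = ((rconst sK - xcoef N (int i) (int i + 1)) * swap_aut i (F T)) / (rconst sK - xcoef N (int i) (int i + 1))"
      using that by (simp add: swap_op_def rmat_def hecke_off left_diff_distrib)
    then show ?thesis using xcoef_neq[OF i] by (simp add: sh)
  qed
  moreover have "swap_op N lam i (\<lambda>T. c * F T) = (\<lambda>T. swap_aut i c * swap_op N lam i F T)" for c F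
    by (simp add: swap_op_def rmat_def sh hecke_scale right_diff_distrib mult.left_commute)
  moreover have "swap_op N lam i (\<lambda>T. F T + G T) = (\<lambda>T. swap_op N lam i F T + swap_op N lam i G T)" for F G
    by (simp add: swap_op_def rmat_def sh hecke_add distrib_left add_diff_add add_divide_distrib)
  ultimately show ?thesis unfolding semilinear_op_def by blast
qed

end

section \<open>Laurent polynomials and divided differences\<close>

lemma LP_add: "p \<in> LP N \<Longrightarrow> q \<in> LP N \<Longrightarrow> p + q \<in> LP N"
  unfolding LP_def using Poly_Mapping.keys_add[of p q] by blast

lemma LP_zero: "0 \<in> LP N" and LP_one: "1 \<in> LP N"
  by (simp_all add: LP_def)

lemma LP_sum: "(\<And>x. x \<in> A \<Longrightarrow> f x \<in> LP N) \<Longrightarrow> sum f A \<in> LP N"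
  by (induction A rule: infinite_finite_induct) (auto intro: LP_add LP_zero)

lemma LP_mult: assumes "p \<in> LP N" "q \<in> LP N" shows "p * q \<in> LP N"
  unfolding LP_def
proof (intro CollectI ballI)
  fix m assume "m \<in> Poly_Mapping.keys (p * q)"
  then obtain a b where "m = a + b" "a \<in> Poly_Mapping.keys p" "b \<in> Poly_Mapping.keys q" 
    using Poly_Mapping.keys_mult[of p q] by blast
  then show "Poly_Mapping.keys m \<subseteq> {1..N}" using assms Poly_Mapping.keys_add[of a b] unfolding LP_def by blast
qed

lemma LP_lconst: "lconst c \<in> LP N"
  by (simp add: LP_def lconst_def)

lemma LP_uminus: "p \<in> LP N \<Longrightarrow> - p \<in> LP N"
  by (simp add: LP_def)

lemma LP_diff: "p \<in> LP N \<Longrightarrow> q \<in> LP N \<Longrightarrow> p - q \<in> LP N"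
  using LP_add[of p N "- q"] LP_uminus[of q N] by simp

lemma LP_Xv: "1 \<le> i \<Longrightarrow> i \<le> N \<Longrightarrow> Xv i \<in> LP N" and LP_Xinv: "1 \<le> i \<Longrightarrow> i \<le> N \<Longrightarrow> Xinv i \<in> LP N"
  by (simp_all add: LP_def Xv_def Xinv_def)

lemma LP_lp_map:
  assumes "p \<in> LP N" "\<And>m. Poly_Mapping.keys m \<subseteq> {1..N} \<Longrightarrow> Poly_Mapping.keys (\<tau> m) \<subseteq> {1..N}"
  shows "lp_map c \<tau> p \<in> LP N"
  unfolding lp_map_def using assms by (intro LP_sum) (auto simp: LP_def split: if_splits)

lemma keys_mono_perm:
  assumes "bij \<sigma>" "\<And>k. k \<notin> {1..N} \<Longrightarrow> \<sigma> k \<notin> {1..N}" "Poly_Mapping.keys m \<subseteq> {1..N}"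
  shows "Poly_Mapping.keys (mono_perm \<sigma> m) \<subseteq> {1..N}"
proof
  fix k assume "k \<in> Poly_Mapping.keys (mono_perm \<sigma> m)"
  then have "\<sigma> k \<in> Poly_Mapping.keys m" by (simp add: in_keys_iff lookup_mono_perm[OF assms(1)])
  then show "k \<in> {1..N}" using assms by blast
qed

lemma LP_lp_swap: "p \<in> LP N \<Longrightarrow> 1 \<le> i \<Longrightarrow> i < N \<Longrightarrow> lp_swap i p \<in> LP N"
  unfolding lp_swap_def by (intro LP_lp_map keys_mono_perm bij_swp) (auto simp: swp_def split: if_splits)

lemma LP_lp_w: "p \<in> LP N \<Longrightarrow> 0 < N \<Longrightarrow> lp_w N p \<in> LP N"
  unfolding lp_w_def by (intro LP_lp_map keys_mono_perm bij_cyc) (auto simp: cyc_def split: if_splits)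

lemma LP_lp_w_inv: "p \<in> LP N \<Longrightarrow> 0 < N \<Longrightarrow> lp_w_inv N p \<in> LP N"
  unfolding lp_w_inv_def by (intro LP_lp_map keys_mono_perm bij_uncyc) (auto simp: uncyc_def split: if_splits)

lemma Xv_Xinv: "Xv k * Xinv k = 1"
  by (simp add: Xv_def Xinv_def mult_single single_add[symmetric])

lemma lp_swap_Xv: "lp_swap i (Xv k) = Xv (swp i k)"
  using swap_aut_rvar[of i k] by (simp add: rvar_def swap_aut_to_fract)

lemma lp_swap_one: "lp_swap i 1 = 1"
  using lp_swap_hom(3)[of i 1] by simp

lemma LP_induct [consumes 1, case_names const Xv Xinv add mult]:
  assumes "p \<in> LP N" "\<And>c. P (lconst c)" "\<And>k. 1 \<le> k \<Longrightarrow> k \<le> N \<Longrightarrow> P (Xv k)" "\<And>k. 1 \<le> k \<Longrightarrow> k \<le> N \<Longrightarrow> P (Xinv k)"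
    "\<And>p q. P p \<Longrightarrow> P q \<Longrightarrow> P (p + q)" "\<And>p q. P p \<Longrightarrow> P q \<Longrightarrow> P (p * q)"
  shows "P p"
proof -
  have P1: "P 1" using assms(2)[of 1] by simp
  have xk: "P (Poly_Mapping.single (Poly_Mapping.single k n) 1)" if "1 \<le> k" "k \<le> N" for k n
  proof (induction n rule: int_induct[where k = 0])
    case base then show ?case using P1 by simp
  next
    case (step1 n)
    have "Poly_Mapping.single (Poly_Mapping.single k (n + 1)) 1 = Poly_Mapping.single (Poly_Mapping.single k n) (1::K) * Xv k"
      by (simp add: Xv_def mult_single single_add)
    then show ?case using step1 assms(3,6) that by simp
  next
    case (step2 n)
    have "Poly_Mapping.single (Poly_Mapping.single k (n - 1)) 1 = Poly_Mapping.single (Poly_Mapping.single k n) (1::K) * Xinv k"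
      by (simp add: Xinv_def mult_single single_add[symmetric])
    then show ?case using step2 assms(4,6) that by simp
  qed
  have xm: "P (Poly_Mapping.single m 1)" if m: "Poly_Mapping.keys m \<subseteq> {1..N}" for m
  proof (induction m rule: poly_mapping_single_induct)
    case zero then show ?case using P1 by simp
  next
    case (single k n) then show ?case using xk m by auto
  next
    case (add m n)
    have "Poly_Mapping.single (m + n) (1::K) = Poly_Mapping.single m 1 * Poly_Mapping.single n 1" by (simp add: mult_single)
    then show ?case using add assms(6) by simp
  qed
  show ?thesis
  proof (induction p rule: poly_mapping_single_induct)
    case zero then show ?case using assms(2)[of 0] by simp
  next
    case (single m c)
    have "Poly_Mapping.single m c = lconst c * Poly_Mapping.single m 1" by (simp add: lconst_def mult_single)
    then show ?case using assms(1,2,6) xm[of m] single by (simp add: LP_def)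
  qed (rule assms(5))
qed

lemma divided_difference_exists:
  assumes i: "1 \<le> i" "i < N" and p: "p \<in> LP N"
  shows "\<exists>r\<in>LP N. (Xv i - Xv (i + 1)) * r = p - lp_swap i p"
proof -
  have "p \<in> LP N \<and> (\<exists>r\<in>LP N. (Xv i - Xv (i + 1)) * r = p - lp_swap i p)" using p
  proof (induction p rule: LP_induct)
    case (const c)
    then show ?case by (auto intro!: LP_lconst bexI[of _ 0] LP_zero simp: lp_swap_hom)
  next
    case (Xv k)
    have "(Xv i - Xv (i + 1)) * (if k = i then 1 else if k = i + 1 then - 1 else 0) = Xv k - lp_swap i (Xv k)"
      by (auto simp: lp_swap_Xv swp_def)
    moreover have "(if k = i then 1 else if k = i + 1 then - 1 else 0) \<in> LP N" by (auto intro: LP_zero LP_one LP_uminus)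
    ultimately show ?case using LP_Xv[OF Xv] by blast
  next
    case (Xinv k)
    have inv: "lp_swap i (Xinv k) = Xinv (swp i k)"
    proof -
      have "Xv (swp i k) * lp_swap i (Xinv k) = 1"
        using arg_cong[OF Xv_Xinv[of k], of "lp_swap i"] by (simp add: lp_swap_hom lp_swap_Xv lp_swap_one)
      then have "Xinv (swp i k) * (Xv (swp i k) * lp_swap i (Xinv k)) = Xinv (swp i k)" by simp
      moreover have "Xinv (swp i k) * Xv (swp i k) = 1" using Xv_Xinv[of "swp i k"] by (simp add: mult.commute)
      ultimately show ?thesis by (simp add: mult.assoc[symmetric])
    qed
    have "(Xv i - Xv (i + 1)) * (Xinv i * Xinv (i + 1)) = (Xv i * Xinv i) * Xinv (i + 1) - (Xv (i + 1) * Xinv (i + 1)) * Xinv i"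
      by (simp add: algebra_simps)
    then have d: "(Xv i - Xv (i + 1)) * (Xinv i * Xinv (i + 1)) = Xinv (i + 1) - Xinv i" by (simp only: Xv_Xinv mult_1)
    have "(Xv i - Xv (i + 1)) * (if k = i then - (Xinv i * Xinv (i + 1)) else if k = i + 1 then Xinv i * Xinv (i + 1) else 0)
        = Xinv k - lp_swap i (Xinv k)"
      using d by (auto simp: inv swp_def)
    moreover have "(if k = i then - (Xinv i * Xinv (i + 1)) else if k = i + 1 then Xinv i * Xinv (i + 1) else 0) \<in> LP N"
      using i by (auto intro!: LP_zero LP_uminus LP_mult LP_Xinv)
    ultimately show ?case using LP_Xinv[OF Xinv] by blast
  next
    case (add p q)
    then obtain r s where rs: "r \<in> LP N" "(Xv i - Xv (i + 1)) * r = p - lp_swap i p" "s \<in> LP N" "(Xv i - Xv (i + 1)) * s = q - lp_swap i q" by blast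
    then have "(Xv i - Xv (i + 1)) * (r + s) = p + q - lp_swap i (p + q)" by (simp add: distrib_left lp_swap_hom)
    then show ?case using rs add by (blast intro: LP_add)
  next
    case (mult p q)
    then obtain r s where rs: "r \<in> LP N" "(Xv i - Xv (i + 1)) * r = p - lp_swap i p" "s \<in> LP N" "(Xv i - Xv (i + 1)) * s = q - lp_swap i q" by blast
    \<comment> \<open>The twisted Leibniz rule for divided differences, which explains the quotient
      chosen for a product.\<close>
    have "(Xv i - Xv (i + 1)) * (r * lp_swap i q + p * s) = ((Xv i - Xv (i + 1)) * r) * lp_swap i q + p * ((Xv i - Xv (i + 1)) * s)"
      by (simp add: algebra_simps)
    also have "\<dots> = p * q - lp_swap i (p * q)" unfolding rs by (simp add: algebra_simps lp_swap_hom)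
    finally show ?case using rs mult i by (blast intro: LP_add LP_mult LP_lp_swap)
  qed
  then show ?thesis by blast
qed

lemma ddiff_LP:
  assumes i: "1 \<le> i" "i < N" and p: "p \<in> LP N"
  shows "ddiff i p \<in> LP N" "(Xv i - Xv (i + 1)) * ddiff i p = p - lp_swap i p"
proof -
  obtain r where r: "r \<in> LP N" "(Xv i - Xv (i + 1)) * r = p - lp_swap i p" using divided_difference_exists[OF assms] by blast
  have ne: "Xv i - Xv (i + 1) \<noteq> 0" using rvar_inj[of i "i + 1"] by (auto simp: rvar_def)
  have "ddiff i p = r" unfolding ddiff_def
    by (rule the_equality) (use r ne in \<open>auto simp: mult_left_cancel simp flip: r(2)\<close>)
  then show "ddiff i p \<in> LP N" "(Xv i - Xv (i + 1)) * ddiff i p = p - lp_swap i p" using r by simp_all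
qed

lemma to_fract_ddiff:
  assumes i: "1 \<le> i" "i < N" and p: "p \<in> LP N"
  shows "to_fract (lconst (1 - sK) * Xv (i + 1) * ddiff i p)
    = xcoef N (int i) (int i + 1) * (to_fract p - swap_aut i (to_fract p))"
proof -
  have x: "pvar N (int i) = rvar i" "pvar N (int i + 1) = rvar (i + 1)"
    using i pvar_nat[of i N] pvar_nat[of "i + 1" N] by (simp_all add: add.commute)
  have ne: "rvar (i + 1) - rvar i \<noteq> 0" using rvar_inj[of "i + 1" i] by auto
  have e: "to_fract p - swap_aut i (to_fract p) = - ((rvar (i + 1) - rvar i) * to_fract (ddiff i p))"
    using arg_cong[OF ddiff_LP(2)[OF assms], of to_fract] by (simp add: rvar_def swap_aut_to_fract algebra_simps)
  have "xcoef N (int i) (int i + 1) * (to_fract p - swap_aut i (to_fract p))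
      = - (rconst (sK - 1) * rvar (i + 1) * to_fract (ddiff i p))"
    unfolding xcoef_def x e using ne by simp
  also have "\<dots> = rconst (1 - sK) * rvar (i + 1) * to_fract (ddiff i p)" by (simp add: rconst_hom algebra_simps)
  finally show ?thesis by (simp add: rconst_def rvar_def mult.assoc)
qed

section \<open>The action of the window group and its independence\<close>

definition window_op :: "nat \<Rightarrow> nat list \<Rightarrow> (int \<Rightarrow> int) \<Rightarrow> (tab \<Rightarrow> lrat) \<Rightarrow> (tab \<Rightarrow> lrat)" where
  "window_op N lam = affine_action.U (int N)
     (\<lambda>i. zpow (rot_op N lam) (- (i - 1)) \<circ> swap_op N lam 1 \<circ> zpow (rot_op N lam) (- (1 - i)))
     (\<lambda>k. zpow (rot_op N lam) (- k))"

definition window_aut :: "nat \<Rightarrow> (int \<Rightarrow> int) \<Rightarrow> lrat \<Rightarrow> lrat" where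
  "window_aut N b = (THE h. acts_by N b h)"

context
  fixes N lam
  assumes part: "is_partition N lam" and N2: "N \<ge> 2"
begin

abbreviation (input) "win \<equiv> affine_window (int N)"

lemma generators_affine_action:
  "affine_action (int N) (\<lambda>i. zpow (rot_op N lam) (- (i - 1)) \<circ> swap_op N lam 1 \<circ> zpow (rot_op N lam) (- (1 - i)))
     (\<lambda>k. zpow (rot_op N lam) (- k))"
  "1 \<le> i \<Longrightarrow> i < N \<Longrightarrow> zpow (rot_op N lam) (- (int i - 1)) \<circ> swap_op N lam 1 \<circ> zpow (rot_op N lam) (- (1 - int i)) = swap_op N lam i"
  "zpow (rot_op N lam) (- (- 1)) = rot_op N lam"
proof -
  note rules = bij_rot_op[OF part N2] swap_op_invol[OF part N2] swap_op_commute[OF part N2]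
    swap_op_braid[OF part N2] rot_op_swap_op[OF part N2] rot_op_swap_op_wrap[OF part N2]
  show "affine_action (int N) (\<lambda>i. zpow (rot_op N lam) (- (i - 1)) \<circ> swap_op N lam 1 \<circ> zpow (rot_op N lam) (- (1 - i)))
     (\<lambda>k. zpow (rot_op N lam) (- k))"
    by (rule affine_action_of_generators(1)[OF N2]; (rule rules; assumption)?)
  show "zpow (rot_op N lam) (- (int i - 1)) \<circ> swap_op N lam 1 \<circ> zpow (rot_op N lam) (- (1 - int i)) = swap_op N lam i" if "1 \<le> i" "i < N"
    by (rule affine_action_of_generators(2)[OF N2]; (rule rules that; assumption)?)
  show "zpow (rot_op N lam) (- (- 1)) = rot_op N lam"
    by (simp add: zpow_one)
qed

lemma window_op_comp: "b \<in> win \<Longrightarrow> c \<in> win \<Longrightarrow> window_op N lam (b \<circ> c) = window_op N lam b \<circ> window_op N lam c"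
  unfolding window_op_def by (rule affine_action.U_comp[OF generators_affine_action(1)])

lemma window_op_id: "window_op N lam id = id"
  unfolding window_op_def by (rule affine_action.U_id[OF generators_affine_action(1)])

lemma window_op_swap: "1 \<le> i \<Longrightarrow> i < N \<Longrightarrow> window_op N lam (affine_swap (int N) (int i)) = swap_op N lam i"
  unfolding window_op_def using affine_action.U_affine_swap[OF generators_affine_action(1), of "int i"] generators_affine_action(2)[of i] by simp

lemma window_op_shift_minus: "window_op N lam (\<lambda>j. j + - 1) = rot_op N lam"
  unfolding window_op_def using affine_action.U_shift[OF generators_affine_action(1), of "- 1"] generators_affine_action(3) by simp

lemma window_op_shift_plus: "window_op N lam (\<lambda>j. j + 1) = rot_op_inv N lam"
proof -
  have "window_op N lam ((\<lambda>j. j + 1) \<circ> (\<lambda>j. j + - 1)) = window_op N lam (\<lambda>j. j + 1) \<circ> rot_op N lam"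
    unfolding window_op_shift_minus[symmetric] by (intro window_op_comp affine_shift_window)
  moreover have "(\<lambda>j. j + 1) \<circ> (\<lambda>j. j + - 1) = (id :: int \<Rightarrow> int)" by auto
  ultimately have "window_op N lam (\<lambda>j. j + 1) \<circ> rot_op N lam = id" using window_op_id by simp
  then have "window_op N lam (\<lambda>j. j + 1) (rot_op N lam (rot_op_inv N lam F)) = rot_op_inv N lam F" for F by (metis comp_apply id_apply)
  then show ?thesis using rot_op_rot_op_inv[OF part N2] by (simp add: fun_eq_iff)
qed

lemma rot_aut_inv_acts: "acts_by N (\<lambda>j. j + 1) (rot_aut_inv N)"
proof -
  have N0: "0 < N" using N2 by simp
  have o: "rot_aut N (pvar N j) = pvar N (j - 1)" "k \<notin> {1..N} \<Longrightarrow> rot_aut N (rvar k) = rvar k" for j k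
    using rot_aut_acts[OF N0] by (auto simp: acts_by_def)
  show ?thesis unfolding acts_by_def
  proof (intro conjI allI impI)
    show "rot_aut_inv N (pvar N j) = pvar N (j + 1)" for j using o(1)[of "j + 1"] rot_aut_rot_aut_inv[OF N0] by (metis add_diff_cancel_right')
    show "rot_aut_inv N (rvar k) = rvar k" if "k \<notin> {1..N}" for k using o(2)[OF that] rot_aut_rot_aut_inv[OF N0] by metis
  qed (rule rot_aut_inv_hom[OF N0])
qed

text \<open>The windows having both an automorphism and a matching semilinear operator are closed
  under composition. They contain the shifts by 1 and -1 and one reflection, hence by conjugation
  all reflections.\<close>

lemma window_semilinear:
  assumes "b \<in> win" shows "\<exists>h. acts_by N b h \<and> semilinear_op N lam h (window_op N lam b)"
proof -
  define Q where "Q = {b \<in> win. \<exists>h. acts_by N b h \<and> semilinear_op N lam h (window_op N lam b)}"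
  have N0: "0 < N" using N2 by simp
  have comp: "b \<circ> c \<in> Q" if "b \<in> Q" "c \<in> Q" for b c
    using that acts_by_comp semilinear_op_comp window_op_comp affine_window_comp unfolding Q_def by (smt (verit) mem_Collect_eq)
  have shm: "(\<lambda>j. j + - 1) \<in> Q"
    unfolding Q_def using rot_aut_acts[OF N0] semilinear_rot_op[OF part N2] affine_shift_window[of "- 1" "int N"] window_op_shift_minus by auto
  have "semilinear_op N lam (rot_aut_inv N) (rot_op_inv N lam)"
    using semilinear_op_inv[OF semilinear_rot_op[OF part N2], of "rot_aut_inv N"] rot_aut_rot_aut_inv[OF N0] inv_rot_op[OF part N2] by simp
  then have shp: "(\<lambda>j. j + 1) \<in> Q"
    unfolding Q_def using rot_aut_inv_acts affine_shift_window window_op_shift_plus by auto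
  have sh: "(\<lambda>j. j + k) \<in> Q" for k
  proof (induction k rule: int_induct[where k = 0])
    case base
    have "(\<lambda>j. j + 1) \<circ> (\<lambda>j. j + - 1) = (\<lambda>j. j + (0::int))" by auto
    then show ?case using comp[OF shp shm] by simp
  next
    case (step1 k)
    have "(\<lambda>j. j + k) \<circ> (\<lambda>j. j + 1) = (\<lambda>j. j + (k + 1))" by (auto simp: algebra_simps)
    then show ?case using comp[OF step1(2) shp] by simp
  next
    case (step2 k)
    have "(\<lambda>j. j + k) \<circ> (\<lambda>j. j + - 1) = (\<lambda>j. j + (k - 1))" by (auto simp: algebra_simps)
    then show ?case using comp[OF step2(2) shm] by simp
  qed
  have sw1: "affine_swap (int N) 1 \<in> Q"
    unfolding Q_def using swap_aut_acts[of 1 N] semilinear_swap_op[OF part N2, of 1] affine_swap_window[of "int N" 1] window_op_swap[of 1] N2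
    by auto
  have sw: "affine_swap (int N) i \<in> Q" for i
  proof -
    have "(\<lambda>j. j + (i - 1)) \<circ> affine_swap (int N) 1 \<circ> (\<lambda>j. j + (1 - i)) = affine_swap (int N) i"
      using affine_swap_shift[of "int N" 1 "i - 1"] by (auto simp: fun_eq_iff) (metis add_diff_cancel_left' diff_add_cancel add_diff_eq)
    then show ?thesis using comp[OF comp[OF sh sw1] sh] by metis
  qed
  have "b \<in> Q"
    by (rule affine_action.window_induct[OF generators_affine_action(1) assms, of "\<lambda>b. b \<in> Q"]) (rule sh, erule comp[OF _ sw])
  then show ?thesis by (simp add: Q_def)
qed

lemma window_aut_eq: "acts_by N b h \<Longrightarrow> window_aut N b = h"
  unfolding window_aut_def using acts_by_unique by blast

lemma window_aut_acts: "b \<in> win \<Longrightarrow> acts_by N b (window_aut N b)"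
  using window_semilinear window_aut_eq by metis

lemma window_aut_hom: "b \<in> win \<Longrightarrow> field_hom (window_aut N b)"
  using window_aut_acts by (simp add: acts_by_def)

lemma window_op_semilinear: "b \<in> win \<Longrightarrow> semilinear_op N lam (window_aut N b) (window_op N lam b)"
  using window_semilinear window_aut_eq by metis

lemma window_aut_comp: "b \<in> win \<Longrightarrow> c \<in> win \<Longrightarrow> window_aut N (b \<circ> c) = window_aut N b \<circ> window_aut N c"
  by (intro window_aut_eq acts_by_comp window_aut_acts)

text \<open>A variable \<open>x_k\<close> with \<open>k\<close> in \<open>1..N\<close> already
  separates the two automorphisms. A witness in \<open>LP N\<close> matters because the operators
  are known only there.\<close>

lemma window_aut_distinct:
  assumes "b \<in> win" "c \<in> win" "b \<noteq> c" shows "\<exists>p\<in>LP N. window_aut N b (to_fract p) \<noteq> window_aut N c (to_fract p)"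
proof -
  have N0: "0 < N" using N2 by simp
  obtain j where j: "b j \<noteq> c j" using assms(3) by blast
  obtain k t where k: "1 \<le> k" "k \<le> N" "j = int k + int N * t" using pvar_cases[OF N0] .
  have "b (int k) \<noteq> c (int k)"
    using j affine_window_add_mult[OF assms(1), of "int k" t] affine_window_add_mult[OF assms(2), of "int k" t] k by auto
  then have "pvar N (b (int k)) \<noteq> pvar N (c (int k))" using pvar_inj[OF N0] by blast
  then have "window_aut N b (rvar k) \<noteq> window_aut N c (rvar k)"
    using window_aut_acts[OF assms(1)] window_aut_acts[OF assms(2)] pvar_nat[OF k(1,2)] unfolding acts_by_def by metis
  then show ?thesis using LP_Xv[OF k(1,2)] unfolding rvar_def by blast
qed

end

text \<open>Artin's argument, for characters tested only on a submonoid \<open>M\<close>, so that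
  Laurent polynomials suffice to detect coefficients that are rational functions.\<close>

lemma dedekind_independence:
  fixes \<chi> :: "'b \<Rightarrow> 'm::monoid_mult \<Rightarrow> 'f::field"
  assumes "finite B" "1 \<in> M" "\<And>p q. p \<in> M \<Longrightarrow> q \<in> M \<Longrightarrow> p * q \<in> M"
    "\<And>b p q. b \<in> B \<Longrightarrow> \<chi> b (p * q) = \<chi> b p * \<chi> b q" "\<And>b. b \<in> B \<Longrightarrow> \<chi> b 1 = 1"
    "\<And>b c. b \<in> B \<Longrightarrow> c \<in> B \<Longrightarrow> b \<noteq> c \<Longrightarrow> \<exists>p\<in>M. \<chi> b p \<noteq> \<chi> c p"
    "\<And>p. p \<in> M \<Longrightarrow> (\<Sum>b\<in>B. \<kappa> b * \<chi> b p) = 0"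
  shows "\<forall>b\<in>B. \<kappa> b = 0"
  using assms(1,4-7)
proof (induction B arbitrary: \<kappa> rule: finite_induct)
  case (insert a B)
  have zero: "\<kappa> b = 0" if b: "b \<in> B" for b
  proof -
    obtain y where y: "y \<in> M" "\<chi> b y \<noteq> \<chi> a y" using insert.prems(3)[of b a] b insert.hyps by auto
    \<comment> \<open>Evaluate the relation at \<open>p * y\<close> and subtract
      \<open>\<chi> a y\<close> times the relation at \<open>p\<close>: the term of \<open>a\<close>
      disappears and the others gain the factor \<open>\<chi> b y - \<chi> a y\<close>.\<close>
    have "\<forall>b\<in>B. \<kappa> b * (\<chi> b y - \<chi> a y) = 0"
    proof (rule insert.IH)
      fix p assume p: "p \<in> M"
      have 1: "\<kappa> a * \<chi> a p + (\<Sum>b\<in>B. \<kappa> b * \<chi> b p) = 0" using insert.prems(4)[OF p] insert.hyps by simp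
      have "\<kappa> a * \<chi> a (p * y) + (\<Sum>b\<in>B. \<kappa> b * \<chi> b (p * y)) = 0"
        using insert.prems(4)[of "p * y"] assms(3)[OF p y(1)] insert.hyps by simp
      then have 2: "\<kappa> a * \<chi> a p * \<chi> a y + (\<Sum>b\<in>B. \<kappa> b * \<chi> b p * \<chi> b y) = 0"
        using insert.prems(1) by (simp add: mult.assoc)
      have "(\<Sum>b\<in>B. \<kappa> b * (\<chi> b y - \<chi> a y) * \<chi> b p)
          = (\<Sum>b\<in>B. \<kappa> b * \<chi> b p * \<chi> b y) - (\<Sum>b\<in>B. \<kappa> b * \<chi> b p) * \<chi> a y"
        by (simp only: sum_distrib_right sum_subtractf[symmetric]) (simp add: algebra_simps)
      also have "\<dots> = (\<kappa> a * \<chi> a p * \<chi> a y + (\<Sum>b\<in>B. \<kappa> b * \<chi> b p * \<chi> b y))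
          - (\<kappa> a * \<chi> a p + (\<Sum>b\<in>B. \<kappa> b * \<chi> b p)) * \<chi> a y" by (simp add: algebra_simps)
      also have "\<dots> = 0" unfolding 1 2 by simp
      finally show "(\<Sum>b\<in>B. \<kappa> b * (\<chi> b y - \<chi> a y) * \<chi> b p) = 0" .
    qed (use insert.prems in auto)
    then have "\<kappa> b * (\<chi> b y - \<chi> a y) = 0" using b by blast
    then show ?thesis using y by simp
  qed
  moreover have "\<kappa> a = 0" using insert.prems(4)[OF assms(2)] insert.prems(2)[of a] insert.hyps zero by simp
  ultimately show ?case by blast
qed simp

text \<open>Evaluation of an expansion with an arbitrary interpretation \<open>\<theta>\<close> of
  windows, so that the same list can be read through automorphisms or through operators on
  \<open>V\<close>. Windows may repeat; \<open>comb_coeff\<close> collects them.\<close>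

definition comb :: "(lrat \<times> (int \<Rightarrow> int)) list \<Rightarrow> ((int \<Rightarrow> int) \<Rightarrow> lrat) \<Rightarrow> lrat" where
  "comb xs \<theta> = (\<Sum>(k, b)\<leftarrow>xs. k * \<theta> b)"

definition comb_coeff :: "(lrat \<times> (int \<Rightarrow> int)) list \<Rightarrow> (int \<Rightarrow> int) \<Rightarrow> lrat" where
  "comb_coeff xs b = (\<Sum>(k, c)\<leftarrow>xs. if c = b then k else 0)"

lemma comb_comb_coeff: "finite C \<Longrightarrow> snd ` set xs \<subseteq> C \<Longrightarrow> comb xs \<theta> = (\<Sum>b\<in>C. comb_coeff xs b * \<theta> b)"
proof (induction xs)
  case (Cons x xs)
  obtain k c where x: "x = (k, c)" by (cases x)
  have "(\<Sum>b\<in>C. comb_coeff (x # xs) b * \<theta> b) = (\<Sum>b\<in>C. (if b = c then k * \<theta> c else 0) + comb_coeff xs b * \<theta> b)"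
    by (rule sum.cong) (auto simp: comb_coeff_def x distrib_right)
  also have "\<dots> = k * \<theta> c + comb xs \<theta>" using Cons x by (simp add: sum.distrib)
  finally show ?case by (simp add: comb_def x)
qed (simp add: comb_def comb_coeff_def)

lemma comb_coeff_notin: "b \<notin> snd ` set xs \<Longrightarrow> comb_coeff xs b = 0"
  by (induction xs) (auto simp: comb_coeff_def)

lemma comb_Cons: "comb ((k, b) # xs) \<theta> = k * \<theta> b + comb xs \<theta>"
  by (simp add: comb_def)

lemma comb_append: "comb (xs @ ys) \<theta> = comb xs \<theta> + comb ys \<theta>"
  by (simp add: comb_def)

lemma comb_scale: "comb (map (\<lambda>(k, b). (c * k, b)) xs) \<theta> = c * comb xs \<theta>"
  by (induction xs) (auto simp: comb_def algebra_simps)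

definition lift :: "(tab \<Rightarrow> lpoly) \<Rightarrow> tab \<Rightarrow> lrat" where
  "lift F = (\<lambda>T. to_fract (F T))"

context
  fixes N lam
  assumes part: "is_partition N lam" and N2: "N \<ge> 2"
begin

text \<open>The weight \<open>\<mu>\<close> covers both sides: it is 1 for scalar operators and an
  entry of the window operator for vector-valued ones.\<close>

lemma comb_coeff_zero_of_LP:
  assumes xs: "snd ` set xs \<subseteq> affine_window (int N)"
    and z: "\<And>p. p \<in> LP N \<Longrightarrow> comb (map (\<lambda>(k, b). (k * \<mu> b, b)) xs) (\<lambda>b. window_aut N b (to_fract p)) = 0"
  shows "comb_coeff xs b * \<mu> b = 0"
proof (cases "b \<in> snd ` set xs")
  case True
  have e: "comb_coeff (map (\<lambda>(k, b). (k * \<mu> b, b)) xs) b = comb_coeff xs b * \<mu> b" for b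
    by (induction xs) (auto simp: comb_coeff_def distrib_right)
  have "\<forall>b\<in>snd ` set xs. comb_coeff (map (\<lambda>(k, b). (k * \<mu> b, b)) xs) b = 0"
  proof (rule dedekind_independence[where M = "LP N" and \<chi> = "\<lambda>b p. window_aut N b (to_fract p)"])
    fix p assume p: "p \<in> LP N"
    have "snd ` set (map (\<lambda>(k, b). (k * \<mu> b, b)) xs) \<subseteq> snd ` set xs" by force
    then show "(\<Sum>b\<in>snd ` set xs. comb_coeff (map (\<lambda>(k, b). (k * \<mu> b, b)) xs) b * window_aut N b (to_fract p)) = 0"
      using comb_comb_coeff[of "snd ` set xs" "map (\<lambda>(k, b). (k * \<mu> b, b)) xs"] z[OF p] by simp
  next
    fix b c assume "b \<in> snd ` set xs" "c \<in> snd ` set xs" "b \<noteq> c"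
    then show "\<exists>p\<in>LP N. window_aut N b (to_fract p) \<noteq> window_aut N c (to_fract p)"
      using window_aut_distinct[OF part N2] xs by blast
  next
    fix b p q assume "b \<in> snd ` set xs"
    then have h: "field_hom (window_aut N b)" using window_aut_hom[OF part N2] xs by blast
    show "window_aut N b (to_fract (p * q)) = window_aut N b (to_fract p) * window_aut N b (to_fract q)" by (simp add: field_homD[OF h])
  next
    fix b assume "b \<in> snd ` set xs"
    then have h: "field_hom (window_aut N b)" using window_aut_hom[OF part N2] xs by blast
    show "window_aut N b (to_fract 1) = 1" by (simp add: field_homD[OF h])
  qed (auto intro: LP_one LP_mult)
  from bspec[OF this True] show ?thesis unfolding e .
qed (simp add: comb_coeff_notin)

lemma indep_LP:
  assumes "snd ` set xs \<subseteq> affine_window (int N)" "\<And>p. p \<in> LP N \<Longrightarrow> comb xs (\<lambda>b. window_aut N b (to_fract p)) = 0"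
  shows "comb_coeff xs b = 0"
proof -
  have m: "map (\<lambda>(k, b). (k * 1, b)) xs = xs" by (induction xs) auto
  have "comb_coeff xs b * 1 = 0"
    by (rule comb_coeff_zero_of_LP[OF assms(1), where \<mu> = "\<lambda>_. 1"]) (unfold m, rule assms(2))
  then show ?thesis by simp
qed

text \<open>On a pure tensor of \<open>p\<close> with \<open>T0\<close>, semilinearity pulls
  \<open>p\<close> out as \<open>g_b(p)\<close>, leaving the weight
  \<open>window_op N lam b E T\<close>. For the given \<open>b\<close> a \<open>T\<close> with
  nonzero weight exists, because the operator is injective.\<close>

lemma indep_VP:
  assumes xs: "snd ` set xs \<subseteq> affine_window (int N)"
    and z: "\<And>F T. F \<in> VP N lam \<Longrightarrow> comb xs (\<lambda>b. window_op N lam b (lift F) T) = 0"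
  shows "comb_coeff xs b = 0"
proof (cases "b \<in> snd ` set xs")
  case True
  obtain T0 where T0: "T0 \<in> Tab N lam" using Tab_nonempty[OF part] by blast
  define E :: "tab \<Rightarrow> lrat" where "E = (\<lambda>T. if T = T0 then 1 else 0)"
  have b: "b \<in> affine_window (int N)" using True xs by blast
  have sl: "window_op N lam c (\<lambda>T. a * F T) = (\<lambda>T. window_aut N c a * window_op N lam c F T)" if "c \<in> snd ` set xs" for c a F
    using window_op_semilinear[OF part N2, of c] xs that unfolding semilinear_op_def by blast
  have "E \<noteq> (\<lambda>_. 0)" by (auto simp: E_def fun_eq_iff)
  moreover have "inj (window_op N lam b)" "window_op N lam b (\<lambda>_. 0) = (\<lambda>_. 0)"
    using window_op_semilinear[OF part N2 b] semilinear_op_zero by (auto simp: semilinear_op_def bij_is_inj)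
  ultimately have "window_op N lam b E \<noteq> (\<lambda>_. 0)" by (metis injD)
  then obtain T where T: "window_op N lam b E T \<noteq> 0" by blast
  have "comb_coeff xs b * window_op N lam b E T = 0"
  proof (rule comb_coeff_zero_of_LP[OF xs])
    fix p assume p: "p \<in> LP N"
    define F where "F = (\<lambda>T. if T = T0 then p else 0)"
    have "F \<in> VP N lam" using p T0 LP_zero by (auto simp: VP_def F_def)
    then have "comb xs (\<lambda>b. window_op N lam b (lift F) T) = 0" by (rule z)
    moreover have "lift F = (\<lambda>T. to_fract p * E T)" by (auto simp: lift_def F_def E_def)
    ultimately have 0: "comb xs (\<lambda>b. window_op N lam b (\<lambda>T. to_fract p * E T) T) = 0" by simp
    have "comb (map (\<lambda>(k, b). (k * window_op N lam b E T, b)) ys) (\<lambda>b. window_aut N b (to_fract p))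
        = comb ys (\<lambda>b. window_op N lam b (\<lambda>T. to_fract p * E T) T)" if "set ys \<subseteq> set xs" for ys
      using that
    proof (induction ys)
      case (Cons y ys)
      obtain k c where y: "y = (k, c)" by (cases y)
      then have "c \<in> snd ` set xs" using Cons(2) by force
      from sl[OF this] have s: "window_op N lam c (\<lambda>T. to_fract p * E T) T = window_aut N c (to_fract p) * window_op N lam c E T" by simp
      have IH: "comb (map (\<lambda>(k, b). (k * window_op N lam b E T, b)) ys) (\<lambda>b. window_aut N b (to_fract p))
        = comb ys (\<lambda>b. window_op N lam b (\<lambda>T. to_fract p * E T) T)" using Cons by simp
      show ?case unfolding y list.map prod.case comb_Cons s IH by (simp add: mult_ac)
    qed (simp add: comb_def)
    from this[of xs] 0 show "comb (map (\<lambda>(k, b). (k * window_op N lam b E T, b)) xs) (\<lambda>b. window_aut N b (to_fract p)) = 0" by simp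
  qed
  then show ?thesis using T by simp
qed (simp add: comb_coeff_notin)

end

section \<open>The isomorphism\<close>

lemma to_fract_lconst [simp]: "to_fract (lconst c) = rconst c"
  by (simp add: rconst_def)

lemma hecke_word_Mprod: "T' \<in> Tab N lam \<Longrightarrow> hecke_word N lam k F T' = (\<Sum>T\<in>Tab N lam. rconst (Mprod N lam k T T') * F T)"
proof (induction k arbitrary: T')
  case 0
  then show ?case using finite_Tab by (simp add: if_distrib[of rconst] if_distrib[of "\<lambda>x. x * _"] sum.delta cong: if_cong)
next
  case (Suc k)
  have "hecke_word N lam (Suc k) F T' = (\<Sum>U\<in>Tab N lam. rconst (Tmat lam (Suc k) U T') * hecke_word N lam k F U)"
    using Suc.prems by (simp add: hecke_def)
  also have "\<dots> = (\<Sum>U\<in>Tab N lam. \<Sum>T\<in>Tab N lam. rconst (Mprod N lam k T U * Tmat lam (Suc k) U T') * F T)"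
    by (intro sum.cong refl) (simp add: Suc.IH sum_distrib_left rconst_hom mult_ac)
  also have "\<dots> = (\<Sum>T\<in>Tab N lam. \<Sum>U\<in>Tab N lam. rconst (Mprod N lam k T U * Tmat lam (Suc k) U T') * F T)"
    by (rule sum.swap)
  finally show ?case by (simp add: rconst_sum sum_distrib_right)
qed

text \<open>The list \<open>xs\<close> of pairs \<open>(c, b)\<close> is a common expansion \<open>\<Sum> c g\<^sub>b\<close> of \<open>f\<close> and \<open>\<Sum> c U\<^sub>b\<close> of \<open>h\<close>.\<close>
definition represents :: "nat \<Rightarrow> nat list \<Rightarrow> (lpoly \<Rightarrow> lpoly) \<Rightarrow> ((tab \<Rightarrow> lpoly) \<Rightarrow> (tab \<Rightarrow> lpoly))
    \<Rightarrow> (lrat \<times> (int \<Rightarrow> int)) list \<Rightarrow> bool" where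
  "represents N lam f h xs \<longleftrightarrow> snd ` set xs \<subseteq> affine_window (int N)
    \<and> (\<forall>p. p \<notin> LP N \<longrightarrow> f p = 0)
    \<and> (\<forall>p\<in>LP N. f p \<in> LP N \<and> to_fract (f p) = comb xs (\<lambda>b. window_aut N b (to_fract p)))
    \<and> (\<forall>F. F \<notin> VP N lam \<longrightarrow> h F = (\<lambda>_. 0))
    \<and> (\<forall>F\<in>VP N lam. h F \<in> VP N lam \<and> (\<forall>T. to_fract (h F T) = comb xs (\<lambda>b. window_op N lam b (lift F) T)))"

lemma VP_zero: "(\<lambda>_. 0) \<in> VP N lam"
  by (simp add: VP_def LP_zero)

lemma VP_D: "F \<in> VP N lam \<Longrightarrow> F T \<in> LP N" "F \<in> VP N lam \<Longrightarrow> T \<notin> Tab N lam \<Longrightarrow> F T = 0"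
  by (auto simp: VP_def)

lemma lift_inj: "lift F = lift G \<Longrightarrow> F = G"
  by (simp add: lift_def fun_eq_iff)

text \<open>The product of the skew group ring: moving the coefficient \<open>l\<close> to the left
  past the window \<open>b\<close> applies the automorphism of \<open>b\<close> to it.\<close>

definition comb_mult :: "nat \<Rightarrow> (lrat \<times> (int \<Rightarrow> int)) list \<Rightarrow> (lrat \<times> (int \<Rightarrow> int)) list \<Rightarrow> (lrat \<times> (int \<Rightarrow> int)) list" where
  "comb_mult N xs ys = concat (map (\<lambda>(k, b). map (\<lambda>(l, c). (k * window_aut N b l, b \<circ> c)) ys) xs)"

lemma comb_comb_mult: "comb (comb_mult N xs ys) \<theta> = comb xs (\<lambda>b. \<Sum>(l, c)\<leftarrow>ys. window_aut N b l * \<theta> (b \<circ> c))"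
proof (induction xs)
  case (Cons x xs)
  obtain k b where x: "x = (k, b)" by (cases x)
  have "comb (map (\<lambda>(l, c). (k * window_aut N b l, b \<circ> c)) ys) \<theta> = k * (\<Sum>(l, c)\<leftarrow>ys. window_aut N b l * \<theta> (b \<circ> c))"
    by (induction ys) (auto simp: comb_def algebra_simps)
  moreover have "comb_mult N ((k, b) # xs) ys = map (\<lambda>(l, c). (k * window_aut N b l, b \<circ> c)) ys @ comb_mult N xs ys"
    by (simp add: comb_mult_def)
  ultimately show ?case unfolding x by (simp only: comb_append comb_Cons Cons.IH)
qed (simp add: comb_mult_def comb_def)

lemma comb_cong: "(\<And>b. b \<in> snd ` set xs \<Longrightarrow> \<theta> b = \<theta>' b) \<Longrightarrow> comb xs \<theta> = comb xs \<theta>'"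
  unfolding comb_def by (rule arg_cong[where f = sum_list], rule map_cong) force+

context
  fixes N lam
  assumes part: "is_partition N lam" and N2: "N \<ge> 2"
begin

text \<open>Needed for composition: outside its space the inner operator takes the default value 0,
  and the outer one must keep it.\<close>

lemma represents_zero: assumes "represents N lam f h xs" shows "f 0 = 0" "h (\<lambda>_. 0) = (\<lambda>_. 0)"
proof -
  have w: "snd ` set xs \<subseteq> affine_window (int N)" using assms by (simp add: represents_def)
  have z: "comb xs (\<lambda>_. 0) = 0" by (induction xs) (auto simp: comb_def)
  have "to_fract (f 0) = comb xs (\<lambda>b. window_aut N b 0)" using assms LP_zero by (simp add: represents_def)
  also have "\<dots> = comb xs (\<lambda>_. 0)"
    using w field_homD(4)[OF window_aut_hom[OF part N2]] by (intro comb_cong) blast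
  finally show "f 0 = 0" using z by simp
  have "to_fract (h (\<lambda>_. 0) T) = 0" for T
  proof -
    have "to_fract (h (\<lambda>_. 0) T) = comb xs (\<lambda>b. window_op N lam b (lift (\<lambda>_. 0)) T)" using assms VP_zero by (simp add: represents_def)
    also have "\<dots> = comb xs (\<lambda>_. 0)"
    proof (rule comb_cong)
      fix b assume "b \<in> snd ` set xs"
      then have "window_op N lam b (\<lambda>_. 0) = (\<lambda>_. 0)" using w window_op_semilinear[OF part N2] semilinear_op_zero by blast
      then show "window_op N lam b (lift (\<lambda>_. 0)) T = 0" by (simp add: lift_def)
    qed
    finally show ?thesis using z by simp
  qed
  then show "h (\<lambda>_. 0) = (\<lambda>_. 0)" by auto
qed

lemma represents_comp:
  assumes r: "represents N lam f h xs" and r': "represents N lam f' h' ys"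
  shows "represents N lam (f \<circ> f') (h \<circ> h') (comb_mult N xs ys)"
proof -
  have w: "snd ` set xs \<subseteq> affine_window (int N)" "snd ` set ys \<subseteq> affine_window (int N)"
    using r r' by (simp_all add: represents_def)
  have "snd ` set (comb_mult N xs ys) \<subseteq> affine_window (int N)"
  proof
    fix d assume "d \<in> snd ` set (comb_mult N xs ys)"
    then obtain k b l c where "(k, b) \<in> set xs" "(l, c) \<in> set ys" "d = b \<circ> c" by (auto simp: comb_mult_def o_def)
    then show "d \<in> affine_window (int N)" using w by (force intro: affine_window_comp)
  qed
  moreover have "to_fract (f (f' p)) = comb (comb_mult N xs ys) (\<lambda>b. window_aut N b (to_fract p))" if p: "p \<in> LP N" for p
  proof -
    have f': "f' p \<in> LP N" "to_fract (f' p) = comb ys (\<lambda>b. window_aut N b (to_fract p))" using r' p by (auto simp: represents_def)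
    have "to_fract (f (f' p)) = comb xs (\<lambda>b. window_aut N b (comb ys (\<lambda>b. window_aut N b (to_fract p))))"
      using r f' by (auto simp: represents_def)
    also have "\<dots> = comb (comb_mult N xs ys) (\<lambda>b. window_aut N b (to_fract p))"
      unfolding comb_comb_mult
    proof (rule comb_cong)
      fix b assume "b \<in> snd ` set xs"
      then have b: "b \<in> affine_window (int N)" using w by blast
      note h = field_homD[OF window_aut_hom[OF part N2 b]]
      show "window_aut N b (comb ys (\<lambda>b. window_aut N b (to_fract p))) = (\<Sum>(l, c)\<leftarrow>ys. window_aut N b l * window_aut N (b \<circ> c) (to_fract p))"
        using w(2)
      proof (induction ys)
        case (Cons y ys)
        obtain l c where y: "y = (l, c)" by (cases y)
        have "window_aut N (b \<circ> c) = window_aut N b \<circ> window_aut N c" using Cons y b by (intro window_aut_comp[OF part N2]) auto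
        then have "window_aut N (b \<circ> c) z = window_aut N b (window_aut N c z)" for z by simp
        then show ?case using Cons by (simp add: y comb_Cons h del: o_apply)
      qed (simp add: comb_def h)
    qed
    finally show ?thesis .
  qed
  moreover have "to_fract (h (h' F) T) = comb (comb_mult N xs ys) (\<lambda>b. window_op N lam b (lift F) T)" if F: "F \<in> VP N lam" for F T
  proof -
    have h': "h' F \<in> VP N lam" "lift (h' F) = (\<lambda>T. comb ys (\<lambda>b. window_op N lam b (lift F) T))"
      using r' F by (auto simp: represents_def lift_def)
    have "to_fract (h (h' F) T) = comb xs (\<lambda>b. window_op N lam b (\<lambda>T. comb ys (\<lambda>b. window_op N lam b (lift F) T)) T)"
      using r h' by (auto simp: represents_def)
    also have "\<dots> = comb (comb_mult N xs ys) (\<lambda>b. window_op N lam b (lift F) T)"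
      unfolding comb_comb_mult
    proof (rule comb_cong)
      fix b assume "b \<in> snd ` set xs"
      then have b: "b \<in> affine_window (int N)" using w by blast
      have sc: "window_op N lam b (\<lambda>T. c * F T) = (\<lambda>T. window_aut N b c * window_op N lam b F T)"
        and ad: "window_op N lam b (\<lambda>T. F T + G T) = (\<lambda>T. window_op N lam b F T + window_op N lam b G T)" for c F G
        using window_op_semilinear[OF part N2 b] unfolding semilinear_op_def by blast+
      have z: "window_op N lam b (\<lambda>_. 0) = (\<lambda>_. 0)" using window_op_semilinear[OF part N2 b] semilinear_op_zero by blast
      show "window_op N lam b (\<lambda>T. comb ys (\<lambda>b. window_op N lam b (lift F) T)) T = (\<Sum>(l, c)\<leftarrow>ys. window_aut N b l * window_op N lam (b \<circ> c) (lift F) T)"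
        using w(2)
      proof (induction ys)
        case (Cons y ys)
        obtain l c where y: "y = (l, c)" by (cases y)
        have "window_op N lam (b \<circ> c) = window_op N lam b \<circ> window_op N lam c" using Cons y b by (intro window_op_comp[OF part N2]) auto
        then have "window_op N lam (b \<circ> c) G = window_op N lam b (window_op N lam c G)" for G by simp
        then show ?case using Cons by (simp add: y comb_Cons sc ad del: o_apply)
      qed (simp add: comb_def z)
    qed
    finally show ?thesis .
  qed
  ultimately show ?thesis using r r' represents_zero[OF r] unfolding represents_def by auto
qed

lemma represents_add:
  assumes "represents N lam f h xs" "represents N lam f' h' ys"
  shows "represents N lam (\<lambda>p. f p + f' p) (\<lambda>F. addV (h F) (h' F)) (xs @ ys)"
  using assms unfolding represents_def by (auto simp: addV_def comb_append VP_def intro: LP_add)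

lemma represents_smult:
  assumes "represents N lam f h xs"
  shows "represents N lam (\<lambda>p. lconst c * f p) (\<lambda>F. smV c (h F)) (map (\<lambda>(k, b). (rconst c * k, b)) xs)"
proof -
  have "snd ` set (map (\<lambda>(k, b). (rconst c * k, b)) xs) = snd ` set xs" by force
  then show ?thesis
    using assms unfolding represents_def by (simp add: smV_def comb_scale VP_def LP_mult LP_lconst)
qed

text \<open>Independence is applied to the formal difference of the two lists: equality on either
  side makes all collected coefficients agree, hence the other side too. One direction makes the map
  well defined, the other makes it injective.\<close>

lemma represents_unique:
  assumes r: "represents N lam f h xs" and r': "represents N lam f' h' ys"
  shows "f = f' \<longleftrightarrow> h = h'"
proof -
  let ?zs = "xs @ map (\<lambda>(k, b). (- 1 * k, b)) ys"
  have "snd ` set (map (\<lambda>(k, b). (- 1 * k, b)) ys) = snd ` set ys" by force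
  then have w: "snd ` set ?zs \<subseteq> affine_window (int N)" using r r' unfolding represents_def set_append image_Un by simp
  have evz: "comb ?zs \<theta> = comb xs \<theta> - comb ys \<theta>" for \<theta> unfolding comb_append comb_scale by simp
  have ev0: "comb xs \<theta> = comb ys \<theta>" if "\<And>b. comb_coeff ?zs b = 0" for \<theta>
    using comb_comb_coeff[OF _ order_refl, of ?zs \<theta>] that evz[of \<theta>] by simp
  have L: "comb xs (\<lambda>b. window_aut N b (to_fract p)) = to_fract (f p)" "comb ys (\<lambda>b. window_aut N b (to_fract p)) = to_fract (f' p)"
    if "p \<in> LP N" for p using r r' that by (simp_all add: represents_def)
  have V: "comb xs (\<lambda>b. window_op N lam b (lift F) T) = to_fract (h F T)" "comb ys (\<lambda>b. window_op N lam b (lift F) T) = to_fract (h' F T)"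
    if "F \<in> VP N lam" for F T using r r' that by (simp_all add: represents_def)
  show ?thesis
  proof
    assume eq: "f = f'"
    have "comb_coeff ?zs b = 0" for b
      by (rule indep_LP[OF part N2 w]) (simp only: evz L eq diff_self)
    note e = ev0[OF this]
    show "h = h'"
    proof
      fix F
      show "h F = h' F"
      proof (cases "F \<in> VP N lam")
        case True
        then have "to_fract (h F T) = to_fract (h' F T)" for T by (simp only: V[symmetric] e)
        then show ?thesis by (simp add: fun_eq_iff)
      qed (use r r' in \<open>simp add: represents_def\<close>)
    qed
  next
    assume eq: "h = h'"
    have "comb_coeff ?zs b = 0" for b
      by (rule indep_VP[OF part N2 w]) (simp only: evz V eq diff_self)
    note e = ev0[OF this]
    show "f = f'"
    proof
      fix p
      show "f p = f' p"
      proof (cases "p \<in> LP N")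
        case True
        then have "to_fract (f p) = to_fract (f' p)" by (simp only: L[symmetric] e)
        then show ?thesis by simp
      qed (use r r' in \<open>simp add: represents_def\<close>)
    qed
  qed
qed

lemma window_aut_values:
  "window_aut N id = id" "1 \<le> i \<Longrightarrow> i < N \<Longrightarrow> window_aut N (affine_swap (int N) (int i)) = swap_aut i"
  "window_aut N (\<lambda>j. j + - 1) = rot_aut N" "window_aut N (\<lambda>j. j + 1) = rot_aut_inv N"
  using window_aut_eq[OF part N2] acts_by_id swap_aut_acts rot_aut_acts rot_aut_inv_acts[OF part N2] N2 by auto

lemma id_window: "id \<in> affine_window (int N)"
  by (simp add: affine_window_def)

lemma represents_unit: "represents N lam (ropL N id) (ropV N lam id) [(1, id)]"
  using id_window window_op_id[OF part N2]
  by (auto simp: represents_def ropL_def ropV_def comb_def window_aut_values lift_def)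

lemma represents_mult:
  assumes "r \<in> LP N"
  shows "represents N lam (ropL N (\<lambda>p. r * p)) (ropV N lam (\<lambda>F T. r * F T)) [(to_fract r, id)]"
  using assms id_window window_op_id[OF part N2]
  by (auto simp: represents_def ropL_def ropV_def comb_def window_aut_values lift_def VP_def intro: LP_mult)

lemma bw_rot_op: assumes "F \<in> VP N lam" shows "bw N lam F \<in> VP N lam" "lift (bw N lam F) = rot_op N lam (lift F)"
proof -
  have N0: "0 < N" using N2 by simp
  show "bw N lam F \<in> VP N lam"
    using assms N0 by (auto simp: bw_def ropV_def VP_def intro!: LP_sum LP_mult LP_lconst LP_lp_w LP_zero)
  show "lift (bw N lam F) = rot_op N lam (lift F)"
  proof
    fix T
    show "lift (bw N lam F) T = rot_op N lam (lift F) T"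
    proof (cases "T \<in> Tab N lam")
      case True
      then show ?thesis using assms N0
        by (simp add: bw_def ropV_def lift_def rot_op_def hecke_word_Mprod rot_aut_to_fract)
    next
      case False
      then have "rot_op N lam (lift F) T = 0"
        using semilinear_rot_op[OF part N2] assms by (simp add: semilinear_op_def lift_def VP_D)
      then show ?thesis using False assms by (simp add: bw_def ropV_def lift_def)
    qed
  qed
qed

lemma represents_w: "represents N lam (wxL N) (bw N lam) [(1, \<lambda>j. j + - 1)]"
proof -
  have N0: "0 < N" using N2 by simp
  have "to_fract (bw N lam F T) = rot_op N lam (lift F) T" if "F \<in> VP N lam" for F T
    using bw_rot_op(2)[OF that] by (metis lift_def)
  then show ?thesis
    using affine_shift_window[of "- 1" "int N"] bw_rot_op(1) window_op_shift_minus[OF part N2] window_aut_values(3) LP_lp_w[OF _ N0] rot_aut_to_fract[OF N0]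
    by (auto simp: represents_def wxL_def ropL_def comb_def) (simp add: bw_def ropV_def)
qed

text \<open>The inverse computed over the fraction field does not leave the Laurent polynomials, so
  \<open>bw\<close> is surjective on \<open>VP N lam\<close> and \<open>bw_inv\<close> is a genuine
  inverse.\<close>

lemma rot_op_inv_VP: assumes "F \<in> VP N lam" shows "\<exists>G\<in>VP N lam. lift G = rot_op_inv N lam (lift F)"
proof -
  have N0: "0 < N" using N2 by simp
  have hecke_inv: "\<exists>G\<in>VP N lam. lift G = hecke_inv N lam i (lift F)" if F: "F \<in> VP N lam" for i F
  proof -
    define G where "G = (\<lambda>T'. if T' \<in> Tab N lam then
      lconst (1 / sK) * ((\<Sum>T\<in>Tab N lam. lconst (Tmat lam i T T') * F T) - lconst (sK - 1) * F T') else 0)"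
    have "G \<in> VP N lam"
      using F by (auto simp: VP_def G_def intro!: LP_mult LP_lconst LP_diff LP_sum LP_zero)
    moreover have "lift G T = hecke_inv N lam i (lift F) T" for T
    proof (cases "T \<in> Tab N lam")
      case True
      have "rconst (1 / sK) * rconst sK = 1" using sK_nonzero by (simp add: rconst_hom[symmetric])
      then have "rconst (1 / sK) = 1 / rconst sK" using sK_nonzero by (simp add: field_simps)
      then show ?thesis using True by (simp add: G_def lift_def hecke_inv_def hecke_def)
    qed (use F in \<open>simp add: G_def lift_def hecke_inv_def hecke_off VP_D\<close>)
    ultimately show ?thesis by blast
  qed
  have "\<exists>G\<in>VP N lam. lift G = hecke_word_inv N lam k (lift F)" for k using assms
  proof (induction k arbitrary: F)
    case (Suc k)
    obtain G where "G \<in> VP N lam" "lift G = hecke_inv N lam (Suc k) (lift F)" using hecke_inv[OF Suc.prems] by blast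
    then show ?case using Suc.IH by force
  qed auto
  then obtain G where G: "G \<in> VP N lam" "lift G = hecke_word_inv N lam (N - 1) (lift F)" by blast
  have "(\<lambda>T. lp_w_inv N (G T)) \<in> VP N lam"
    using G(1) N0 by (auto simp: VP_def intro: LP_lp_w_inv) (simp add: lp_w_inv_def)
  moreover have "lift (\<lambda>T. lp_w_inv N (G T)) = rot_op_inv N lam (lift F)"
    unfolding rot_op_inv_def G(2)[symmetric] using N0 by (simp add: lift_def rot_aut_inv_to_fract)
  ultimately show ?thesis by blast
qed

text \<open>Both inverses are given by \<open>the_inv_into\<close>, so they are identified by
  proving injectivity on the space and exhibiting a preimage inside it.\<close>

lemma represents_w_inv: "represents N lam (wxL_inv N) (bw_inv N lam) [(1, \<lambda>j. j + 1)]"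
proof -
  have N0: "0 < N" using N2 by simp
  have inj: "inj_on (wxL N) (LP N)"
    by (rule inj_on_inverseI[where g = "lp_w_inv N"]) (simp add: wxL_def ropL_def lp_w_inv_lp_w N0)
  have w: "wxL_inv N p = lp_w_inv N p" if "p \<in> LP N" for p
    using the_inv_into_f_eq[OF inj, of "lp_w_inv N p" p] that LP_lp_w_inv[OF that N0]
    by (simp add: wxL_inv_def ropL_def wxL_def lp_w_lp_w_inv N0)
  have injV: "inj_on (bw N lam) (VP N lam)"
  proof (rule inj_onI)
    fix F G assume FG: "F \<in> VP N lam" "G \<in> VP N lam" "bw N lam F = bw N lam G"
    then have "rot_op N lam (lift F) = rot_op N lam (lift G)" using bw_rot_op(2) by metis
    then have "lift F = lift G" using rot_op_rot_op_inv(2)[OF part N2] by metis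
    then show "F = G" by (rule lift_inj)
  qed
  have bw: "bw_inv N lam F \<in> VP N lam" "lift (bw_inv N lam F) = rot_op_inv N lam (lift F)" if F: "F \<in> VP N lam" for F
  proof -
    obtain G where G: "G \<in> VP N lam" "lift G = rot_op_inv N lam (lift F)" using rot_op_inv_VP[OF F] by blast
    have "lift (bw N lam G) = lift F" using bw_rot_op(2)[OF G(1)] G(2) rot_op_rot_op_inv(1)[OF part N2] by simp
    then have "bw N lam G = F" by (rule lift_inj)
    then have "the_inv_into (VP N lam) (bw N lam) F = G" by (rule the_inv_into_f_eq[OF injV _ G(1)])
    then show "bw_inv N lam F \<in> VP N lam" "lift (bw_inv N lam F) = rot_op_inv N lam (lift F)" using F G by (simp_all add: bw_inv_def ropV_def)
  qed
  have "to_fract (bw_inv N lam F T) = rot_op_inv N lam (lift F) T" if "F \<in> VP N lam" for F T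
    using bw(2)[OF that] by (metis lift_def)
  then show ?thesis
    using affine_shift_window[of 1 "int N"] bw(1) window_op_shift_plus[OF part N2] window_aut_values(4) w LP_lp_w_inv[OF _ N0] rot_aut_inv_to_fract[OF N0]
    by (auto simp: represents_def comb_def) (simp_all add: bw_inv_def ropV_def wxL_inv_def ropL_def)
qed

lemma represents_T:
  assumes i: "1 \<le> i" "i < N"
  shows "represents N lam (TxL N i) (bT N lam i)
    [(xcoef N (int i) (int i + 1), id), (rconst sK - xcoef N (int i) (int i + 1), affine_swap (int N) (int i))]"
proof -
  let ?a = "xcoef N (int i) (int i + 1)"
  have i1: "1 \<le> i + 1" "i + 1 \<le> N" using i by auto
  have 1: "TxL N i p \<in> LP N" if "p \<in> LP N" for p
    using that i1 unfolding TxL_def ropL_def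
    by (auto intro!: LP_add LP_mult LP_lconst LP_Xv ddiff_LP(1)[OF i] LP_lp_swap i simp del: One_nat_def)
  have 2: "to_fract (TxL N i p) = ?a * to_fract p + (rconst sK - ?a) * swap_aut i (to_fract p)" if "p \<in> LP N" for p
  proof -
    have "to_fract (TxL N i p) = to_fract (lconst (1 - sK) * Xv (i + 1) * ddiff i p) + rconst sK * swap_aut i (to_fract p)"
      using that by (simp add: TxL_def ropL_def swap_aut_to_fract)
    then show ?thesis unfolding to_fract_ddiff[OF i that] by (simp add: algebra_simps)
  qed
  have 3: "bT N lam i F \<in> VP N lam" if "F \<in> VP N lam" for F
    using that i1 unfolding bT_def ropV_def VP_def
    by (auto intro!: LP_add LP_mult LP_lconst LP_Xv ddiff_LP(1)[OF i] LP_sum LP_lp_swap i LP_zero simp del: One_nat_def)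
  have 4: "to_fract (bT N lam i F T) = ?a * lift F T + (rconst sK - ?a) * swap_op N lam i (lift F) T" if F: "F \<in> VP N lam" for F T
  proof (cases "T \<in> Tab N lam")
    case True
    have "to_fract (bT N lam i F T) = to_fract (lconst (1 - sK) * Xv (i + 1) * ddiff i (F T))
        + hecke N lam i (\<lambda>T. swap_aut i (lift F T)) T"
      using F True by (simp add: bT_def ropV_def swap_aut_to_fract hecke_def lift_def)
    \<comment> \<open>Regrouping puts the two terms in \<open>swap_aut\<close> into the numerator of
      the normalised intertwiner; the factor \<open>s - a\<close> then cancels its
      denominator.\<close>
    also have "\<dots> = ?a * lift F T + (hecke N lam i (\<lambda>T. swap_aut i (lift F T)) T - ?a * swap_aut i (lift F T))"
      unfolding to_fract_ddiff[OF i VP_D(1)[OF F]] by (simp add: lift_def algebra_simps)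
    finally show ?thesis using xcoef_neq[OF i] by (simp add: swap_op_def rmat_def)
  next
    case False
    then have "lift F T = 0" using F by (simp add: lift_def VP_D)
    moreover have "swap_op N lam i (lift F) T = 0"
      using semilinear_swap_op[OF part N2 i] False \<open>lift F T = 0\<close> by (simp add: semilinear_op_def)
    ultimately show ?thesis using F False by (simp add: bT_def ropV_def)
  qed
  have "affine_swap (int N) (int i) \<in> affine_window (int N)" using N2 by (intro affine_swap_window) simp
  moreover have "p \<notin> LP N \<Longrightarrow> TxL N i p = 0" for p by (simp add: TxL_def ropL_def)
  moreover have "F \<notin> VP N lam \<Longrightarrow> bT N lam i F = (\<lambda>_. 0)" for F by (simp add: bT_def ropV_def)
  ultimately show ?thesis
    using 1 2 3 4 id_window window_op_id[OF part N2] window_op_swap[OF part N2 i] window_aut_values(1) window_aut_values(2)[OF i]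
    by (simp add: represents_def comb_def)
qed

lemma represents_x:
  assumes "1 \<le> i" "i \<le> N"
  shows "represents N lam (xL N i) (bx N lam i) [(to_fract (Xv i), id)]"
    "represents N lam (xL_inv N i) (bx_inv N lam i) [(to_fract (Xinv i), id)]"
  unfolding xL_def bx_def xL_inv_def bx_inv_def by (intro represents_mult LP_Xv LP_Xinv assms)+

text \<open>Building the partner along the generation of \<open>f\<close> keeps it inside the second
  algebra, so the image of the map lies there.\<close>

lemma HL_represents: "f \<in> HL N \<Longrightarrow> \<exists>h\<in>HV N lam. \<exists>xs. represents N lam f h xs"
  unfolding HL_def HV_def
proof (induction rule: gen_alg.induct)
  case unit
  then show ?case using represents_unit by (blast intro: gen_alg.unit)
next
  case (gen g)
  have "i \<le> N - 1 \<Longrightarrow> i < N" for i using N2 by simp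
  then show ?case using gen represents_T represents_w represents_w_inv represents_x by (blast intro: gen_alg.gen)
next
  case (add f g)
  then show ?case using represents_add by (blast intro: gen_alg.add)
next
  case (smul f c)
  then show ?case using represents_smult by (blast intro: gen_alg.smul)
next
  case (comp f g)
  then show ?case using represents_comp by (blast intro: gen_alg.comp)
qed

text \<open>The same induction started from the other algebra gives surjectivity.\<close>

lemma HV_represents: "h \<in> HV N lam \<Longrightarrow> \<exists>f\<in>HL N. \<exists>xs. represents N lam f h xs"
  unfolding HL_def HV_def
proof (induction rule: gen_alg.induct)
  case unit
  then show ?case using represents_unit by (blast intro: gen_alg.unit)
next
  case (gen g)
  have "i \<le> N - 1 \<Longrightarrow> i < N" for i using N2 by simp
  then show ?case using gen represents_T represents_w represents_w_inv represents_x by (blast intro: gen_alg.gen)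
next
  case (add h k)
  then obtain f g xs ys where fg: "f \<in> HL N" "g \<in> HL N" "represents N lam f h xs" "represents N lam g k ys"
    unfolding HL_def by blast
  from gen_alg.add[OF fg(1,2)[unfolded HL_def]] represents_add[OF fg(3,4)] show ?case by blast
next
  case (smul h c)
  then obtain f xs where f: "f \<in> HL N" "represents N lam f h xs" unfolding HL_def by blast
  from gen_alg.smul[OF f(1)[unfolded HL_def], of c] represents_smult[OF f(2), of c] show ?case by blast
next
  case (comp h k)
  then obtain f g xs ys where fg: "f \<in> HL N" "g \<in> HL N" "represents N lam f h xs" "represents N lam g k ys"
    unfolding HL_def by blast
  from gen_alg.comp[OF fg(1,2)[unfolded HL_def]] represents_comp[OF fg(3,4)] show ?case by blast
qed

end

theorem theorem3p1:
  fixes N :: nat and lam :: "nat list"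
  assumes "N \<ge> 2" and "is_partition N lam"
  shows "\<exists>\<phi>. bij_betw \<phi> (HL N) (HV N lam)
    \<and> (\<forall>f\<in>HL N. \<forall>g\<in>HL N. \<phi> (f \<circ> g) = \<phi> f \<circ> \<phi> g)
    \<and> (\<forall>f\<in>HL N. \<forall>g\<in>HL N. \<phi> (\<lambda>p. f p + g p) = (\<lambda>F. addV (\<phi> f F) (\<phi> g F)))
    \<and> (\<forall>f\<in>HL N. \<forall>c. \<phi> (\<lambda>p. lconst c * f p) = (\<lambda>F. smV c (\<phi> f F)))
    \<and> \<phi> (ropL N id) = ropV N lam id
    \<and> (\<forall>i. 1 \<le> i \<and> i \<le> N - 1 \<longrightarrow> \<phi> (TxL N i) = bT N lam i)
    \<and> \<phi> (wxL N) = bw N lam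
    \<and> (\<forall>i. 1 \<le> i \<and> i \<le> N \<longrightarrow> \<phi> (xL N i) = bx N lam i)"
proof -
  note pN = assms(2,1)
  \<comment> \<open>By \<open>represents_unique\<close> the choice is forced, so each required value
    follows from exhibiting any one common expansion.\<close>
  define \<phi> where "\<phi> f = (SOME h. \<exists>xs. represents N lam f h xs)" for f
  have val: "\<phi> f = h" if "represents N lam f h xs" for f h xs
  proof -
    have "\<exists>h xs. represents N lam f h xs" using that by blast
    from someI_ex[OF this] have "\<exists>xs. represents N lam f (\<phi> f) xs" unfolding \<phi>_def .
    then show ?thesis using represents_unique[OF pN] that by blast
  qed
  have represents: "\<exists>xs. represents N lam f (\<phi> f) xs" "\<phi> f \<in> HV N lam" if "f \<in> HL N" for f
    using HL_represents[OF pN that] val by blast+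
  have "inj_on \<phi> (HL N)"
  proof (rule inj_onI)
    fix f g assume "f \<in> HL N" "g \<in> HL N" "\<phi> f = \<phi> g"
    then show "f = g" using represents(1) represents_unique[OF pN] by metis
  qed
  moreover have "\<phi> ` HL N = HV N lam" using represents(2) HV_represents[OF pN] val by blast
  ultimately have "bij_betw \<phi> (HL N) (HV N lam)" by (simp add: bij_betw_def)
  moreover have "\<phi> (f \<circ> g) = \<phi> f \<circ> \<phi> g" if "f \<in> HL N" "g \<in> HL N" for f g
    using represents(1)[OF that(1)] represents(1)[OF that(2)] represents_comp[OF pN] val by blast
  moreover have "\<phi> (\<lambda>p. f p + g p) = (\<lambda>F. addV (\<phi> f F) (\<phi> g F))" if "f \<in> HL N" "g \<in> HL N" for f g
    using represents(1)[OF that(1)] represents(1)[OF that(2)] represents_add[OF pN] val by blast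
  moreover have "\<phi> (\<lambda>p. lconst c * f p) = (\<lambda>F. smV c (\<phi> f F))" if "f \<in> HL N" for f c
    using represents(1)[OF that] represents_smult[OF pN] val by blast
  moreover have "\<phi> (ropL N id) = ropV N lam id" by (rule val[OF represents_unit[OF pN]])
  moreover have "\<phi> (TxL N i) = bT N lam i" if "1 \<le> i \<and> i \<le> N - 1" for i
    by (rule val[OF represents_T[OF pN]]) (use that assms in auto)
  moreover have "\<phi> (wxL N) = bw N lam" by (rule val[OF represents_w[OF pN]])
  moreover have "\<phi> (xL N i) = bx N lam i" if "1 \<le> i \<and> i \<le> N" for i
    by (rule val[OF represents_x(1)[OF pN]]) (use that in auto)
  ultimately show ?thesis by blast
qed

end
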